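(* Let $\Theta=\tilde p/p$ be a rational inner function on $\mathbb{D}^2$ of degree $(m,n)$, let $\mathcal{K}_\Theta=\mathcal{S}_1\oplus\mathcal{S}_2$ be an orthogonal decomposition into closed subspaces with $\mathcal{S}_1$ invariant under $M_{z_1}$ and $\mathcal{S}_2$ invariant under $M_{z_2}$, and let $S^1_\Theta=P_{\mathcal{S}_2}M_{z_1}|_{\mathcal{S}_2}$. Then the numerical radius satisfies $w(S^1_\Theta)=1$ if and only if $\Theta$ has a singularity on $\mathbb{T}^2$.
   Context: $\mathbb{D}$ is the open unit disk, $\mathbb{T}$ the unit circle. A rational inner function on $\mathbb{D}^2$ is a rational function holomorphic on $\mathbb{D}^2$ with $|\Theta|=1$ a.e. on $\mathbb{T}^2$; its degree $(m,n)$: writing $\Theta=q/p$ in lowest terms, $m$ (resp. $n$) is the highest power of $z_1$ (resp. $z_2$) in $p$ or $q$. One may write $\Theta=\tilde p/p$ with $p$ a polynomial with no zeros on $\mathbb{D}^2$, $\tilde p(z)=z_1^mz_2^n\overline{p(1/\bar z_1,1/\bar z_2)}$, $p,\tilde p$ coprime; $p$ and $\tilde p$ have the same zeros on $\mathbb{T}^2$, and $\Theta$ has a singularity at a point of $\mathbb{T}^2$ exactly when $p$ vanishes there. $\mathcal{K}_\Theta=H^2(\mathbb{D}^2)\ominus\Theta H^2(\mathbb{D}^2)$. The numerical radius of $T$ is $w(T)=\sup\{|\lambda|:\lambda\in\mathcal{W}(T)\}$, where $\mathcal{W}(T)=\{\langle Th,h\rangle:\|h\|=1\}$. *)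

theory Defs
  imports "HOL-Analysis.Analysis"
begin

definition bidisk :: "(complex \<times> complex) set" where
  "bidisk = {(z1, z2). cmod z1 < 1 \<and> cmod z2 < 1}"

definition torus2 :: "(complex \<times> complex) set" where
  "torus2 = {(z1, z2). cmod z1 = 1 \<and> cmod z2 = 1}"

definition is_bipoly :: "(nat \<times> nat \<Rightarrow> complex) \<Rightarrow> bool" where
  "is_bipoly c \<longleftrightarrow> finite {k. c k \<noteq> 0}"

definition bipoly_eval :: "(nat \<times> nat \<Rightarrow> complex) \<Rightarrow> complex \<times> complex \<Rightarrow> complex" where
  "bipoly_eval c z = (\<Sum>k\<in>{k. c k \<noteq> 0}. c k * fst z ^ fst k * snd z ^ snd k)"

definition bipoly_deg_le :: "(nat \<times> nat \<Rightarrow> complex) \<Rightarrow> nat \<Rightarrow> nat \<Rightarrow> bool" where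
  "bipoly_deg_le c m n \<longleftrightarrow> (\<forall>i j. c (i, j) \<noteq> 0 \<longrightarrow> i \<le> m \<and> j \<le> n)"

text \<open>The reflection p~(z) = z1^m z2^n conj(p(1/conj z1, 1/conj z2)), at the level of coefficients
  (valid for p of degree at most (m,n)).\<close>
definition reflect :: "nat \<Rightarrow> nat \<Rightarrow> (nat \<times> nat \<Rightarrow> complex) \<Rightarrow> (nat \<times> nat \<Rightarrow> complex)" where
  "reflect m n p = (\<lambda>(i, j). if i \<le> m \<and> j \<le> n then cnj (p (m - i, n - j)) else 0)"

definition bipoly_coprime :: "(nat \<times> nat \<Rightarrow> complex) \<Rightarrow> (nat \<times> nat \<Rightarrow> complex) \<Rightarrow> bool" where
  "bipoly_coprime p q \<longleftrightarrow>
     (\<forall>r s t. is_bipoly r \<and> is_bipoly s \<and> is_bipoly t \<and>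
        (\<forall>z. bipoly_eval p z = bipoly_eval r z * bipoly_eval s z) \<and>
        (\<forall>z. bipoly_eval q z = bipoly_eval r z * bipoly_eval t z)
        \<longrightarrow> (\<exists>c. \<forall>z. bipoly_eval r z = c))"

definition rat_degree :: "(nat \<times> nat \<Rightarrow> complex) \<Rightarrow> (nat \<times> nat \<Rightarrow> complex) \<Rightarrow> nat \<Rightarrow> nat \<Rightarrow> bool" where
  "rat_degree q p m n \<longleftrightarrow>
     bipoly_deg_le p m n \<and> bipoly_deg_le q m n \<and>
     (\<exists>j. p (m, j) \<noteq> 0 \<or> q (m, j) \<noteq> 0) \<and>
     (\<exists>i. p (i, n) \<noteq> 0 \<or> q (i, n) \<noteq> 0)"

definition rif :: "nat \<Rightarrow> nat \<Rightarrow> (nat \<times> nat \<Rightarrow> complex) \<Rightarrow> complex \<times> complex \<Rightarrow> complex" where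
  "rif m n p z = bipoly_eval (reflect m n p) z / bipoly_eval p z"

text \<open>Theta has a singularity at a point of T^2 exactly when p vanishes there (standing fact
  of the paper, used as the definition).\<close>
definition has_singularity_on_torus :: "(nat \<times> nat \<Rightarrow> complex) \<Rightarrow> bool" where
  "has_singularity_on_torus p \<longleftrightarrow> (\<exists>z\<in>torus2. bipoly_eval p z = 0)"

section \<open>Hardy space H^2 of the bidisk, via Taylor coefficients\<close>

definition H2 :: "(nat \<times> nat \<Rightarrow> complex) set" where
  "H2 = {f. (\<lambda>k. (cmod (f k))\<^sup>2) summable_on UNIV}"

definition h2_inner :: "(nat \<times> nat \<Rightarrow> complex) \<Rightarrow> (nat \<times> nat \<Rightarrow> complex) \<Rightarrow> complex" where
  "h2_inner f g = (\<Sum>\<^sub>\<infinity>k. f k * cnj (g k))"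

definition h2_norm :: "(nat \<times> nat \<Rightarrow> complex) \<Rightarrow> real" where
  "h2_norm f = sqrt (\<Sum>\<^sub>\<infinity>k. (cmod (f k))\<^sup>2)"

definition h2_eval :: "(nat \<times> nat \<Rightarrow> complex) \<Rightarrow> complex \<times> complex \<Rightarrow> complex" where
  "h2_eval f z = (\<Sum>\<^sub>\<infinity>k. f k * fst z ^ fst k * snd z ^ snd k)"

definition Mz1 :: "(nat \<times> nat \<Rightarrow> complex) \<Rightarrow> (nat \<times> nat \<Rightarrow> complex)" where
  "Mz1 f = (\<lambda>(i, j). if i = 0 then 0 else f (i - 1, j))"

definition Mz2 :: "(nat \<times> nat \<Rightarrow> complex) \<Rightarrow> (nat \<times> nat \<Rightarrow> complex)" where
  "Mz2 f = (\<lambda>(i, j). if j = 0 then 0 else f (i, j - 1))"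

definition mult_range :: "(complex \<times> complex \<Rightarrow> complex) \<Rightarrow> (nat \<times> nat \<Rightarrow> complex) set" where
  "mult_range \<Theta> = {g \<in> H2. \<exists>f\<in>H2. \<forall>z\<in>bidisk. h2_eval g z = \<Theta> z * h2_eval f z}"

definition h2_orth_compl :: "(nat \<times> nat \<Rightarrow> complex) set \<Rightarrow> (nat \<times> nat \<Rightarrow> complex) set" where
  "h2_orth_compl S = {f \<in> H2. \<forall>g\<in>S. h2_inner f g = 0}"

definition model_space :: "(complex \<times> complex \<Rightarrow> complex) \<Rightarrow> (nat \<times> nat \<Rightarrow> complex) set" where
  "model_space \<Theta> = h2_orth_compl (mult_range \<Theta>)"

definition h2_closed_subspace :: "(nat \<times> nat \<Rightarrow> complex) set \<Rightarrow> bool" where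
  "h2_closed_subspace S \<longleftrightarrow>
     S \<subseteq> H2 \<and> (\<lambda>k. 0) \<in> S \<and>
     (\<forall>f\<in>S. \<forall>g\<in>S. (\<lambda>k. f k + g k) \<in> S) \<and>
     (\<forall>a. \<forall>f\<in>S. (\<lambda>k. a * f k) \<in> S) \<and>
     (\<forall>X f. (\<forall>k. X k \<in> S) \<and> f \<in> H2 \<and> (\<lambda>k. h2_norm (\<lambda>i. X k i - f i)) \<longlonglongrightarrow> 0 \<longrightarrow> f \<in> S)"

definition h2_proj :: "(nat \<times> nat \<Rightarrow> complex) set \<Rightarrow> (nat \<times> nat \<Rightarrow> complex) \<Rightarrow> (nat \<times> nat \<Rightarrow> complex)" where
  "h2_proj S f = (THE g. g \<in> S \<and> (\<forall>h\<in>S. h2_inner (\<lambda>k. f k - g k) h = 0))"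

text \<open>Numerical radius of an operator T on the subspace S: sup of |<Th,h>| over unit h in S
  (taken to be 0 when S = {0}).\<close>
definition num_radius :: "(nat \<times> nat \<Rightarrow> complex) set \<Rightarrow> ((nat \<times> nat \<Rightarrow> complex) \<Rightarrow> (nat \<times> nat \<Rightarrow> complex)) \<Rightarrow> real" where
  "num_radius S T = Sup (insert 0 {cmod (h2_inner (T h) h) | h. h \<in> S \<and> h2_norm h = 1})"

end

theory Submission
  imports Defs
    "HOL-Computational_Algebra.Polynomial_FPS"
    "HOL-Computational_Algebra.Fundamental_Theorem_Algebra"
    "HOL-Computational_Algebra.Polynomial_Factorial"
    "HOL-Computational_Algebra.Field_as_Ring"
begin

text \<open>
  Since \<open>S\<^sub>2\<close> is invariant under \<open>z\<^sub>2\<close>, every \<open>h\<close> in it lies in the space \<open>W\<close> of all \<open>h \<in> H\<^sup>2\<close> for which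
  \<open>p h\<close> has degree less than \<open>m\<close> in \<open>z\<^sub>1\<close>, and the numerical radius is the supremum of \<open>|\<langle>z\<^sub>1 h, h\<rangle>|\<close> over
  unit vectors.

  If \<open>|p| \<ge> \<delta> > 0\<close> on the torus, then \<open>\<parallel>p h\<parallel> \<ge> \<delta> \<parallel>h\<parallel>\<close>. A unit vector \<open>h \<in> W\<close> with \<open>|\<langle>z\<^sub>1 h, h\<rangle>|\<close> close to 1
  is nearly an eigenvector, \<open>z\<^sub>1 h \<approx> \<lambda> h\<close>, hence \<open>(z\<^sub>1 - \<lambda>) p h \<approx> 0\<close>, which for a polynomial of bounded degree
  in \<open>z\<^sub>1\<close> forces \<open>p h \<approx> 0\<close>, a contradiction.

  Conversely suppose that the numerical radius is \<open>w < 1\<close>. As \<open>S\<^sub>1 \<inter> W\<close> has finite dimension, the component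
  of \<open>z\<^sub>2\<^sup>N h\<close> in \<open>S\<^sub>1\<close> tends to 0 for \<open>h \<in> W\<close>, so \<open>|\<langle>z\<^sub>1 h, h\<rangle>| \<le> w \<parallel>h\<parallel>\<^sup>2\<close> on all of \<open>W\<close>. If \<open>p(\<alpha>, \<beta>) = 0\<close> with
  \<open>|\<beta>| < 1\<close>, then \<open>h \<mapsto> (p h)(\<alpha>, \<beta>)\<close> is an eigenfunctional with eigenvalue \<open>1/\<alpha>\<close> of the backward shift in \<open>z\<^sub>1\<close>, so
  it vanishes on \<open>W\<close> as soon as \<open>w |\<alpha>| < 1\<close>; applied to the backward shift of \<open>\<Theta>\<close> this gives \<open>p~(\<alpha>, \<beta>) = 0\<close>.
  By coprimality this happens for finitely many \<open>\<beta>\<close> only, so near \<open>\<tau>\<^sub>2\<close> the sections \<open>p(\<cdot>, \<beta>)\<close> have no zeros in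
  a disk of radius greater than 1; a zero \<open>(\<tau>\<^sub>1, \<tau>\<^sub>2)\<close> on the torus then forces \<open>p(\<cdot>, \<tau>\<^sub>2) = 0\<close>, and \<open>z\<^sub>2 - \<tau>\<^sub>2\<close>
  divides both \<open>p\<close> and \<open>p~\<close>.
\<close>

section \<open>The Hardy space as a Hilbert space\<close>

text \<open>Uniformly bounded finite partial sums give membership and norm bound at once; most
  estimates below are therefore made on finite index sets.\<close>

lemma H2_sumI:
  assumes "\<And>F. finite F \<Longrightarrow> (\<Sum>k\<in>F. (cmod (x k))\<^sup>2) \<le> C\<^sup>2" and "C \<ge> 0"
  shows "x \<in> H2" "h2_norm x \<le> C"
proof -
  have sm: "(\<lambda>k. (cmod (x k))\<^sup>2) summable_on UNIV"
    by (rule nonneg_bdd_above_summable_on) (auto intro!: bdd_aboveI2[where M = "C\<^sup>2"] assms(1))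
  then show "x \<in> H2" by (simp add: H2_def)
  have "(\<Sum>\<^sub>\<infinity>k. (cmod (x k))\<^sup>2) \<le> C\<^sup>2"
    by (rule infsum_le_finite_sums[OF sm]) (use assms in auto)
  then show "h2_norm x \<le> C"
    unfolding h2_norm_def using assms(2) by (simp add: real_le_lsqrt)
qed

lemma h2_norm_sq: "(h2_norm x)\<^sup>2 = (\<Sum>\<^sub>\<infinity>k. (cmod (x k))\<^sup>2)"
  unfolding h2_norm_def by (simp add: infsum_nonneg)

lemma h2_norm_nonneg [simp]: "h2_norm x \<ge> 0"
  unfolding h2_norm_def by (simp add: infsum_nonneg)

lemma sum_le_h2_norm_sq:
  assumes "x \<in> H2" "finite F"
  shows "(\<Sum>k\<in>F. (cmod (x k))\<^sup>2) \<le> (h2_norm x)\<^sup>2"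
  unfolding h2_norm_sq using assms by (intro finite_sum_le_infsum) (auto simp: H2_def)

lemma L2_set_le_h2_norm:
  assumes "x \<in> H2" "finite F"
  shows "L2_set (\<lambda>k. cmod (x k)) F \<le> h2_norm x"
  unfolding L2_set_def using sum_le_h2_norm_sq[OF assms] by (simp add: real_le_lsqrt)

lemma H2_L2_setI:
  assumes "\<And>F. finite F \<Longrightarrow> L2_set (\<lambda>k. cmod (x k)) F \<le> C" and "C \<ge> 0"
  shows "x \<in> H2" "h2_norm x \<le> C"
proof -
  have "(\<Sum>k\<in>F. (cmod (x k))\<^sup>2) \<le> C\<^sup>2" if "finite F" for F
    using assms(1)[OF that] assms(2) unfolding L2_set_def by (metis real_sqrt_le_iff real_sqrt_unique)
  from H2_sumI[OF this assms(2)] show "x \<in> H2" "h2_norm x \<le> C" by auto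
qed

lemma cmod_le_h2_norm:
  assumes "x \<in> H2" shows "cmod (x k) \<le> h2_norm x"
  using L2_set_le_h2_norm[OF assms, of "{k}"] by simp

lemma H2_mono:
  assumes "y \<in> H2" "\<And>k. cmod (x k) \<le> cmod (y k)"
  shows "x \<in> H2" "h2_norm x \<le> h2_norm y"
proof -
  have "L2_set (\<lambda>k. cmod (x k)) F \<le> h2_norm y" if "finite F" for F
    using L2_set_mono[of F "\<lambda>k. cmod (x k)" "\<lambda>k. cmod (y k)"] L2_set_le_h2_norm[OF assms(1) that] assms(2)
    by fastforce
  from H2_L2_setI[OF this] show "x \<in> H2" "h2_norm x \<le> h2_norm y" by auto
qed

lemma H2_add:
  assumes "x \<in> H2" "y \<in> H2"
  shows "(\<lambda>k. x k + y k) \<in> H2" "h2_norm (\<lambda>k. x k + y k) \<le> h2_norm x + h2_norm y"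
proof -
  have "L2_set (\<lambda>k. cmod (x k + y k)) F \<le> h2_norm x + h2_norm y" if "finite F" for F
  proof -
    have "L2_set (\<lambda>k. cmod (x k + y k)) F \<le> L2_set (\<lambda>k. cmod (x k) + cmod (y k)) F"
      by (rule L2_set_mono) (auto simp: norm_triangle_ineq)
    also have "\<dots> \<le> L2_set (\<lambda>k. cmod (x k)) F + L2_set (\<lambda>k. cmod (y k)) F"
      by (rule L2_set_triangle_ineq)
    finally show ?thesis using L2_set_le_h2_norm[OF assms(1) that] L2_set_le_h2_norm[OF assms(2) that] by linarith
  qed
  from H2_L2_setI[OF this] show "(\<lambda>k. x k + y k) \<in> H2" "h2_norm (\<lambda>k. x k + y k) \<le> h2_norm x + h2_norm y" by auto
qed

lemma H2_zero [simp]: "(\<lambda>k. 0) \<in> H2" "h2_norm (\<lambda>k. 0) = 0"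
  by (simp_all add: H2_def h2_norm_def)

lemma H2_cmult:
  assumes "x \<in> H2"
  shows "(\<lambda>k. a * x k) \<in> H2" "h2_norm (\<lambda>k. a * x k) = cmod a * h2_norm x"
proof -
  show "(\<lambda>k. a * x k) \<in> H2"
    using assms unfolding H2_def by (auto simp: norm_mult power_mult_distrib intro: summable_on_cmult_right)
  show "h2_norm (\<lambda>k. a * x k) = cmod a * h2_norm x"
    unfolding h2_norm_def by (simp add: norm_mult power_mult_distrib infsum_cmult_right' real_sqrt_mult)
qed

lemma H2_minus:
  assumes "x \<in> H2"
  shows "(\<lambda>k. - x k) \<in> H2" "h2_norm (\<lambda>k. - x k) = h2_norm x"
  using H2_cmult[OF assms, of "-1"] by auto

lemma H2_diff:
  assumes "x \<in> H2" "y \<in> H2"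
  shows "(\<lambda>k. x k - y k) \<in> H2" "h2_norm (\<lambda>k. x k - y k) \<le> h2_norm x + h2_norm y"
  using H2_add[OF assms(1) H2_minus(1)[OF assms(2)]] H2_minus(2)[OF assms(2)] by simp_all

lemma h2_norm_minus_commute: "h2_norm (\<lambda>k. x k - y k) = h2_norm (\<lambda>k. y k - x k)"
  unfolding h2_norm_def by (simp add: norm_minus_commute)

lemma H2_sum:
  assumes "finite A" "\<And>a. a \<in> A \<Longrightarrow> x a \<in> H2"
  shows "(\<lambda>k. \<Sum>a\<in>A. x a k) \<in> H2"
  using assms by (induction A rule: finite_induct) (auto intro!: H2_add)

lemma H2_finite_support:
  assumes "finite {k. x k \<noteq> 0}" shows "x \<in> H2"
  unfolding H2_def using assms
  by (auto intro!: finite_nonzero_values_imp_summable_on simp: power2_eq_square)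

lemma h2_norm_eq_0:
  assumes "x \<in> H2" "h2_norm x = 0" shows "x k = 0"
  using cmod_le_h2_norm[OF assms(1), of k] assms(2) by simp

section \<open>Inner product and the Cauchy-Schwarz inequality\<close>

lemma h2_inner_abs_summable:
  assumes "x \<in> H2" "y \<in> H2"
  shows "(\<lambda>k. cmod (x k * cnj (y k))) summable_on UNIV"
proof (rule summable_on_comparison_test)
  show "(\<lambda>k. (cmod (x k))\<^sup>2 + (cmod (y k))\<^sup>2) summable_on UNIV"
    using assms by (intro summable_on_add) (auto simp: H2_def)
  fix k
  have "0 \<le> (cmod (x k) - cmod (y k))\<^sup>2" "0 \<le> cmod (x k) * cmod (y k)" by auto
  then have "cmod (x k) * cmod (y k) \<le> (cmod (x k))\<^sup>2 + (cmod (y k))\<^sup>2"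
    unfolding power2_diff by linarith
  then show "cmod (x k * cnj (y k)) \<le> (cmod (x k))\<^sup>2 + (cmod (y k))\<^sup>2"
    by (simp add: norm_mult)
qed auto

lemma h2_inner_summable:
  assumes "x \<in> H2" "y \<in> H2"
  shows "(\<lambda>k. x k * cnj (y k)) summable_on UNIV"
  using abs_summable_summable[OF h2_inner_abs_summable[OF assms]] .

lemma h2_inner_add_left:
  assumes "x \<in> H2" "y \<in> H2" "z \<in> H2"
  shows "h2_inner (\<lambda>k. x k + y k) z = h2_inner x z + h2_inner y z"
  unfolding h2_inner_def using infsum_add[OF h2_inner_summable[OF assms(1,3)] h2_inner_summable[OF assms(2,3)]]
  by (simp add: algebra_simps)

lemma h2_inner_cmult_left: "h2_inner (\<lambda>k. a * x k) y = a * h2_inner x y"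
  unfolding h2_inner_def by (simp add: mult.assoc infsum_cmult_right')

lemma h2_inner_commute: "h2_inner x y = cnj (h2_inner y x)"
  unfolding h2_inner_def by (simp flip: infsum_cnj add: mult.commute)

lemma h2_inner_add_right:
  assumes "x \<in> H2" "y \<in> H2" "z \<in> H2"
  shows "h2_inner z (\<lambda>k. x k + y k) = h2_inner z x + h2_inner z y"
  using h2_inner_add_left[OF assms] by (metis h2_inner_commute complex_cnj_add)

lemma h2_inner_cmult_right: "h2_inner x (\<lambda>k. a * y k) = cnj a * h2_inner x y"
  by (metis h2_inner_commute h2_inner_cmult_left complex_cnj_mult)

lemma h2_inner_diff_left:
  assumes "x \<in> H2" "y \<in> H2" "z \<in> H2"
  shows "h2_inner (\<lambda>k. x k - y k) z = h2_inner x z - h2_inner y z"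
  using h2_inner_add_left[OF assms(1) H2_cmult(1)[OF assms(2), of "-1"] assms(3)]
  h2_inner_cmult_left[of "-1" y z] by simp

lemma h2_inner_diff_right:
  assumes "x \<in> H2" "y \<in> H2" "z \<in> H2"
  shows "h2_inner z (\<lambda>k. x k - y k) = h2_inner z x - h2_inner z y"
  using h2_inner_diff_left[OF assms] by (metis h2_inner_commute complex_cnj_diff)

lemma h2_inner_zero [simp]: "h2_inner (\<lambda>k. 0) y = 0" "h2_inner y (\<lambda>k. 0) = 0"
  by (simp_all add: h2_inner_def)

lemma h2_inner_sum_right:
  assumes "finite A" "\<And>a. a \<in> A \<Longrightarrow> x a \<in> H2" "z \<in> H2"
  shows "h2_inner z (\<lambda>k. \<Sum>a\<in>A. c a * x a k) = (\<Sum>a\<in>A. cnj (c a) * h2_inner z (x a))"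
  using assms(1,2)
proof (induction A rule: finite_induct)
  case (insert a A)
  have "h2_inner z (\<lambda>k. c a * x a k + (\<Sum>a\<in>A. c a * x a k)) =
    h2_inner z (\<lambda>k. c a * x a k) + h2_inner z (\<lambda>k. \<Sum>a\<in>A. c a * x a k)"
    using insert by (intro h2_inner_add_right H2_cmult(1) H2_sum assms(3)) auto
  then show ?case using insert by (simp add: h2_inner_cmult_right)
qed simp

lemma h2_inner_self:
  assumes "x \<in> H2" shows "h2_inner x x = complex_of_real ((h2_norm x)\<^sup>2)"
proof -
  have "((\<lambda>k. complex_of_real ((cmod (x k))\<^sup>2)) has_sum complex_of_real ((h2_norm x)\<^sup>2)) UNIV"
    unfolding h2_norm_sq using assms by (intro has_sum_of_real has_sum_infsum) (simp add: H2_def)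
  then show ?thesis
    unfolding h2_inner_def complex_norm_square by (rule infsumI)
qed

lemma h2_Cauchy_Schwarz:
  assumes "x \<in> H2" "y \<in> H2"
  shows "cmod (h2_inner x y) \<le> h2_norm x * h2_norm y"
proof -
  have "cmod (h2_inner x y) \<le> (\<Sum>\<^sub>\<infinity>k. cmod (x k * cnj (y k)))"
    unfolding h2_inner_def by (rule norm_infsum_bound[OF h2_inner_abs_summable[OF assms]])
  also have "\<dots> \<le> h2_norm x * h2_norm y"
  proof (rule infsum_le_finite_sums[OF h2_inner_abs_summable[OF assms]])
    fix F :: "(nat \<times> nat) set" assume F: "finite F"
    have "(\<Sum>k\<in>F. cmod (x k * cnj (y k))) = (\<Sum>k\<in>F. \<bar>cmod (x k)\<bar> * \<bar>cmod (y k)\<bar>)"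
      by (simp add: norm_mult)
    also have "\<dots> \<le> L2_set (\<lambda>k. cmod (x k)) F * L2_set (\<lambda>k. cmod (y k)) F"
      by (rule L2_set_mult_ineq)
    also have "\<dots> \<le> h2_norm x * h2_norm y"
      by (intro mult_mono L2_set_le_h2_norm assms F) auto
    finally show "(\<Sum>k\<in>F. cmod (x k * cnj (y k))) \<le> h2_norm x * h2_norm y" .
  qed
  finally show ?thesis .
qed

lemma h2_norm_sq_diff:
  assumes "x \<in> H2" "y \<in> H2"
  shows "(h2_norm (\<lambda>k. x k - y k))\<^sup>2 = (h2_norm x)\<^sup>2 + (h2_norm y)\<^sup>2 - 2 * Re (h2_inner x y)"
proof -
  have "complex_of_real ((h2_norm (\<lambda>k. x k - y k))\<^sup>2)
     = h2_inner x x + h2_inner y y - (h2_inner x y + cnj (h2_inner x y))"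
    unfolding h2_inner_self[OF H2_diff(1)[OF assms], symmetric] using assms
    by (simp add: h2_inner_diff_left h2_inner_diff_right H2_diff h2_inner_commute[of y x])
  then have "Re (complex_of_real ((h2_norm (\<lambda>k. x k - y k))\<^sup>2))
     = Re (h2_inner x x + h2_inner y y - (h2_inner x y + cnj (h2_inner x y)))" by (simp only:)
  then show ?thesis using assms by (simp add: h2_inner_self)
qed

lemma h2_parallelogram:
  assumes "x \<in> H2" "y \<in> H2"
  shows "(h2_norm (\<lambda>k. x k - y k))\<^sup>2 + (h2_norm (\<lambda>k. x k + y k))\<^sup>2 = 2 * (h2_norm x)\<^sup>2 + 2 * (h2_norm y)\<^sup>2"
  using h2_norm_sq_diff[OF assms] h2_norm_sq_diff[OF assms(1) H2_cmult(1)[OF assms(2), of "-1"]]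
    H2_cmult(2)[OF assms(2), of "-1"] h2_inner_cmult_right[of x "-1" y] by simp

section \<open>Coefficientwise limits and weak convergence\<close>

text \<open>Each finite partial sum passes to the limit. The filter is arbitrary because the lemma
  serves both truncations (\<open>sequentially\<close>) and dilations
  (\<open>at_left 1\<close>).\<close>

lemma h2_Fatou:
  assumes "F \<noteq> bot" "\<forall>\<^sub>F N in F. X N \<in> H2 \<and> h2_norm (X N) \<le> C"
    and "\<And>k. ((\<lambda>N. X N k) \<longlongrightarrow> x k) F"
  shows "x \<in> H2" "h2_norm x \<le> C"
proof -
  obtain N where "h2_norm (X N) \<le> C"
    using eventually_happens'[OF assms(1,2)] by blast
  then have C: "C \<ge> 0" using h2_norm_nonneg[of "X N"] by linarith
  have "(\<Sum>k\<in>G. (cmod (x k))\<^sup>2) \<le> C\<^sup>2" if G: "finite G" for G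
  proof (rule tendsto_upperbound[OF _ _ assms(1)])
    show "((\<lambda>N. \<Sum>k\<in>G. (cmod (X N k))\<^sup>2) \<longlongrightarrow> (\<Sum>k\<in>G. (cmod (x k))\<^sup>2)) F"
      by (intro tendsto_intros assms(3))
    show "\<forall>\<^sub>F N in F. (\<Sum>k\<in>G. (cmod (X N k))\<^sup>2) \<le> C\<^sup>2"
      using assms(2)
    proof eventually_elim
      case (elim N)
      then show ?case using sum_le_h2_norm_sq[of "X N" G] G
        by (meson h2_norm_nonneg order_trans power_mono)
    qed
  qed
  from H2_sumI[OF this C] show "x \<in> H2" "h2_norm x \<le> C" by auto
qed

lemma h2_tail_small:
  assumes "b \<in> H2" "e > 0"
  obtains G where "finite G" "h2_norm (\<lambda>k. if k \<in> G then 0 else b k) < e"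
proof -
  have sm: "(\<lambda>k. (cmod (b k))\<^sup>2) summable_on UNIV" using assms by (simp add: H2_def)
  obtain G where G: "finite G" "dist (\<Sum>k\<in>G. (cmod (b k))\<^sup>2) (\<Sum>\<^sub>\<infinity>k. (cmod (b k))\<^sup>2) \<le> e\<^sup>2 / 2"
    using infsum_finite_approximation[OF sm, of "e\<^sup>2 / 2"] assms by auto
  have "(\<Sum>k\<in>F. (cmod (if k \<in> G then 0 else b k))\<^sup>2) \<le> (e / sqrt 2)\<^sup>2" if F: "finite F" for F
  proof -
    have "(\<Sum>k\<in>F. (cmod (if k \<in> G then 0 else b k))\<^sup>2) = (\<Sum>k\<in>F - G. (cmod (b k))\<^sup>2)"
      using F by (intro sum.mono_neutral_cong_right) auto
    also have "\<dots> = (\<Sum>k\<in>F \<union> G. (cmod (b k))\<^sup>2) - (\<Sum>k\<in>G. (cmod (b k))\<^sup>2)"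
      using F G by (simp add: sum_diff[symmetric] Un_Diff)
    also have "\<dots> \<le> (\<Sum>\<^sub>\<infinity>k. (cmod (b k))\<^sup>2) - (\<Sum>k\<in>G. (cmod (b k))\<^sup>2)"
      using F G by (intro diff_right_mono finite_sum_le_infsum sm) auto
    also have "\<dots> \<le> e\<^sup>2 / 2" using G(2) unfolding dist_real_def by linarith
    finally show ?thesis by (simp add: power_divide)
  qed
  from H2_sumI(2)[OF this] have "h2_norm (\<lambda>k. if k \<in> G then 0 else b k) \<le> e / sqrt 2"
    using assms by simp
  also have "\<dots> < e" using assms by (simp add: field_simps)
  finally show thesis using that G by blast
qed

text \<open>Split \<open>b\<close> into a finite part \<open>s\<close>, where only finitely many
  coefficients matter, and a tail \<open>t\<close>, whose contribution Cauchy-Schwarz bounds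
  uniformly in \<open>N\<close>.\<close>

lemma h2_weak_convergence:
  assumes "F \<noteq> bot" and ev: "\<forall>\<^sub>F N in F. X N \<in> H2 \<and> h2_norm (X N) \<le> C"
    and lim: "\<And>k. ((\<lambda>N. X N k) \<longlongrightarrow> x k) F" and b: "b \<in> H2"
  shows "((\<lambda>N. h2_inner (X N) b) \<longlongrightarrow> h2_inner x b) F"
proof (rule tendstoI)
  fix e :: real assume e: "e > 0"
  note x = h2_Fatou[OF assms(1-3)]
  have C: "C \<ge> 0" using x(2) h2_norm_nonneg[of x] by linarith
  \<comment> \<open>The summand 1 keeps the denominator positive when \<open>C\<close> is 0; the
    factor 4 leaves at most \<open>e / 2\<close> for the tails of \<open>X N\<close> and
    \<open>x\<close> together.\<close>
  define d where "d = e / (4 * (C + 1))"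
  have d: "d > 0" using e C by (simp add: d_def)
  obtain G where G: "finite G" "h2_norm (\<lambda>k. if k \<in> G then 0 else b k) < d"
    using h2_tail_small[OF b d] by blast
  define t where "t = (\<lambda>k. if k \<in> G then 0 else b k)"
  define s where "s = (\<lambda>k. if k \<in> G then b k else 0)"
  have t: "t \<in> H2" "h2_norm t < d" using H2_mono(1)[OF b, of t] G by (auto simp: t_def)
  have s: "s \<in> H2" using H2_mono(1)[OF b, of s] by (auto simp: s_def)
  have split: "h2_inner y b = (\<Sum>k\<in>G. y k * cnj (b k)) + h2_inner y t" if y: "y \<in> H2" for y
  proof -
    have "h2_inner y b = h2_inner y s + h2_inner y t"
      using h2_inner_add_right[OF s t(1) y] by (simp add: s_def t_def if_distrib cong: if_cong)
    also have "h2_inner y s = (\<Sum>\<^sub>\<infinity>k\<in>G. y k * cnj (b k))"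
      unfolding h2_inner_def by (rule infsum_cong_neutral) (auto simp: s_def)
    finally show ?thesis using G by simp
  qed
  have "((\<lambda>N. \<Sum>k\<in>G. X N k * cnj (b k)) \<longlongrightarrow> (\<Sum>k\<in>G. x k * cnj (b k))) F"
    by (intro tendsto_intros lim)
  then have "\<forall>\<^sub>F N in F. dist (\<Sum>k\<in>G. X N k * cnj (b k)) (\<Sum>k\<in>G. x k * cnj (b k)) < e / 2"
    using e by (intro tendstoD) auto
  then show "\<forall>\<^sub>F N in F. dist (h2_inner (X N) b) (h2_inner x b) < e"
    using ev
  proof eventually_elim
    case (elim N)
    have small: "cmod (h2_inner y t) \<le> e / 4" if y: "y \<in> H2" "h2_norm y \<le> C" for y
    proof -
      have "cmod (h2_inner y t) \<le> h2_norm y * h2_norm t" by (rule h2_Cauchy_Schwarz[OF y(1) t(1)])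
      also have "\<dots> \<le> (C + 1) * d" using t y C by (intro mult_mono) auto
      also have "\<dots> = e / 4" using C by (simp add: d_def field_simps)
      finally show ?thesis .
    qed
    have "dist (h2_inner (X N) b) (h2_inner x b)
      = cmod (((\<Sum>k\<in>G. X N k * cnj (b k)) - (\<Sum>k\<in>G. x k * cnj (b k))) + (h2_inner (X N) t - h2_inner x t))"
      using elim x by (simp add: split dist_norm algebra_simps)
    also have "\<dots> \<le> dist (\<Sum>k\<in>G. X N k * cnj (b k)) (\<Sum>k\<in>G. x k * cnj (b k))
        + (cmod (h2_inner (X N) t) + cmod (h2_inner x t))"
      unfolding dist_norm by (meson add_left_mono norm_triangle_ineq norm_triangle_ineq4 order_trans)
    also have "\<dots> < e" using elim small[of "X N"] small[of x] x by linarith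
    finally show ?case .
  qed
qed

section \<open>Completeness and orthogonal projections\<close>

text \<open>Coefficients are dominated by the norm, hence converge; \<open>h2_Fatou\<close> in the
  second index then carries the Cauchy estimate over to the limit.\<close>

lemma h2_complete:
  assumes "\<And>N. X N \<in> H2"
    and "\<And>e. e > 0 \<Longrightarrow> \<exists>M. \<forall>N\<ge>M. \<forall>N'\<ge>M. h2_norm (\<lambda>k. X N k - X N' k) \<le> e"
  obtains x where "x \<in> H2" "(\<lambda>N. h2_norm (\<lambda>k. X N k - x k)) \<longlonglongrightarrow> 0"
proof -
  have "Cauchy (\<lambda>N. X N k)" for k
  proof (rule metric_CauchyI)
    fix e :: real assume "e > 0"
    then obtain M where M: "\<forall>N\<ge>M. \<forall>N'\<ge>M. h2_norm (\<lambda>k. X N k - X N' k) \<le> e/2"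
      using assms(2)[of "e/2"] by auto
    have "dist (X N k) (X N' k) < e" if "N \<ge> M" "N' \<ge> M" for N N'
    proof -
      have "dist (X N k) (X N' k) \<le> h2_norm (\<lambda>k. X N k - X N' k)"
        unfolding dist_norm using cmod_le_h2_norm[OF H2_diff(1)[OF assms(1) assms(1)]] .
      also have "\<dots> \<le> e/2" using M that by auto
      finally show ?thesis using \<open>e > 0\<close> by simp
    qed
    then show "\<exists>M. \<forall>m\<ge>M. \<forall>n\<ge>M. dist (X m k) (X n k) < e" by blast
  qed
  then have "\<exists>l. (\<lambda>N. X N k) \<longlonglongrightarrow> l" for k
    using Cauchy_convergent unfolding convergent_def by blast
  then obtain x where lim: "\<And>k. (\<lambda>N. X N k) \<longlonglongrightarrow> x k" by metis
  have key: "(\<lambda>k. X N k - x k) \<in> H2 \<and> h2_norm (\<lambda>k. X N k - x k) \<le> e"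
    if M: "\<forall>N\<ge>M. \<forall>N'\<ge>M. h2_norm (\<lambda>k. X N k - X N' k) \<le> e" and N: "N \<ge> M" for N M e
  proof -
    have ev: "\<forall>\<^sub>F N' in sequentially. (\<lambda>k. X N k - X N' k) \<in> H2 \<and> h2_norm (\<lambda>k. X N k - X N' k) \<le> e"
      using eventually_ge_at_top[of M] by eventually_elim (use M N H2_diff(1) assms(1) in auto)
    have "(\<lambda>N'. X N k - X N' k) \<longlonglongrightarrow> X N k - x k" for k
      by (intro tendsto_intros lim)
    from h2_Fatou[OF trivial_limit_sequentially ev this] show ?thesis by (rule conjI)
  qed
  obtain M where M: "\<forall>N\<ge>M. \<forall>N'\<ge>M. h2_norm (\<lambda>k. X N k - X N' k) \<le> 1"
    using assms(2)[of 1] by auto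
  have "(\<lambda>k. X M k - (X M k - x k)) \<in> H2"
    by (rule H2_diff(1)[OF assms(1)]) (use key[OF M order_refl] in blast)
  then have "x \<in> H2" by simp
  moreover have "(\<lambda>N. h2_norm (\<lambda>k. X N k - x k)) \<longlonglongrightarrow> 0"
  proof (rule LIMSEQ_I)
    fix r :: real assume "r > 0"
    then obtain M where M: "\<forall>N\<ge>M. \<forall>N'\<ge>M. h2_norm (\<lambda>k. X N k - X N' k) \<le> r/2"
      using assms(2)[of "r/2"] by auto
    show "\<exists>no. \<forall>n\<ge>no. norm (h2_norm (\<lambda>k. X n k - x k) - 0) < r"
      using key[OF M] \<open>r > 0\<close> by (intro exI[of _ M]) fastforce
  qed
  ultimately show thesis using that by blast
qed

lemma h2_closed_subspaceD:
  assumes "h2_closed_subspace S"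
  shows "f \<in> S \<Longrightarrow> f \<in> H2" "(\<lambda>k. 0) \<in> S" "f \<in> S \<Longrightarrow> g \<in> S \<Longrightarrow> (\<lambda>k. f k + g k) \<in> S"
    "f \<in> S \<Longrightarrow> (\<lambda>k. a * f k) \<in> S" "f \<in> S \<Longrightarrow> g \<in> S \<Longrightarrow> (\<lambda>k. f k - g k) \<in> S"
    "\<lbrakk>\<And>N. X N \<in> S; f \<in> H2; (\<lambda>N. h2_norm (\<lambda>i. X N i - f i)) \<longlonglongrightarrow> 0\<rbrakk> \<Longrightarrow> f \<in> S"
proof -
  show "f \<in> S \<Longrightarrow> f \<in> H2" "(\<lambda>k. 0) \<in> S" and add: "\<And>f g. f \<in> S \<Longrightarrow> g \<in> S \<Longrightarrow> (\<lambda>k. f k + g k) \<in> S"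
    and mul: "\<And>f a. f \<in> S \<Longrightarrow> (\<lambda>k. a * f k) \<in> S"
    and "\<lbrakk>\<And>N. X N \<in> S; f \<in> H2; (\<lambda>N. h2_norm (\<lambda>i. X N i - f i)) \<longlonglongrightarrow> 0\<rbrakk> \<Longrightarrow> f \<in> S"
    using assms unfolding h2_closed_subspace_def by blast+
  show "f \<in> S \<Longrightarrow> g \<in> S \<Longrightarrow> (\<lambda>k. f k - g k) \<in> S"
    using add[of f "\<lambda>k. -1 * g k"] mul[of g "-1"] by simp
qed

text \<open>A minimising sequence for the distance from \<open>f\<close> to \<open>S\<close> is
  Cauchy by the parallelogram law; its limit attains the distance, and perturbing it along
  \<open>h\<close> yields orthogonality.\<close>

lemma h2_projection_exists:
  assumes S: "h2_closed_subspace S" and f: "f \<in> H2"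
  obtains g where "g \<in> S" "\<forall>h\<in>S. h2_inner (\<lambda>k. f k - g k) h = 0"
proof -
  note SD = h2_closed_subspaceD[OF S]
  define d where "d = (INF g\<in>S. (h2_norm (\<lambda>k. f k - g k))\<^sup>2)"
  have bdd: "bdd_below ((\<lambda>g. (h2_norm (\<lambda>k. f k - g k))\<^sup>2) ` S)" by (rule bdd_belowI2[where m = 0]) auto
  have d_le: "d \<le> (h2_norm (\<lambda>k. f k - g k))\<^sup>2" if "g \<in> S" for g
    unfolding d_def by (rule cINF_lower[OF bdd that])
  have ne: "S \<noteq> {}" using SD(2) by blast
  have "\<exists>g\<in>S. (h2_norm (\<lambda>k. f k - g k))\<^sup>2 < d + e" if "e > 0" for e
    using cINF_less_iff[OF ne bdd, of "d + e"] that unfolding d_def by simp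
  then have "\<exists>g\<in>S. (h2_norm (\<lambda>k. f k - g k))\<^sup>2 < d + 1 / real (Suc N)" for N by simp
  then obtain X where X: "\<And>N. X N \<in> S" "\<And>N. (h2_norm (\<lambda>k. f k - X N k))\<^sup>2 < d + 1 / real (Suc N)" by metis
  have XH: "X N \<in> H2" for N using SD(1) X(1) by blast
  have par: "(h2_norm (\<lambda>k. X N k - X M k))\<^sup>2 \<le> 2 / real (Suc N) + 2 / real (Suc M)" for N M
  proof -
    \<comment> \<open>The midpoint stays in \<open>S\<close>, so its squared distance from
      \<open>f\<close> is at least \<open>d\<close>; the parallelogram law turns this into an upper
      bound for the difference.\<close>
    have mid: "(\<lambda>k. (1/2) * (X N k + X M k)) \<in> S" by (rule SD(4)[OF SD(3)[OF X(1) X(1)]])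
    have "(h2_norm (\<lambda>k. (f k - X N k) + (f k - X M k)))\<^sup>2
        = (h2_norm (\<lambda>k. 2 * (f k - (1/2) * (X N k + X M k))))\<^sup>2"
      by (rule arg_cong[where f = "\<lambda>x. (h2_norm x)\<^sup>2"]) (auto simp: algebra_simps)
    also have "\<dots> = 4 * (h2_norm (\<lambda>k. f k - (1/2) * (X N k + X M k)))\<^sup>2"
      using H2_diff(1)[OF f SD(1)[OF mid]] by (subst H2_cmult(2)) (auto simp: power_mult_distrib)
    finally have "(h2_norm (\<lambda>k. (f k - X N k) + (f k - X M k)))\<^sup>2 \<ge> 4 * d" using d_le[OF mid] by simp
    moreover have "h2_norm (\<lambda>k. X N k - X M k) = h2_norm (\<lambda>k. (f k - X N k) - (f k - X M k))"
      by (simp add: h2_norm_minus_commute[of "X N"])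
    ultimately show ?thesis
      using h2_parallelogram[OF H2_diff(1)[OF f XH] H2_diff(1)[OF f XH], of N M] X(2)[of N] X(2)[of M] by simp
  qed
  have "\<exists>M. \<forall>N\<ge>M. \<forall>N'\<ge>M. h2_norm (\<lambda>k. X N k - X N' k) \<le> e" if e: "e > 0" for e
  proof -
    obtain M where M: "1 / real (Suc M) < e\<^sup>2 / 4"
      using e nat_approx_posE[of "e\<^sup>2 / 4"] by (metis zero_less_divide_iff zero_less_numeral zero_less_power)
    have "h2_norm (\<lambda>k. X N k - X N' k) \<le> e" if "N \<ge> M" "N' \<ge> M" for N N'
    proof -
      have "1 / real (Suc N) \<le> 1 / real (Suc M)" "1 / real (Suc N') \<le> 1 / real (Suc M)"
        using that by (auto simp: field_simps)
      then have "(h2_norm (\<lambda>k. X N k - X N' k))\<^sup>2 \<le> e\<^sup>2" using par[of N N'] M by simp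
      then show ?thesis by (rule power2_le_imp_le) (use e in simp)
    qed
    then show ?thesis by blast
  qed
  from h2_complete[of X, OF XH this] obtain g where g: "g \<in> H2" "(\<lambda>N. h2_norm (\<lambda>k. X N k - g k)) \<longlonglongrightarrow> 0" by blast
  have gS: "g \<in> S" by (rule SD(6)[OF X(1) g])
  define u where "u = (\<lambda>k. f k - g k)"
  have u: "u \<in> H2" unfolding u_def by (rule H2_diff(1)[OF f g(1)])
  have "h2_norm u \<le> sqrt (d + 1 / real (Suc N)) + h2_norm (\<lambda>k. X N k - g k)" for N
  proof -
    have "h2_norm u \<le> h2_norm (\<lambda>k. f k - X N k) + h2_norm (\<lambda>k. X N k - g k)"
      using H2_add(2)[OF H2_diff(1)[OF f XH[of N]] H2_diff(1)[OF XH[of N] g(1)]] by (simp add: u_def)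
    moreover have "h2_norm (\<lambda>k. f k - X N k) \<le> sqrt (d + 1 / real (Suc N))"
      by (rule real_le_rsqrt[OF less_imp_le[OF X(2)]])
    ultimately show ?thesis by simp
  qed
  moreover have "(\<lambda>N. sqrt (d + 1 / real (Suc N)) + h2_norm (\<lambda>k. X N k - g k)) \<longlonglongrightarrow> sqrt (d + 0) + 0"
    by (intro tendsto_intros g(2) LIMSEQ_Suc[OF lim_inverse_n'])
  ultimately have "h2_norm u \<le> sqrt d"
    using LIMSEQ_le_const[of _ "sqrt (d + 0) + 0" "h2_norm u"] by simp
  moreover have "d \<ge> 0" unfolding d_def using ne by (intro cINF_greatest) auto
  ultimately have ud: "(h2_norm u)\<^sup>2 \<le> d"
    by (metis h2_norm_nonneg power_mono real_sqrt_pow2)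
  have "h2_inner u h = 0" if h: "h \<in> S" for h
  proof (rule ccontr)
    assume ne0: "h2_inner u h \<noteq> 0"
    have hH: "h \<in> H2" using SD(1)[OF h] .
    define r where "r = (h2_norm h)\<^sup>2"
    have r: "r > 0"
      using ne0 h2_Cauchy_Schwarz[OF u hH] unfolding r_def
      by (metis h2_norm_nonneg mult_zero_right norm_le_zero_iff zero_less_power2)
    \<comment> \<open>\<open>t\<close> times \<open>h\<close> is the projection of \<open>u\<close>
      onto the line through \<open>h\<close>; subtracting it lowers the squared norm by
      \<open>(cmod t)\<^sup>2 * r\<close>, against minimality.\<close>
    define t where "t = h2_inner u h / of_real r"
    have "(\<lambda>k. g k + t * h k) \<in> S" by (rule SD(3)[OF gS SD(4)[OF h]])
    from d_le[OF this] have "d \<le> (h2_norm (\<lambda>k. u k - t * h k))\<^sup>2" by (simp add: u_def algebra_simps)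
    also have "\<dots> = (h2_norm u)\<^sup>2 + (cmod t)\<^sup>2 * r - 2 * Re (cnj t * h2_inner u h)"
      using h2_norm_sq_diff[OF u H2_cmult(1)[OF hH, of t]] H2_cmult(2)[OF hH, of t]
      by (simp add: h2_inner_cmult_right r_def power_mult_distrib)
    also have "cnj t * h2_inner u h = of_real ((cmod t)\<^sup>2 * r)"
    proof -
      have "h2_inner u h = t * of_real r" using r by (simp add: t_def)
      then have "cnj t * h2_inner u h = (t * cnj t) * of_real r" by simp
      then show ?thesis by (simp add: complex_norm_square[symmetric])
    qed
    finally have "(cmod t)\<^sup>2 * r \<le> 0" using ud by (simp add: mult.commute)
    then show False using r ne0 by (simp add: t_def mult_le_0_iff)
  qed
  then show thesis using that gS unfolding u_def by blast
qed

text \<open>The \<open>THE\<close> is well defined since the difference of two candidates lies in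
  \<open>S\<close> and is orthogonal to \<open>S\<close>, hence to itself.\<close>

lemma h2_proj:
  assumes S: "h2_closed_subspace S" and f: "f \<in> H2"
  shows "h2_proj S f \<in> S" "h \<in> S \<Longrightarrow> h2_inner (\<lambda>k. f k - h2_proj S f k) h = 0"
proof -
  note SD = h2_closed_subspaceD[OF S]
  obtain g where g: "g \<in> S" "\<forall>h\<in>S. h2_inner (\<lambda>k. f k - g k) h = 0"
    using h2_projection_exists[OF assms] .
  have "g' = g" if g': "g' \<in> S" "\<forall>h\<in>S. h2_inner (\<lambda>k. f k - g' k) h = 0" for g'
  proof -
    define w where "w = (\<lambda>k. g k - g' k)"
    have w: "w \<in> S" unfolding w_def by (rule SD(5)[OF g(1) g'(1)])
    have "h2_inner w w = h2_inner (\<lambda>k. (f k - g' k) - (f k - g k)) w" by (simp add: w_def)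
    also have "\<dots> = 0"
      using g g' w SD(1) by (subst h2_inner_diff_left) (auto intro!: H2_diff(1) f)
    finally have "h2_norm w = 0" using h2_inner_self[OF SD(1)[OF w]] by simp
    from h2_norm_eq_0[OF SD(1)[OF w] this] show ?thesis by (auto simp: w_def fun_eq_iff)
  qed
  then have "h2_proj S f = g" unfolding h2_proj_def using g by (intro the_equality) blast+
  then show "h2_proj S f \<in> S" "h \<in> S \<Longrightarrow> h2_inner (\<lambda>k. f k - h2_proj S f k) h = 0" using g by auto
qed

section \<open>Cauchy products and Parseval's identity\<close>

text \<open>Multiplication by the monomial with exponents \<open>l\<close>. The value type is
  general so that squared moduli can be shifted as well.\<close>

definition shift :: "nat \<times> nat \<Rightarrow> (nat \<times> nat \<Rightarrow> 'a::zero) \<Rightarrow> nat \<times> nat \<Rightarrow> 'a" where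
  "shift l x = (\<lambda>k. if fst l \<le> fst k \<and> snd l \<le> snd k then x (fst k - fst l, snd k - snd l) else 0)"

definition conv :: "(nat \<times> nat \<Rightarrow> complex) \<Rightarrow> (nat \<times> nat \<Rightarrow> complex) \<Rightarrow> nat \<times> nat \<Rightarrow> complex" where
  "conv x y = (\<lambda>(i, j). \<Sum>a\<le>i. \<Sum>b\<le>j. x (a, b) * y (i - a, j - b))"

definition conv_unit :: "nat \<times> nat \<Rightarrow> complex" where
  "conv_unit = (\<lambda>k. if k = (0, 0) then 1 else 0)"

text \<open>Embedding into power series in z1 over power series in z2, from which
  \<open>conv\<close> inherits the laws of a commutative ring.\<close>

definition fps2 :: "(nat \<times> nat \<Rightarrow> complex) \<Rightarrow> complex fps fps" where
  "fps2 x = Abs_fps (\<lambda>i. Abs_fps (\<lambda>j. x (i, j)))"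

lemma fps2_nth [simp]: "fps_nth (fps_nth (fps2 x) i) j = x (i, j)"
  by (simp add: fps2_def)

lemma fps2_inject: "fps2 x = fps2 y \<Longrightarrow> x = y"
proof
  fix k :: "nat \<times> nat" assume "fps2 x = fps2 y"
  then have "fps_nth (fps_nth (fps2 x) (fst k)) (snd k) = fps_nth (fps_nth (fps2 y) (fst k)) (snd k)" by simp
  then show "x k = y k" by simp
qed

lemma fps2_conv: "fps2 (conv x y) = fps2 x * fps2 y"
  by (intro fps_ext) (simp add: fps_mult_nth fps_sum_nth conv_def atLeast0AtMost)

lemma fps2_conv_unit: "fps2 conv_unit = 1"
  by (intro fps_ext) (auto simp: conv_unit_def)

lemma conv_commute: "conv x y = conv y x"
  by (rule fps2_inject) (simp add: fps2_conv mult.commute)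

lemma conv_assoc: "conv (conv x y) z = conv x (conv y z)"
  by (rule fps2_inject) (simp add: fps2_conv mult.assoc)

lemma conv_left_commute: "conv x (conv y z) = conv y (conv x z)"
  by (rule fps2_inject) (simp add: fps2_conv mult.left_commute)

lemma conv_unit_left [simp]: "conv conv_unit x = x"
  by (rule fps2_inject) (simp add: fps2_conv fps2_conv_unit)

lemma conv_diff_right: "conv x (\<lambda>k. y k - z k) = (\<lambda>k. conv x y k - conv x z k)"
  by (simp add: conv_def fun_eq_iff right_diff_distrib sum_subtractf)

lemma conv_cmult_right: "conv x (\<lambda>k. a * y k) = (\<lambda>k. a * conv x y k)"
  by (simp add: conv_def fun_eq_iff mult.left_commute sum_distrib_left)

lemma conv_zero_right [simp]: "conv x (\<lambda>k. 0) = (\<lambda>k. 0)"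
  by (auto simp: conv_def)

lemma conv_add_right: "conv x (\<lambda>k. y k + z k) = (\<lambda>k. conv x y k + conv x z k)"
  by (simp add: conv_def fun_eq_iff distrib_left sum.distrib)

lemma conv_tendsto:
  assumes "\<And>k. ((\<lambda>N. X N k) \<longlongrightarrow> x k) F" "\<And>k. ((\<lambda>N. Y N k) \<longlongrightarrow> y k) F"
  shows "((\<lambda>N. conv (X N) (Y N) k) \<longlongrightarrow> conv x y k) F"
  unfolding conv_def by (cases k) (auto intro!: tendsto_intros assms)

text \<open>\<open>A\<close> can be any finite set outside which \<open>x\<close> vanishes below
  \<open>k\<close>; later it is a support, a single point or a box.\<close>

lemma conv_eq_sum_shift:
  assumes "finite A" "\<And>l. l \<notin> A \<Longrightarrow> fst l \<le> fst k \<Longrightarrow> snd l \<le> snd k \<Longrightarrow> x l = 0"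
  shows "conv x y k = (\<Sum>l\<in>A. x l * shift l y k)"
proof -
  obtain i j where k: "k = (i, j)" by (cases k)
  have "conv x y k = (\<Sum>l\<in>{..i} \<times> {..j}. x l * shift l y k)"
    unfolding k conv_def shift_def sum.cartesian_product by (auto intro!: sum.cong)
  also have "\<dots> = (\<Sum>l\<in>A \<union> {..i} \<times> {..j}. x l * shift l y k)"
    using assms by (intro sum.mono_neutral_left) (auto simp: shift_def k)
  also have "\<dots> = (\<Sum>l\<in>A. x l * shift l y k)"
    using assms by (intro sum.mono_neutral_right) (auto simp: shift_def k)
  finally show ?thesis .
qed

lemma conv_bipoly:
  assumes "is_bipoly p"
  shows "conv p x = (\<lambda>k. \<Sum>l\<in>{l. p l \<noteq> 0}. p l * shift l x k)"
  using assms unfolding is_bipoly_def by (intro ext conv_eq_sum_shift) auto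

text \<open>A shift is a reindexing along the translation \<open>h\<close>, which is injective, with
  value 0 off its range.\<close>

lemma has_sum_shift:
  fixes G :: "nat \<times> nat \<Rightarrow> 'a::{comm_monoid_add, topological_space}"
  shows "(shift l G has_sum s) UNIV \<longleftrightarrow> (G has_sum s) UNIV"
proof -
  define h where "h = (\<lambda>k :: nat \<times> nat. (fst k + fst l, snd k + snd l))"
  have inj: "inj h" by (auto simp: h_def inj_def prod_eq_iff)
  have *: "k \<in> range h" if "fst l \<le> fst k" "snd l \<le> snd k" for k
    using that by (intro range_eqI[of _ _ "(fst k - fst l, snd k - snd l)"]) (auto simp: h_def)
  have "(G has_sum s) UNIV \<longleftrightarrow> (shift l G \<circ> h has_sum s) UNIV"
    by (rule has_sum_cong) (simp add: h_def shift_def)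
  also have "\<dots> \<longleftrightarrow> (shift l G has_sum s) (range h)"
    by (rule has_sum_reindex[OF inj, symmetric])
  also have "\<dots> \<longleftrightarrow> (shift l G has_sum s) UNIV"
    by (rule has_sum_cong_neutral) (use * in \<open>auto simp: shift_def\<close>)
  finally show ?thesis by simp
qed

lemma infsum_shift:
  fixes G :: "nat \<times> nat \<Rightarrow> 'a::{comm_monoid_add, t2_space}"
  shows "infsum (shift l G) UNIV = infsum G UNIV"
proof (cases "G summable_on UNIV")
  case True
  then show ?thesis by (intro infsumI) (simp add: has_sum_shift)
next
  case False
  then have "\<not> shift l G summable_on UNIV" by (simp add: summable_on_def has_sum_shift)
  then show ?thesis using False by (simp add: infsum_not_exists)
qed

lemma shift_shift: "shift l (shift l' x) = shift (fst l + fst l', snd l + snd l') x"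
  by (auto simp: shift_def fun_eq_iff)

lemma shift_zero: "shift (0, 0) x = x"
  by (auto simp: shift_def fun_eq_iff)

lemma H2_shift:
  assumes "x \<in> H2" shows "shift l x \<in> H2" "h2_norm (shift l x) = h2_norm x"
proof -
  have *: "(\<lambda>k. (cmod (shift l x k))\<^sup>2) = shift l (\<lambda>k. (cmod (x k))\<^sup>2)"
    by (auto simp: shift_def)
  show "shift l x \<in> H2"
    using assms unfolding H2_def mem_Collect_eq * by (metis summable_on_def has_sum_shift)
  show "h2_norm (shift l x) = h2_norm x"
    unfolding h2_norm_def * infsum_shift ..
qed

lemma h2_inner_shift: "h2_inner (shift l x) (shift l y) = h2_inner x y"
proof -
  have "(\<lambda>k. shift l x k * cnj (shift l y k)) = shift l (\<lambda>k. x k * cnj (y k))"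
    by (auto simp: shift_def)
  then show ?thesis unfolding h2_inner_def by (simp add: infsum_shift)
qed

text \<open>Shifting is itself a product, with a monomial, so the laws of \<open>conv\<close> let
  shifts pass through products.\<close>

lemma conv_shift_unit: "shift l x = conv (shift l conv_unit) x"
proof
  fix k
  have "conv (shift l conv_unit) x k = (\<Sum>l'\<in>{l}. shift l conv_unit l' * shift l' x k)"
    by (rule conv_eq_sum_shift) (auto simp: shift_def conv_unit_def prod_eq_iff)
  then show "shift l x k = conv (shift l conv_unit) x k" by (simp add: shift_def conv_unit_def)
qed

lemma conv_shift_right: "conv x (shift l y) = shift l (conv x y)"
proof -
  have "conv x (shift l y) = conv (shift l conv_unit) (conv x y)"
    by (subst conv_shift_unit[of l y]) (rule conv_left_commute)
  also have "\<dots> = shift l (conv x y)" by (rule conv_shift_unit[symmetric])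
  finally show ?thesis .
qed

lemma Mz1_shift: "Mz1 f = shift (1, 0) f"
  by (auto simp: Mz1_def shift_def)

lemma Mz2_shift: "Mz2 f = shift (0, 1) f"
  by (auto simp: Mz2_def shift_def)

lemma h2_norm_sum:
  assumes "finite A" "\<And>a. a \<in> A \<Longrightarrow> x a \<in> H2"
  shows "h2_norm (\<lambda>k. \<Sum>a\<in>A. x a k) \<le> (\<Sum>a\<in>A. h2_norm (x a))"
  using assms
proof (induction A rule: finite_induct)
  case (insert a A)
  have "h2_norm (\<lambda>k. x a k + (\<Sum>a\<in>A. x a k)) \<le> h2_norm (x a) + h2_norm (\<lambda>k. \<Sum>a\<in>A. x a k)"
    using insert by (intro H2_add H2_sum) auto
  then show ?case using insert by simp
qed simp

text \<open>Young's inequality: on a finite set the product is a finite combination of shifts of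
  \<open>y\<close>, and every shift is isometric.\<close>

lemma conv_H2:
  assumes x: "(\<lambda>k. cmod (x k)) summable_on UNIV" and y: "y \<in> H2"
  shows "conv x y \<in> H2" "h2_norm (conv x y) \<le> (\<Sum>\<^sub>\<infinity>k. cmod (x k)) * h2_norm y"
proof -
  have "L2_set (\<lambda>k. cmod (conv x y k)) F \<le> (\<Sum>\<^sub>\<infinity>k. cmod (x k)) * h2_norm y" if F: "finite F" for F
  proof -
    \<comment> \<open>All indices below some element of \<open>F\<close>, so that one finite sum
      represents the product at every \<open>k\<close> in \<open>F\<close>.\<close>
    define A where "A = (\<Union>k\<in>F. {..fst k} \<times> {..snd k})"
    have A: "finite A" unfolding A_def using F by auto
    have S: "(\<lambda>k. x l * shift l y k) \<in> H2" for l using H2_cmult(1) H2_shift(1) y by blast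
    have "conv x y k = (\<Sum>l\<in>A. x l * shift l y k)" if "k \<in> F" for k
      using that by (intro conv_eq_sum_shift A) (auto simp: A_def)
    then have "L2_set (\<lambda>k. cmod (conv x y k)) F = L2_set (\<lambda>k. cmod (\<Sum>l\<in>A. x l * shift l y k)) F"
      by (intro L2_set_cong) auto
    also have "\<dots> \<le> h2_norm (\<lambda>k. \<Sum>l\<in>A. x l * shift l y k)"
      by (intro L2_set_le_h2_norm H2_sum A S F)
    also have "\<dots> \<le> (\<Sum>l\<in>A. h2_norm (\<lambda>k. x l * shift l y k))"
      by (intro h2_norm_sum A S)
    also have "\<dots> = (\<Sum>l\<in>A. cmod (x l)) * h2_norm y"
      using H2_cmult(2)[OF H2_shift(1)[OF y]] H2_shift(2)[OF y] by (simp add: sum_distrib_right)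
    also have "\<dots> \<le> (\<Sum>\<^sub>\<infinity>k. cmod (x k)) * h2_norm y"
      by (intro mult_right_mono finite_sum_le_infsum x A) auto
    finally show ?thesis .
  qed
  from H2_L2_setI[OF this]
  show "conv x y \<in> H2" "h2_norm (conv x y) \<le> (\<Sum>\<^sub>\<infinity>k. cmod (x k)) * h2_norm y"
    by (auto simp: infsum_nonneg)
qed

lemma bipoly_abs_summable: "is_bipoly p \<Longrightarrow> (\<lambda>k. cmod (p k)) summable_on UNIV"
  unfolding is_bipoly_def by (intro finite_nonzero_values_imp_summable_on) auto

lemmas conv_bipoly_H2 = conv_H2[OF bipoly_abs_summable]

section \<open>Point evaluation of polynomials and power series\<close>

definition zpow :: "complex \<times> complex \<Rightarrow> nat \<times> nat \<Rightarrow> complex" where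
  "zpow z k = fst z ^ fst k * snd z ^ snd k"

lemma bipoly_eval_zpow:
  assumes "finite A" "\<And>l. l \<notin> A \<Longrightarrow> p l = 0"
  shows "bipoly_eval p z = (\<Sum>l\<in>A. p l * zpow z l)"
  unfolding bipoly_eval_def zpow_def mult.assoc[symmetric]
  using assms by (intro sum.mono_neutral_left) auto

lemma h2_eval_zpow: "h2_eval x z = (\<Sum>\<^sub>\<infinity>k. x k * zpow z k)"
  unfolding h2_eval_def zpow_def by (simp add: mult.assoc)

lemma bipoly_has_sum:
  assumes "is_bipoly p" shows "((\<lambda>k. p k * zpow z k) has_sum bipoly_eval p z) UNIV"
  using assms unfolding is_bipoly_def
  by (intro has_sum_finite_neutralI[of "{l. p l \<noteq> 0}"]) (auto intro!: bipoly_eval_zpow)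

lemma has_sum_finite_sum:
  fixes f :: "'a \<Rightarrow> 'b \<Rightarrow> complex"
  assumes "finite A" "\<And>a. a \<in> A \<Longrightarrow> (f a has_sum s a) B"
  shows "((\<lambda>x. \<Sum>a\<in>A. f a x) has_sum (\<Sum>a\<in>A. s a)) B"
  using assms by (induction A rule: finite_induct) (auto intro!: has_sum_add)

lemma shift_has_sum:
  assumes "((\<lambda>k. x k * zpow z k) has_sum s) UNIV"
  shows "((\<lambda>k. shift l x k * zpow z k) has_sum (zpow z l * s)) UNIV"
proof -
  have "(shift l (\<lambda>k. zpow z l * (x k * zpow z k)) has_sum (zpow z l * s)) UNIV"
    using has_sum_cmult_right[OF assms] by (simp add: has_sum_shift)
  moreover have "shift l (\<lambda>k. zpow z l * (x k * zpow z k)) = (\<lambda>k. shift l x k * zpow z k)"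
  proof
    fix k
    show "shift l (\<lambda>k. zpow z l * (x k * zpow z k)) k = shift l x k * zpow z k"
    proof (cases "fst l \<le> fst k \<and> snd l \<le> snd k")
      case True
      then have "fst z ^ fst k = fst z ^ fst l * fst z ^ (fst k - fst l)"
        "snd z ^ snd k = snd z ^ snd l * snd z ^ (snd k - snd l)" by (simp_all flip: power_add)
      then show ?thesis using True by (simp add: shift_def zpow_def)
    qed (auto simp: shift_def)
  qed
  ultimately show ?thesis by simp
qed

text \<open>Only convergence at the single point \<open>z\<close> is asked for, which may lie
  outside the bidisk; later it is a zero of \<open>p\<close> whose first coordinate has modulus at
  least 1.\<close>

lemma conv_has_sum:
  assumes p: "is_bipoly p" and x: "((\<lambda>k. x k * zpow z k) has_sum s) UNIV"
  shows "((\<lambda>k. conv p x k * zpow z k) has_sum (bipoly_eval p z * s)) UNIV"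
proof -
  have fin: "finite {l. p l \<noteq> 0}" using p by (simp add: is_bipoly_def)
  have "((\<lambda>k. \<Sum>l\<in>{l. p l \<noteq> 0}. p l * (shift l x k * zpow z k)) has_sum (\<Sum>l\<in>{l. p l \<noteq> 0}. p l * (zpow z l * s))) UNIV"
    by (intro has_sum_finite_sum fin has_sum_cmult_right shift_has_sum x)
  moreover have "(\<Sum>l\<in>{l. p l \<noteq> 0}. p l * (zpow z l * s)) = bipoly_eval p z * s"
    using fin by (subst bipoly_eval_zpow) (auto simp: sum_distrib_right mult.assoc)
  ultimately show ?thesis
    unfolding conv_bipoly[OF p] by (simp add: sum_distrib_right mult.assoc)
qed

lemma bipoly_conv:
  assumes "is_bipoly p" "is_bipoly q" shows "is_bipoly (conv p q)"
proof -
  have fin: "finite {l. p l \<noteq> 0}" "finite {l. q l \<noteq> 0}" using assms by (auto simp: is_bipoly_def)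
  have "{k. conv p q k \<noteq> 0} \<subseteq> (\<lambda>(a, b). (fst a + fst b, snd a + snd b)) ` ({l. p l \<noteq> 0} \<times> {l. q l \<noteq> 0})"
  proof
    fix k assume "k \<in> {k. conv p q k \<noteq> 0}"
    then have "(\<Sum>l\<in>{l. p l \<noteq> 0}. p l * shift l q k) \<noteq> 0" by (simp add: conv_bipoly[OF assms(1)])
    then obtain l where "p l * shift l q k \<noteq> 0" by (meson sum.not_neutral_contains_not_neutral)
    then have l: "p l \<noteq> 0" "shift l q k \<noteq> 0" by simp_all
    then have "fst l \<le> fst k" "snd l \<le> snd k" "q (fst k - fst l, snd k - snd l) \<noteq> 0"
      by (auto simp: shift_def split: if_splits)
    then show "k \<in> (\<lambda>(a, b). (fst a + fst b, snd a + snd b)) ` ({l. p l \<noteq> 0} \<times> {l. q l \<noteq> 0})"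
      using l by (intro image_eqI[of _ _ "(l, (fst k - fst l, snd k - snd l))"]) auto
  qed
  then show ?thesis unfolding is_bipoly_def using fin by (meson finite_SigmaI finite_imageI finite_subset)
qed

lemma bipoly_eval_conv:
  assumes "is_bipoly p" "is_bipoly q"
  shows "bipoly_eval (conv p q) z = bipoly_eval p z * bipoly_eval q z"
  using has_sum_unique[OF bipoly_has_sum[OF bipoly_conv[OF assms]] conv_has_sum[OF assms(1) bipoly_has_sum[OF assms(2)]]] .

section \<open>Norm comparison by sampling at roots of unity\<close>

text \<open>Orthogonality of the characters of the cyclic group of order \<open>N\<close>. Sampling
  at roots of unity replaces integration over the circle and is exact for degrees below
  \<open>N\<close>.\<close>

lemma discrete_Parseval:
  fixes c :: "nat \<Rightarrow> complex"
  assumes N: "N > 0"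
  shows "(\<Sum>u<N. (cmod (\<Sum>i<N. c i * cis (2 * pi * real u / real N) ^ i))\<^sup>2) = real N * (\<Sum>i<N. (cmod (c i))\<^sup>2)"
proof -
  define w where "w = (\<lambda>u. cis (2 * pi * real u / real N))"
  have geo: "(\<Sum>u<N. w u ^ i * cnj (w u ^ k)) = (if i = k then of_nat N else 0)" if ik: "i < N" "k < N" for i k
  proof -
    \<comment> \<open>Since \<open>w u ^ i\<close> equals \<open>w i ^ u\<close>, the sum over
      \<open>u\<close> is geometric with ratio \<open>\<zeta>\<close>, an \<open>N\<close>-th root
      of unity that is 1 only for \<open>i = k\<close>.\<close>
    define \<zeta> where "\<zeta> = w i * cnj (w k)"
    have *: "w u ^ i * cnj (w u ^ k) = \<zeta> ^ u" for u
      unfolding \<zeta>_def w_def power_mult_distrib complex_cnj_power[symmetric] Complex.DeMoivre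
      by (simp add: cis_cnj mult_ac)
    have wN: "w i ^ N = 1" "w k ^ N = 1" using Complex.bij_betw_roots_unity[OF N] ik unfolding w_def bij_betw_def by auto
    have "\<zeta> ^ N = 1" unfolding \<zeta>_def power_mult_distrib complex_cnj_power[symmetric] wN by simp
    have unit: "w k * cnj (w k) = 1" by (simp add: w_def complex_norm_square[symmetric])
    show ?thesis
    proof (cases "i = k")
      case True
      then show ?thesis using unit unfolding * by (simp add: \<zeta>_def)
    next
      case False
      have "\<zeta> \<noteq> 1"
      proof
        assume "\<zeta> = 1"
        then have "w i * (w k * cnj (w k)) = w k" by (simp add: \<zeta>_def mult.left_commute)
        then have "w i = w k" using unit by simp
        moreover have "inj_on w {..<N}" using Complex.bij_betw_roots_unity[OF N] unfolding w_def bij_betw_def by simp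
        ultimately show False using False ik by (auto dest: inj_onD)
      qed
      then show ?thesis using False \<open>\<zeta> ^ N = 1\<close> unfolding * by (simp add: geometric_sum)
    qed
  qed
  have "complex_of_real (\<Sum>u<N. (cmod (\<Sum>i<N. c i * w u ^ i))\<^sup>2)
     = (\<Sum>u<N. (\<Sum>i<N. c i * w u ^ i) * cnj (\<Sum>k<N. c k * w u ^ k))"
    by (simp only: of_real_sum complex_norm_square)
  also have "\<dots> = (\<Sum>u<N. \<Sum>i<N. \<Sum>k<N. c i * cnj (c k) * (w u ^ i * cnj (w u ^ k)))"
    by (simp add: sum_product mult_ac)
  also have "\<dots> = (\<Sum>i<N. \<Sum>u<N. \<Sum>k<N. c i * cnj (c k) * (w u ^ i * cnj (w u ^ k)))"
    by (rule sum.swap)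
  also have "\<dots> = (\<Sum>i<N. \<Sum>k<N. \<Sum>u<N. c i * cnj (c k) * (w u ^ i * cnj (w u ^ k)))"
    by (intro sum.cong refl sum.swap)
  also have "\<dots> = (\<Sum>i<N. \<Sum>k<N. c i * cnj (c k) * (if i = k then of_nat N else 0))"
    unfolding sum_distrib_left[symmetric] using geo by (intro sum.cong refl) auto
  also have "\<dots> = (\<Sum>i<N. c i * cnj (c i) * of_nat N)"
    by (intro sum.cong refl) (simp add: if_distrib[where f = "\<lambda>x. _ * x"] sum.delta cong: if_cong)
  also have "\<dots> = complex_of_real (real N * (\<Sum>i<N. (cmod (c i))\<^sup>2))"
    by (simp add: complex_norm_square[symmetric] sum_distrib_left mult.commute)
  finally show ?thesis unfolding w_def of_real_eq_iff .
qed

text \<open>Every larger box works too, so two polynomials can be sampled on one grid.\<close>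

lemma bipoly_in_box:
  assumes "is_bipoly p" obtains N where "N > 0" "\<And>N' l. N' \<ge> N \<Longrightarrow> l \<notin> {..<N'} \<times> {..<N'} \<Longrightarrow> p l = 0"
proof -
  have fin: "finite {l. p l \<noteq> 0}" using assms by (simp add: is_bipoly_def)
  define N where "N = Suc (\<Sum>l\<in>{l. p l \<noteq> 0}. fst l + snd l)"
  have "fst l + snd l < N" if "p l \<noteq> 0" for l
    unfolding N_def less_Suc_eq_le using that fin by (intro member_le_sum[where f = "\<lambda>l. fst l + snd l"]) auto
  then have "p l = 0" if "N' \<ge> N" "l \<notin> {..<N'} \<times> {..<N'}" for N' l
    using that by (cases l) force
  moreover have "N > 0" by (simp add: N_def)
  ultimately show thesis using that by blast
qed

lemma h2_norm_bipoly:
  assumes N: "N > 0" and p: "\<And>l. l \<notin> {..<N} \<times> {..<N} \<Longrightarrow> p l = 0"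
  defines "w \<equiv> \<lambda>u. cis (2 * pi * real u / real N)"
  shows "(\<Sum>u<N. \<Sum>v<N. (cmod (bipoly_eval p (w u, w v)))\<^sup>2) = (real N)\<^sup>2 * (h2_norm p)\<^sup>2"
proof -
  have ev: "bipoly_eval p (w u, w v) = (\<Sum>j<N. (\<Sum>i<N. p (i, j) * w u ^ i) * w v ^ j)" for u v
  proof -
    have "bipoly_eval p (w u, w v) = (\<Sum>l\<in>{..<N} \<times> {..<N}. p l * zpow (w u, w v) l)"
      using p by (intro bipoly_eval_zpow) auto
    also have "\<dots> = (\<Sum>i<N. \<Sum>j<N. p (i, j) * zpow (w u, w v) (i, j))"
      by (simp add: sum.cartesian_product)
    also have "\<dots> = (\<Sum>j<N. \<Sum>i<N. p (i, j) * zpow (w u, w v) (i, j))" by (rule sum.swap)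
    finally show ?thesis by (simp add: zpow_def sum_distrib_right mult.assoc)
  qed
  have "(\<Sum>u<N. \<Sum>v<N. (cmod (bipoly_eval p (w u, w v)))\<^sup>2)
    = (\<Sum>u<N. real N * (\<Sum>j<N. (cmod (\<Sum>i<N. p (i, j) * w u ^ i))\<^sup>2))"
    unfolding ev unfolding w_def discrete_Parseval[OF N] ..
  also have "\<dots> = real N * (\<Sum>j<N. \<Sum>u<N. (cmod (\<Sum>i<N. p (i, j) * w u ^ i))\<^sup>2)"
    unfolding sum_distrib_left[symmetric] by (subst sum.swap) simp
  also have "\<dots> = real N * (\<Sum>j<N. real N * (\<Sum>i<N. (cmod (p (i, j)))\<^sup>2))"
    unfolding w_def discrete_Parseval[OF N] ..
  also have "\<dots> = (real N)\<^sup>2 * (\<Sum>j<N. \<Sum>i<N. (cmod (p (i, j)))\<^sup>2)"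
    by (simp add: sum_distrib_left[symmetric] power2_eq_square)
  also have "(\<Sum>j<N. \<Sum>i<N. (cmod (p (i, j)))\<^sup>2) = (\<Sum>i<N. \<Sum>j<N. (cmod (p (i, j)))\<^sup>2)" by (rule sum.swap)
  also have "\<dots> = (\<Sum>l\<in>{..<N} \<times> {..<N}. (cmod (p l))\<^sup>2)"
    by (simp add: sum.cartesian_product case_prod_unfold)
  also have "\<dots> = (\<Sum>\<^sub>\<infinity>l\<in>{..<N} \<times> {..<N}. (cmod (p l))\<^sup>2)" by simp
  also have "\<dots> = (h2_norm p)\<^sup>2"
    unfolding h2_norm_sq using p by (intro infsum_cong_neutral) auto
  finally show ?thesis .
qed

text \<open>Both squared norms are averages of squared moduli over the same grid on the torus, so
  the pointwise bound at the grid points suffices.\<close>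

lemma bipoly_norm_mono:
  assumes "is_bipoly a" "is_bipoly b" "C \<ge> 0"
    and le: "\<And>z. z \<in> torus2 \<Longrightarrow> cmod (bipoly_eval a z) \<le> C * cmod (bipoly_eval b z)"
  shows "h2_norm a \<le> C * h2_norm b"
proof -
  obtain N1 where N1: "N1 > 0" "\<And>N' l. N' \<ge> N1 \<Longrightarrow> l \<notin> {..<N'} \<times> {..<N'} \<Longrightarrow> a l = 0"
    using bipoly_in_box[OF assms(1)] by blast
  obtain N2 where N2: "N2 > 0" "\<And>N' l. N' \<ge> N2 \<Longrightarrow> l \<notin> {..<N'} \<times> {..<N'} \<Longrightarrow> b l = 0"
    using bipoly_in_box[OF assms(2)] by blast
  define N where "N = max N1 N2"
  define w where "w = (\<lambda>u. cis (2 * pi * real u / real N))"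
  have N: "N > 0" using N1(1) by (simp add: N_def)
  have "(real N)\<^sup>2 * (h2_norm a)\<^sup>2 = (\<Sum>u<N. \<Sum>v<N. (cmod (bipoly_eval a (w u, w v)))\<^sup>2)"
    unfolding w_def using N N1(2)[of N] by (intro h2_norm_bipoly[symmetric]) (auto simp: N_def)
  also have "\<dots> \<le> (\<Sum>u<N. \<Sum>v<N. (C * cmod (bipoly_eval b (w u, w v)))\<^sup>2)"
    by (intro sum_mono power_mono le) (auto simp: torus2_def w_def)
  also have "\<dots> = C\<^sup>2 * (\<Sum>u<N. \<Sum>v<N. (cmod (bipoly_eval b (w u, w v)))\<^sup>2)"
    by (simp add: power_mult_distrib sum_distrib_left)
  also have "(\<Sum>u<N. \<Sum>v<N. (cmod (bipoly_eval b (w u, w v)))\<^sup>2) = (real N)\<^sup>2 * (h2_norm b)\<^sup>2"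
    unfolding w_def using N N2(2)[of N] by (intro h2_norm_bipoly) (auto simp: N_def)
  finally have "(real N)\<^sup>2 * (h2_norm a)\<^sup>2 \<le> (real N)\<^sup>2 * (C * h2_norm b)\<^sup>2"
    by (simp add: power_mult_distrib mult_ac)
  then have "(h2_norm a)\<^sup>2 \<le> (C * h2_norm b)\<^sup>2" using N by simp
  then show ?thesis by (rule power2_le_imp_le) (use assms(3) in simp)
qed

definition trunc :: "nat \<Rightarrow> (nat \<times> nat \<Rightarrow> complex) \<Rightarrow> nat \<times> nat \<Rightarrow> complex" where
  "trunc K x = (\<lambda>k. if fst k < K \<and> snd k < K then x k else 0)"

lemma bipoly_trunc: "is_bipoly (trunc K x)"
  unfolding is_bipoly_def by (rule finite_subset[of _ "{..<K} \<times> {..<K}"]) (auto simp: trunc_def split: if_splits)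

lemma trunc_tendsto: "((\<lambda>K. trunc K x k) \<longlongrightarrow> x k) sequentially"
proof (rule tendsto_eventually)
  show "\<forall>\<^sub>F K in sequentially. trunc K x k = x k"
    using eventually_gt_at_top[of "max (fst k) (snd k)"] by eventually_elim (auto simp: trunc_def)
qed

lemma trunc_norm_tendsto:
  assumes x: "x \<in> H2"
  shows "(\<lambda>K. h2_norm (\<lambda>k. trunc K x k - x k)) \<longlonglongrightarrow> 0"
proof (rule LIMSEQ_I)
  fix r :: real assume "r > 0"
  obtain G where G: "finite G" "h2_norm (\<lambda>k. if k \<in> G then 0 else x k) < r"
    using h2_tail_small[OF x \<open>r > 0\<close>] by blast
  define K0 where "K0 = Suc (\<Sum>l\<in>G. fst l + snd l)"
  have G': "fst l < K0 \<and> snd l < K0" if "l \<in> G" for l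
  proof -
    have "fst l + snd l \<le> (\<Sum>l\<in>G. fst l + snd l)"
      using that G by (intro member_le_sum[where f = "\<lambda>l. fst l + snd l"]) auto
    then show ?thesis by (simp add: K0_def)
  qed
  have "h2_norm (\<lambda>k. trunc K x k - x k) \<le> h2_norm (\<lambda>k. if k \<in> G then 0 else x k)" if "K \<ge> K0" for K
  proof (rule H2_mono(2))
    show "(\<lambda>k. if k \<in> G then 0 else x k) \<in> H2" using H2_mono(1)[OF x] by auto
    fix k show "cmod (trunc K x k - x k) \<le> cmod (if k \<in> G then 0 else x k)"
      using G'[of k] that by (auto simp: trunc_def)
  qed
  then show "\<exists>no. \<forall>n\<ge>no. norm (h2_norm (\<lambda>k. trunc n x k - x k) - 0) < r"
    using G by (intro exI[of _ K0]) fastforce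
qed

text \<open>For polynomial \<open>x\<close> this is \<open>bipoly_norm_mono\<close>. In general the
  truncations converge in norm, which controls the right-hand side, while \<open>h2_Fatou\<close>
  with slack \<open>e\<close> controls the left.\<close>

lemma conv_norm_mono:
  assumes a: "is_bipoly a" and b: "is_bipoly b" and C: "C \<ge> 0"
    and le: "\<And>z. z \<in> torus2 \<Longrightarrow> cmod (bipoly_eval a z) \<le> C * cmod (bipoly_eval b z)"
    and x: "x \<in> H2"
  shows "h2_norm (conv a x) \<le> C * h2_norm (conv b x)"
proof -
  define B where "B = (\<Sum>\<^sub>\<infinity>k. cmod (b k))"
  define X where "X = (\<lambda>K. trunc K x)"
  have XH: "X K \<in> H2" for K
    using H2_mono(1)[OF x, of "X K"] by (auto simp: X_def trunc_def)
  have bd: "h2_norm (conv a (X K)) \<le> C * (h2_norm (conv b x) + B * h2_norm (\<lambda>k. X K k - x k))" for K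
  proof -
    have "h2_norm (conv a (X K)) \<le> C * h2_norm (conv b (X K))"
      using C le by (intro bipoly_norm_mono bipoly_conv a b)
        (auto simp: X_def bipoly_trunc a b bipoly_eval_conv norm_mult mult.assoc[symmetric] intro: mult_right_mono)
    also have "conv b (X K) = (\<lambda>k. conv b x k + conv b (\<lambda>k. X K k - x k) k)"
      by (auto simp: conv_diff_right)
    also have "h2_norm \<dots> \<le> h2_norm (conv b x) + h2_norm (conv b (\<lambda>k. X K k - x k))"
      by (intro H2_add conv_bipoly_H2 b x H2_diff XH)
    also have "\<dots> \<le> h2_norm (conv b x) + B * h2_norm (\<lambda>k. X K k - x k)"
      using conv_bipoly_H2(2)[OF b H2_diff(1)[OF XH x]] by (simp add: B_def)
    finally show ?thesis using C by (simp add: mult_left_mono)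
  qed
  have lim: "(\<lambda>K. C * (h2_norm (conv b x) + B * h2_norm (\<lambda>k. X K k - x k))) \<longlonglongrightarrow> C * (h2_norm (conv b x) + B * 0)"
    unfolding X_def by (intro tendsto_intros trunc_norm_tendsto x)
  have "h2_norm (conv a x) \<le> C * h2_norm (conv b x) + e" if e: "e > 0" for e
  proof (rule h2_Fatou(2)[where F = sequentially and X = "\<lambda>K. conv a (X K)"])
    have "\<forall>\<^sub>F K in sequentially. C * (h2_norm (conv b x) + B * h2_norm (\<lambda>k. X K k - x k)) < C * h2_norm (conv b x) + e"
      using lim e by (intro order_tendstoD) auto
    then show "\<forall>\<^sub>F K in sequentially. conv a (X K) \<in> H2 \<and> h2_norm (conv a (X K)) \<le> C * h2_norm (conv b x) + e"
    proof eventually_elim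
      case (elim K)
      then show ?case using bd[of K] conv_bipoly_H2(1)[OF a XH[of K]] by simp
    qed
    show "\<And>k. (\<lambda>K. conv a (X K) k) \<longlonglongrightarrow> conv a x k"
      unfolding X_def by (intro conv_tendsto trunc_tendsto tendsto_const)
  qed auto
  then show ?thesis by (rule field_le_epsilon)
qed

section \<open>Inverses and dilations of a polynomial without zeros in the bidisk\<close>

lemma poly_nonconst_root_factor:
  fixes f :: "complex poly"
  assumes "degree f = Suc d"
  obtains \<alpha> g where "f = [:-\<alpha>, 1:] * g" "degree g = d" "poly f \<alpha> = 0"
proof -
  have "\<not> constant (poly f)" using assms by (simp add: constant_degree)
  then obtain \<alpha> where \<alpha>: "poly f \<alpha> = 0" using fundamental_theorem_of_algebra by blast
  then obtain g where g: "f = [:-\<alpha>, 1:] * g" by (auto simp: poly_eq_0_iff_dvd)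
  have "g \<noteq> 0" using g assms by auto
  then have "degree f = 1 + degree g" unfolding g by (subst degree_mult_eq) auto
  then show thesis using that g \<alpha> assms by simp
qed

text \<open>Factor by factor: a root \<alpha> at distance at least \<open>e\<close> from
  \<open>a\<close> satisfies |z - \<alpha>| <= |a - \<alpha>| (1 + |z - a| / e). The exponent is a
  degree bound, so the estimate is uniform over families of sections.\<close>

lemma poly_bound_away_from_roots:
  fixes f :: "complex poly"
  assumes "degree f \<le> d" "e > 0" "\<And>x. poly f x = 0 \<Longrightarrow> e \<le> cmod (a - x)"
  shows "cmod (poly f z) \<le> cmod (poly f a) * (1 + cmod (z - a) / e) ^ d"
proof -
  have "cmod (poly f z) \<le> cmod (poly f a) * (1 + cmod (z - a) / e) ^ degree f"
    using assms(3)
  proof (induction "degree f" arbitrary: f)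
    case 0
    then show ?case by (metis degree_eq_zeroE mult.right_neutral order_refl poly_const_conv power_0)
  next
    case (Suc k)
    obtain \<alpha> g where g: "f = [:-\<alpha>, 1:] * g" "degree g = k" "poly f \<alpha> = 0"
      using poly_nonconst_root_factor[of f k] Suc(2) by metis
    have IH: "cmod (poly g z) \<le> cmod (poly g a) * (1 + cmod (z - a) / e) ^ k"
      using Suc(1)[of g] g Suc(3) by (metis mult_zero_right poly_mult)
    have e: "e \<le> cmod (a - \<alpha>)" using Suc(3) g(3) by blast
    have "cmod (z - \<alpha>) \<le> cmod (a - \<alpha>) + cmod (z - a)"
      using norm_triangle_ineq[of "a - \<alpha>" "z - a"] by simp
    also have "\<dots> \<le> cmod (a - \<alpha>) * (1 + cmod (z - a) / e)"
    proof -
      have "cmod (z - a) = e * (cmod (z - a) / e)" using \<open>e > 0\<close> by simp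
      also have "\<dots> \<le> cmod (a - \<alpha>) * (cmod (z - a) / e)"
        using e \<open>e > 0\<close> by (intro mult_right_mono) auto
      finally show ?thesis by (simp add: distrib_left)
    qed
    finally have "cmod (z - \<alpha>) * cmod (poly g z) \<le>
      (cmod (a - \<alpha>) * (1 + cmod (z - a) / e)) * (cmod (poly g a) * (1 + cmod (z - a) / e) ^ k)"
      using IH \<open>e > 0\<close> by (intro mult_mono) auto
    moreover have "poly f x = (x - \<alpha>) * poly g x" for x unfolding g(1) by (simp add: algebra_simps)
    ultimately show ?case using Suc(2) by (simp add: norm_mult mult_ac flip: Suc(2))
  qed
  also have "\<dots> \<le> cmod (poly f a) * (1 + cmod (z - a) / e) ^ d"
    using assms by (intro mult_left_mono power_increasing) auto
  finally show ?thesis .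
qed

text \<open>Roots are removed one at a time: dividing a series by a linear factor whose root has
  modulus at least 1 amounts to summing coefficients and costs a factor
  \<open>k + 1\<close>.\<close>

lemma fps_inverse_poly_bound:
  fixes f :: "complex poly" and D :: "complex fps"
  assumes "degree f \<le> d" "\<And>x. poly f x = 0 \<Longrightarrow> 1 \<le> cmod x" "fps_of_poly f * D = 1"
  shows "cmod (fps_nth D k) \<le> real (k + 1) ^ d / cmod (coeff f 0)"
proof -
  have "cmod (fps_nth D k) \<le> real (k + 1) ^ degree f / cmod (coeff f 0)"
    using assms(2,3)
  proof (induction "degree f" arbitrary: f D k)
    case 0
    then obtain c where c: "f = [:c:]" by (metis degree_eq_zeroE)
    then have "fps_const c * D = 1" using 0 by (simp add: fps_of_poly_const)
    then have "fps_nth (fps_const c * D) k = fps_nth 1 k" by simp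
    then have "c * fps_nth D k = (if k = 0 then 1 else 0)" by simp
    then have "cmod c * cmod (fps_nth D k) = (if k = 0 then 1 else 0)"
      by (metis norm_mult norm_one norm_zero)
    moreover have "c \<noteq> 0" using \<open>fps_const c * D = 1\<close> by auto
    ultimately show ?case using c by (auto simp: field_simps split: if_splits)
  next
    case (Suc d)
    obtain \<alpha> g where g: "f = [:-\<alpha>, 1:] * g" "degree g = d" "poly f \<alpha> = 0"
      using poly_nonconst_root_factor[of f d] Suc(2) by metis
    have \<alpha>: "cmod \<alpha> \<ge> 1" using Suc(3) g by blast
    \<comment> \<open>\<open>E\<close> inverts the remaining factor \<open>g\<close>, so the
      induction hypothesis bounds it; \<open>nth\<close> recovers \<open>D\<close> from
      \<open>E\<close> by a one-step recursion.\<close>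
    define E where "E = fps_of_poly [:-\<alpha>, 1:] * D"
    have "fps_of_poly f = fps_of_poly [:-\<alpha>, 1:] * fps_of_poly g" unfolding g(1) fps_of_poly_mult ..
    with Suc(4) have "(fps_of_poly [:-\<alpha>, 1:] * fps_of_poly g) * D = 1" by (simp only:)
    then have "fps_of_poly g * E = 1" by (simp only: E_def mult_ac)
    then have E: "cmod (fps_nth E l) \<le> real (l + 1) ^ d / cmod (coeff g 0)" for l
      using Suc(1)[of g E l] g Suc(3) by (metis mult_zero_right poly_mult)
    have nth: "fps_nth E l = (if l = 0 then 0 else fps_nth D (l - 1)) - \<alpha> * fps_nth D l" for l
      by (simp add: E_def fps_of_poly_pCons algebra_simps)
    have rec: "cmod \<alpha> * cmod (fps_nth D l) \<le> (\<Sum>i\<le>l. cmod (fps_nth E i))" for l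
    proof (induction l)
      case 0
      show ?case using nth[of 0] by (simp add: norm_mult)
    next
      case (Suc l)
      have "\<alpha> * fps_nth D (Suc l) = fps_nth D l - fps_nth E (Suc l)" using nth[of "Suc l"] by simp
      then have "cmod \<alpha> * cmod (fps_nth D (Suc l)) \<le> cmod (fps_nth D l) + cmod (fps_nth E (Suc l))"
        by (metis norm_mult norm_triangle_ineq4)
      also have "cmod (fps_nth D l) \<le> cmod \<alpha> * cmod (fps_nth D l)"
        using mult_right_mono[OF \<alpha>, of "cmod (fps_nth D l)"] by simp
      finally show ?case using Suc by simp
    qed
    have "cmod \<alpha> * cmod (fps_nth D k) \<le> (\<Sum>i\<le>k. real (k + 1) ^ d / cmod (coeff g 0))"
    proof (rule order_trans[OF rec sum_mono])
      fix i assume "i \<in> {..k}"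
      then have "real (i + 1) ^ d / cmod (coeff g 0) \<le> real (k + 1) ^ d / cmod (coeff g 0)"
        by (intro divide_right_mono power_mono) auto
      then show "cmod (fps_nth E i) \<le> real (k + 1) ^ d / cmod (coeff g 0)" using E[of i] by linarith
    qed
    also have "\<dots> = real (k + 1) ^ Suc d / cmod (coeff g 0)" by simp
    finally have "cmod (fps_nth D k) \<le> real (k + 1) ^ Suc d / cmod (coeff g 0) / cmod \<alpha>"
      using \<alpha> by (subst pos_le_divide_eq) (auto simp: mult.commute)
    also have "\<dots> = real (k + 1) ^ Suc d / cmod (coeff f 0)"
      using g(1) by (simp add: norm_mult mult.commute)
    finally show ?case using Suc(2) by simp
  qed
  also have "\<dots> \<le> real (k + 1) ^ d / cmod (coeff f 0)"
    using assms by (intro divide_right_mono power_increasing) auto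
  finally show ?thesis .
qed

section \<open>Sections and slices of a two-variable polynomial\<close>

lemma bipoly_deg_le_bipoly: "bipoly_deg_le p m n \<Longrightarrow> is_bipoly p"
  unfolding is_bipoly_def bipoly_deg_le_def
  by (rule finite_subset[of _ "{..m} \<times> {..n}"]) auto

lemma bipoly_deg_le_eval:
  assumes "bipoly_deg_le p m n"
  shows "bipoly_eval p z = (\<Sum>i\<le>m. \<Sum>j\<le>n. p (i, j) * fst z ^ i * snd z ^ j)"
proof -
  have "bipoly_eval p z = (\<Sum>l\<in>{..m} \<times> {..n}. p l * zpow z l)"
    using assms by (intro bipoly_eval_zpow) (auto simp: bipoly_deg_le_def)
  then show ?thesis by (simp add: sum.cartesian_product zpow_def case_prod_unfold mult.assoc)
qed

lemma bipoly_section1: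
  assumes "bipoly_deg_le p m n"
  obtains f where "degree f \<le> m" "\<And>x. poly f x = bipoly_eval p (x, w)"
proof
  let ?f = "\<Sum>i\<le>m. monom (\<Sum>j\<le>n. p (i, j) * w ^ j) i"
  show "degree ?f \<le> m" by (intro degree_sum_le) (auto intro: order_trans[OF degree_monom_le])
  show "poly ?f x = bipoly_eval p (x, w)" for x
    by (simp add: bipoly_deg_le_eval[OF assms] poly_sum poly_monom sum_distrib_right sum_distrib_left mult_ac)
qed

lemma bipoly_section2:
  assumes "bipoly_deg_le p m n"
  obtains f where "degree f \<le> n" "\<And>x. poly f x = bipoly_eval p (w, x)"
proof
  let ?f = "\<Sum>j\<le>n. monom (\<Sum>i\<le>m. p (i, j) * w ^ i) j"
  show "degree ?f \<le> n" by (intro degree_sum_le) (auto intro: order_trans[OF degree_monom_le])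
  show "poly ?f x = bipoly_eval p (w, x)" for x
    unfolding bipoly_deg_le_eval[OF assms]
    by (subst sum.swap) (simp add: poly_sum poly_monom sum_distrib_right sum_distrib_left mult_ac)
qed

lemma continuous_bipoly_eval: "continuous_on A (bipoly_eval p)"
  unfolding bipoly_eval_def[abs_def] by (intro continuous_intros)

text \<open>Contracting one variable by \<open>r\<close> moves a point by at most 1 - r, while the
  zeros of the section have distance at least 1 - r from the contracted point; by
  \<open>poly_bound_away_from_roots\<close> each degree costs a factor 2.\<close>

lemma bipoly_dilation_bound:
  assumes deg: "bipoly_deg_le p m n" and nz: "\<forall>z\<in>bidisk. bipoly_eval p z \<noteq> 0"
    and r: "0 \<le> r" "r < 1" and z: "z \<in> torus2"
  shows "cmod (bipoly_eval p z) \<le> 2 ^ (m + n) * cmod (bipoly_eval p (of_real r * fst z, of_real r * snd z))"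
proof -
  define E where "E = (\<lambda>a b. bipoly_eval p (of_real a * fst z, of_real b * snd z))"
  have z1: "cmod (fst z) = 1" "cmod (snd z) = 1" using z by (auto simp: torus2_def)
  have gen: "cmod (poly f (of_real s * w)) \<le> 2 ^ d * cmod (poly f (of_real (r * s) * w))"
    if f: "degree f \<le> d" "\<And>x. cmod x < 1 \<Longrightarrow> poly f x \<noteq> 0" and w: "cmod w = 1" and s: "0 < s" "s < 1"
    for f d s w
  proof -
    have *: "1 - r \<le> cmod (of_real (r * s) * w - x)" if "poly f x = 0" for x
    proof -
      have "1 \<le> cmod x" using f(2) that by force
      moreover have "r * s \<le> r" using r s by (simp add: mult_left_le)
      moreover have "cmod (of_real (r * s) * w) = r * s" using r s w by (simp add: norm_mult)
      ultimately show ?thesis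
        using norm_triangle_ineq2[of x "of_real (r * s) * w"] by (simp add: norm_minus_commute)
    qed
    have "cmod (of_real s * w - of_real (r * s) * w) = s * (1 - r)"
    proof -
      have "of_real s * w - of_real (r * s) * w = of_real (s * (1 - r)) * w" by (simp add: algebra_simps)
      then show ?thesis using r s w by (simp only: norm_mult norm_of_real) (simp add: w)
    qed
    then have le2: "1 + cmod (of_real s * w - of_real (r * s) * w) / (1 - r) \<le> 2" using r s by simp
    have "cmod (poly f (of_real s * w)) \<le> cmod (poly f (of_real (r * s) * w)) *
        (1 + cmod (of_real s * w - of_real (r * s) * w) / (1 - r)) ^ d"
      by (rule poly_bound_away_from_roots[OF f(1) _ *]) (use r in auto)
    also have "\<dots> \<le> cmod (poly f (of_real (r * s) * w)) * 2 ^ d"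
      using r by (intro mult_left_mono power_mono le2) auto
    finally show ?thesis by (simp add: mult.commute)
  qed
  have inner: "cmod (E s s) \<le> 2 ^ (m + n) * cmod (E (r * s) (r * s))" if s: "0 < s" "s < 1" for s
  proof -
    obtain f where f: "degree f \<le> m" "\<And>x. poly f x = bipoly_eval p (x, of_real s * snd z)"
      using bipoly_section1[OF deg] by blast
    obtain g where g: "degree g \<le> n" "\<And>x. poly g x = bipoly_eval p (of_real (r * s) * fst z, x)"
      using bipoly_section2[OF deg] by blast
    have rs: "r * s < 1" "0 \<le> r * s" using r s mult_left_le[of s r] by auto
    have "poly f x \<noteq> 0" if "cmod x < 1" for x
      using nz that s z1 unfolding f by (auto simp: bidisk_def norm_mult)
    from gen[OF f(1) this z1(1) s] have 1: "cmod (E s s) \<le> 2 ^ m * cmod (E (r * s) s)"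
      unfolding f E_def by simp
    have "poly g x \<noteq> 0" if "cmod x < 1" for x
      using nz that rs z1 unfolding g by (auto simp: bidisk_def norm_mult simp del: of_real_mult)
    from gen[OF g(1) this z1(2) s] have 2: "cmod (E (r * s) s) \<le> 2 ^ n * cmod (E (r * s) (r * s))"
      unfolding g E_def by simp
    have "2 ^ m * cmod (E (r * s) s) \<le> 2 ^ m * (2 ^ n * cmod (E (r * s) (r * s)))"
      by (rule mult_left_mono[OF 2]) simp
    with 1 show ?thesis unfolding power_add mult.assoc by (rule order_trans)
  qed
  have cont: "isCont (bipoly_eval p) u" for u
    using continuous_bipoly_eval[of UNIV p] by (cases u) (simp add: continuous_on_eq_continuous_at)
  have "((\<lambda>s. E s s) \<longlongrightarrow> E 1 1) (at_left 1)"
    unfolding E_def by (intro isCont_tendsto_compose[OF cont] tendsto_intros)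
  moreover have "((\<lambda>s. E (r * s) (r * s)) \<longlongrightarrow> E (r * 1) (r * 1)) (at_left 1)"
    unfolding E_def by (intro isCont_tendsto_compose[OF cont] tendsto_intros)
  moreover have "\<forall>\<^sub>F s in at_left 1. cmod (E s s) \<le> 2 ^ (m + n) * cmod (E (r * s) (r * s))"
    using eventually_at_left_real[of 0 "1::real"] by (auto elim!: eventually_mono intro!: inner)
  ultimately have "cmod (E 1 1) \<le> 2 ^ (m + n) * cmod (E (r * 1) (r * 1))"
    by (intro tendsto_le[OF _ tendsto_mult[OF tendsto_const tendsto_norm] tendsto_norm]) auto
  then show ?thesis by (simp add: E_def)
qed

text \<open>The Taylor series of the slice \<open>\<lambda> \<mapsto> x(\<lambda> z\<^sub>1, \<lambda> z\<^sub>2)\<close>.\<close>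

definition diag :: "complex \<times> complex \<Rightarrow> (nat \<times> nat \<Rightarrow> complex) \<Rightarrow> complex fps" where
  "diag z x = Abs_fps (\<lambda>k. \<Sum>i\<le>k. x (i, k - i) * zpow z (i, k - i))"

lemma zpow_add: "zpow z (i + a, j + b) = zpow z (i, j) * zpow z (a, b)"
  by (simp add: zpow_def power_add)

text \<open>Restriction to the line through \<open>z\<close> respects products: the reindexing
  groups the terms by the total degree \<open>l\<close> of the monomial taken from
  \<open>x\<close>.\<close>

lemma diag_conv: "diag z (conv x y) = diag z x * diag z y"
proof (rule fps_ext)
  fix k
  let ?g = "\<lambda>a b c d. x (a, b) * y (c, d) * zpow z (a + c, b + d)"
  have "fps_nth (diag z (conv x y)) k = (\<Sum>i\<le>k. \<Sum>a\<le>i. \<Sum>b\<le>k-i. ?g a b (i - a) (k - i - b))"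
    by (simp add: diag_def conv_def sum_distrib_right)
  also have "\<dots> = (\<Sum>(i, a, b)\<in>(SIGMA i:{..k}. {..i} \<times> {..k-i}). ?g a b (i - a) (k - i - b))"
    unfolding sum.cartesian_product by (subst sum.Sigma) auto
  also have "\<dots> = (\<Sum>(l, a, c)\<in>(SIGMA l:{..k}. {..l} \<times> {..k-l}). ?g a (l - a) c (k - l - c))"
    by (rule sum.reindex_bij_witness[of _ "\<lambda>(l, a, c). (a + c, a, l - a)" "\<lambda>(i, a, b). (a + b, a, i - a)"])
      (auto simp: algebra_simps intro!: arg_cong2[where f = "(*)"] arg_cong[where f = x] arg_cong[where f = y] arg_cong[where f = "zpow z"])
  also have "\<dots> = (\<Sum>l\<le>k. \<Sum>a\<le>l. \<Sum>c\<le>k-l. ?g a (l - a) c (k - l - c))"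
    unfolding sum.cartesian_product by (subst sum.Sigma) auto
  also have "\<dots> = fps_nth (diag z x * diag z y) k"
    unfolding zpow_add by (simp add: diag_def fps_mult_nth atLeast0AtMost sum_product mult_ac)
  finally show "fps_nth (diag z (conv x y)) k = fps_nth (diag z x * diag z y) k" .
qed

lemma diag_conv_unit: "diag z conv_unit = 1"
proof (rule fps_ext)
  fix k
  have "(\<Sum>i\<le>k. conv_unit (i, k - i) * zpow z (i, k - i)) = (\<Sum>i\<le>k. if i = 0 then (if k = 0 then 1 else 0) else 0)"
    by (intro sum.cong refl) (auto simp: conv_unit_def zpow_def)
  then show "fps_nth (diag z conv_unit) k = fps_nth 1 k" by (simp add: diag_def)
qed

lemma bipoly_diag_poly:
  assumes deg: "bipoly_deg_le p m n"
  obtains f where "degree f \<le> m + n" "fps_of_poly f = diag z p"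
    "\<And>x. poly f x = bipoly_eval p (x * fst z, x * snd z)" "coeff f 0 = p (0, 0)"
proof
  let ?f = "\<Sum>i\<le>m. \<Sum>j\<le>n. monom (p (i, j) * zpow z (i, j)) (i + j)"
  show "degree ?f \<le> m + n"
    by (intro degree_sum_le) (auto intro!: degree_sum_le order_trans[OF degree_monom_le])
  show "poly ?f x = bipoly_eval p (x * fst z, x * snd z)" for x
    by (simp add: bipoly_deg_le_eval[OF deg] poly_sum poly_monom zpow_def power_add power_mult_distrib mult_ac)
  have c: "coeff ?f k = (\<Sum>i\<le>k. p (i, k - i) * zpow z (i, k - i))" for k
  proof -
    have "coeff ?f k = (\<Sum>l\<in>{..m} \<times> {..n}. if fst l + snd l = k then p l * zpow z l else 0)"
      by (simp add: coeff_sum sum.cartesian_product case_prod_unfold)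
    also have "\<dots> = (\<Sum>l\<in>(\<lambda>i. (i, k - i)) ` {..k}. p l * zpow z l)"
    proof (rule sum.mono_neutral_cong)
      fix l assume "l \<in> (\<lambda>i. (i, k - i)) ` {..k} - {..m} \<times> {..n}"
      then have "p l = 0" using deg unfolding bipoly_deg_le_def by force
      then show "p l * zpow z l = 0" by simp
    next
      fix l assume "l \<in> {..m} \<times> {..n} - (\<lambda>i. (i, k - i)) ` {..k}"
      then have "fst l + snd l \<noteq> k" by (cases l) (auto simp: image_iff)
      then show "(if fst l + snd l = k then p l * zpow z l else 0) = 0" by simp
    qed auto
    also have "\<dots> = (\<Sum>i\<le>k. p (i, k - i) * zpow z (i, k - i))"
      by (subst sum.reindex) (auto simp: inj_on_def)
    finally show ?thesis .
  qed
  show "fps_of_poly ?f = diag z p" by (rule fps_ext) (simp add: diag_def c del: coeff_sum)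
  show "coeff ?f 0 = p (0, 0)" using c[of 0] by (simp add: zpow_def del: coeff_sum)
qed

section \<open>The formal inverse of \<open>p\<close> and the growth of its coefficients\<close>

text \<open>The coefficient ring of \<open>fps2 p\<close> is not a field, so the inverse is built
  from an explicit inverse \<open>y\<close> of the lowest coefficient, a series in z2 with nonzero
  constant term.\<close>

lemma conv_inverse_exists:
  assumes "p (0, 0) \<noteq> 0" obtains c where "conv p c = conv_unit"
proof -
  define y where "y = inverse (fps_nth (fps2 p) 0)"
  have "fps_nth (fps2 p) 0 * y = 1"
    unfolding y_def using assms by (intro inverse_mult_eq_1') simp
  then have *: "fps2 p * fps_right_inverse (fps2 p) y = 1" by (rule fps_right_inverse)
  define c where "c = (\<lambda>k. fps_nth (fps_nth (fps_right_inverse (fps2 p) y) (fst k)) (snd k))"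
  have "fps2 c = fps_right_inverse (fps2 p) y" by (intro fps_ext) (simp add: c_def)
  then have "fps2 (conv p c) = fps2 conv_unit" using * by (simp add: fps2_conv fps2_conv_unit)
  then show thesis using that fps2_inject by blast
qed

lemma h2_norm_conv_unit: "conv_unit \<in> H2" "h2_norm conv_unit = 1"
proof -
  have "is_bipoly conv_unit" unfolding is_bipoly_def by (rule finite_subset[of _ "{(0,0)}"]) (auto simp: conv_unit_def)
  then show "conv_unit \<in> H2" unfolding is_bipoly_def by (rule H2_finite_support)
  have "(\<Sum>\<^sub>\<infinity>k. (cmod (conv_unit k))\<^sup>2) = (\<Sum>\<^sub>\<infinity>k\<in>{(0,0)}. (cmod (conv_unit k))\<^sup>2)"
    by (rule infsum_cong_neutral) (auto simp: conv_unit_def)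
  then show "h2_norm conv_unit = 1" by (simp add: h2_norm_def conv_unit_def)
qed

lemma conv_unit_bipoly: "is_bipoly conv_unit"
  unfolding is_bipoly_def by (rule finite_subset[of _ "{(0,0)}"]) (auto simp: conv_unit_def)

lemma conv_unit_eval: "bipoly_eval conv_unit z = 1"
  by (subst bipoly_eval_zpow[of "{(0,0)}"]) (auto simp: conv_unit_def zpow_def)

text \<open>On the torus the homogeneous part of degree \<open>N\<close> of 1/p is the
  \<open>N\<close>-th Taylor coefficient of 1/f for a slice \<open>f\<close> of \<open>p\<close>,
  and \<open>f\<close> has no zeros in the open unit disk. The resulting sup bound dominates the
  norm and hence each coefficient.\<close>

lemma conv_inverse_bound:
  assumes deg: "bipoly_deg_le p m n" and nz: "\<forall>z\<in>bidisk. bipoly_eval p z \<noteq> 0"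
    and c: "conv p c = conv_unit"
  shows "cmod (c k) \<le> real (fst k + snd k + 1) ^ (m + n) / cmod (p (0, 0))"
proof -
  define N where "N = fst k + snd k"
  define C where "C = real (N + 1) ^ (m + n) / cmod (p (0, 0))"
  define h where "h = (\<lambda>l. if fst l + snd l = N then c l else 0)"
  have h: "h l = 0" if "l \<notin> (\<lambda>i. (i, N - i)) ` {..N}" for l
    using that by (cases l) (auto simp: h_def image_iff)
  have hp: "is_bipoly h" unfolding is_bipoly_def
    by (rule finite_subset[of _ "(\<lambda>i. (i, N - i)) ` {..N}"]) (use h in auto)
  have "cmod (bipoly_eval h z) \<le> C" if z: "z \<in> torus2" for z
  proof -
    obtain f where f: "degree f \<le> m + n" "fps_of_poly f = diag z p"
      "\<And>x. poly f x = bipoly_eval p (x * fst z, x * snd z)" "coeff f 0 = p (0, 0)"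
      using bipoly_diag_poly[OF deg] by blast
    have rt: "1 \<le> cmod x" if "poly f x = 0" for x
      using nz that z unfolding f by (force simp: bidisk_def torus2_def norm_mult)
    have "fps_of_poly f * diag z c = 1"
      unfolding f diag_conv[symmetric] c diag_conv_unit ..
    from fps_inverse_poly_bound[OF f(1) rt this, of N]
    have "cmod (fps_nth (diag z c) N) \<le> C" by (simp add: C_def f)
    also have "fps_nth (diag z c) N = (\<Sum>l\<in>(\<lambda>i. (i, N - i)) ` {..N}. h l * zpow z l)"
      by (subst sum.reindex) (auto simp: inj_on_def diag_def h_def)
    also have "\<dots> = bipoly_eval h z" using h by (intro bipoly_eval_zpow[symmetric]) auto
    finally show ?thesis .
  qed
  then have "h2_norm h \<le> C * h2_norm conv_unit"
    by (intro bipoly_norm_mono hp conv_unit_bipoly) (auto simp: conv_unit_eval C_def)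
  moreover have "cmod (h k) \<le> h2_norm h"
    by (rule cmod_le_h2_norm[OF H2_finite_support]) (use hp in \<open>simp add: is_bipoly_def\<close>)
  ultimately show ?thesis by (simp add: h2_norm_conv_unit h_def N_def C_def)
qed

section \<open>Dilation of power series\<close>

definition dil :: "real \<Rightarrow> (nat \<times> nat \<Rightarrow> complex) \<Rightarrow> nat \<times> nat \<Rightarrow> complex" where
  "dil r x = (\<lambda>k. of_real r ^ (fst k + snd k) * x k)"

lemma dil_conv: "conv (dil r x) (dil r y) = dil r (conv x y)"
proof
  fix k :: "nat \<times> nat" obtain i j where k: "k = (i, j)" by (cases k)
  have "complex_of_real r ^ (a + b) * x (a, b) * (complex_of_real r ^ (i - a + (j - b)) * y (i - a, j - b))
     = complex_of_real r ^ (i + j) * (x (a, b) * y (i - a, j - b))" if "a \<le> i" "b \<le> j" for a b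
  proof -
    have "i + j = (a + b) + (i - a + (j - b))" using that by simp
    then have "complex_of_real r ^ (i + j) = complex_of_real r ^ (a + b) * complex_of_real r ^ (i - a + (j - b))"
      by (metis power_add)
    then show ?thesis by simp
  qed
  then have "(\<Sum>a\<le>i. \<Sum>b\<le>j. complex_of_real r ^ (a + b) * x (a, b) * (complex_of_real r ^ (i - a + (j - b)) * y (i - a, j - b)))
    = (\<Sum>a\<le>i. \<Sum>b\<le>j. complex_of_real r ^ (i + j) * (x (a, b) * y (i - a, j - b)))"
    by (intro sum.cong refl) (simp only: atMost_iff)
  then show "conv (dil r x) (dil r y) k = dil r (conv x y) k"
    unfolding k conv_def dil_def by (simp only: case_prod_conv fst_conv snd_conv sum_distrib_left)
qed

lemma dil_conv_unit: "dil r conv_unit = conv_unit"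
  by (auto simp: dil_def conv_unit_def)

lemma dil_bipoly: "is_bipoly p \<Longrightarrow> is_bipoly (dil r p)"
  unfolding is_bipoly_def by (rule finite_subset[of _ "{k. p k \<noteq> 0}"]) (auto simp: dil_def)

lemma dil_eval:
  assumes "is_bipoly p"
  shows "bipoly_eval (dil r p) z = bipoly_eval p (of_real r * fst z, of_real r * snd z)"
proof -
  have "bipoly_eval (dil r p) z = (\<Sum>l\<in>{l. p l \<noteq> 0}. dil r p l * zpow z l)"
    using assms by (intro bipoly_eval_zpow) (auto simp: is_bipoly_def dil_def)
  also have "\<dots> = (\<Sum>l\<in>{l. p l \<noteq> 0}. p l * zpow (of_real r * fst z, of_real r * snd z) l)"
    by (intro sum.cong refl) (simp add: dil_def zpow_def power_add power_mult_distrib mult_ac)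
  also have "\<dots> = bipoly_eval p (of_real r * fst z, of_real r * snd z)"
    using assms by (intro bipoly_eval_zpow[symmetric]) (auto simp: is_bipoly_def)
  finally show ?thesis .
qed

lemma dil_tendsto: "((\<lambda>r. dil r x k) \<longlongrightarrow> x k) (at_left 1)"
proof -
  have "((\<lambda>r. of_real r ^ (fst k + snd k) * x k) \<longlongrightarrow> of_real 1 ^ (fst k + snd k) * x k) (at_left 1)"
    by (intro tendsto_intros)
  then show ?thesis by (simp add: dil_def)
qed

lemma geometric_pair_summable:
  fixes s t :: real
  assumes "0 \<le> s" "s < 1" "0 \<le> t" "t < 1"
  shows "(\<lambda>k. s ^ fst k * t ^ snd k) summable_on UNIV"
proof -
  have t: "((\<lambda>n. t ^ n) has_sum (1 / (1 - t))) UNIV"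
    using assms geometric_sums[of t] by (intro norm_summable_imp_has_sum) (auto simp: summable_geometric)
  have "(\<lambda>k. s ^ fst k * t ^ snd k) summable_on (SIGMA x:UNIV. UNIV)"
  proof (rule summable_on_SigmaI)
    show "((\<lambda>y. s ^ fst (x, y) * t ^ snd (x, y)) has_sum s ^ x * (1 / (1 - t))) UNIV" for x
      using has_sum_cmult_right[OF t] by simp
    show "(\<lambda>x. s ^ x * (1 / (1 - t))) summable_on UNIV"
      using assms by (subst summable_on_UNIV_nonneg_real_iff) (auto intro!: summable_mult2 summable_geometric)
  qed (use assms in auto)
  then show ?thesis by simp
qed

text \<open>With \<open>r = s * s\<close>, one factor \<open>s ^ N\<close> absorbs the polynomial
  growth and the other leaves a convergent double geometric series.\<close>

lemma dil_poly_growth_summable: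
  assumes c: "\<And>k. cmod (c k) \<le> real (fst k + snd k + 1) ^ d * K" and r: "0 < r" "r < 1"
  shows "(\<lambda>k. cmod (dil r c k)) summable_on UNIV"
proof -
  define s where "s = sqrt r"
  have s: "0 < s" "s < 1" "r = s * s" using r by (auto simp: s_def)
  have "(\<lambda>k. real k ^ d * s ^ k) \<longlonglongrightarrow> 0"
  proof (cases "d = 0")
    case True
    then show ?thesis using s by (simp add: LIMSEQ_realpow_zero)
  next
    case False
    \<comment> \<open>The \<open>d\<close>-th root turns \<open>real k ^ d * s ^ k\<close> into the
      \<open>d\<close>-th power of \<open>k * t ^ k\<close>, which tends to 0; hence the separate
      case \<open>d = 0\<close>.\<close>
    define t where "t = root d s"
    have t: "norm t < 1" "s = t ^ d" using s False by (auto simp: t_def)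
    have "(\<lambda>k. (of_nat k * t ^ k) ^ d) \<longlonglongrightarrow> 0 ^ d"
      by (intro tendsto_power powser_times_n_limit_0 t)
    then show ?thesis using False by (simp add: t power_mult_distrib mult.commute zero_power flip: power_mult)
  qed
  then have "Bseq (\<lambda>k. real k ^ d * s ^ k)" by (intro convergent_imp_Bseq) (auto simp: convergent_def)
  then obtain M where M: "M > 0" "\<And>k. norm (real k ^ d * s ^ k) \<le> M" by (auto simp: Bseq_def)
  have K: "K \<ge> 0" using c[of "(0,0)"] norm_ge_zero[of "c (0,0)"] by (simp del: norm_ge_zero)
  show ?thesis
  proof (rule summable_on_comparison_test)
    show "(\<lambda>k. (M / s * K) * (s ^ fst k * s ^ snd k)) summable_on UNIV"
      by (intro summable_on_cmult_right geometric_pair_summable) (use s in auto)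
    fix k :: "nat \<times> nat"
    define N where "N = fst k + snd k"
    have "real (N + 1) ^ d * s ^ N * s \<le> M" using M(2)[of "N + 1"] s by (simp add: mult_ac)
    then have b: "real (N + 1) ^ d * s ^ N \<le> M / s" using s by (simp add: field_simps)
    have "cmod (dil r c k) = (s ^ N * s ^ N) * cmod (c k)"
      using r s by (simp add: dil_def norm_mult norm_power N_def power_mult_distrib)
    also have "\<dots> \<le> (s ^ N * s ^ N) * (real (N + 1) ^ d * K)"
      using c[of k] s by (intro mult_left_mono) (auto simp: N_def)
    also have "\<dots> = (real (N + 1) ^ d * s ^ N) * (K * s ^ N)" by (simp add: mult_ac)
    also have "\<dots> \<le> (M / s) * (K * s ^ N)"
      using K s by (intro mult_right_mono b) auto
    also have "\<dots> = (M / s * K) * (s ^ fst k * s ^ snd k)" by (simp add: N_def power_add)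
    finally show "cmod (dil r c k) \<le> (M / s * K) * (s ^ fst k * s ^ snd k)" .
  qed auto
qed

section \<open>The model space\<close>

text \<open>Once the lower coefficients vanish, division by \<open>z ^ i\<close> and z -> 0 leave
  \<open>a i\<close>.\<close>

lemma powser_zero_imp_coeff_zero:
  fixes a :: "nat \<Rightarrow> complex"
  assumes "\<And>z. cmod z < 1 \<Longrightarrow> (\<lambda>i. a i * z ^ i) sums 0"
  shows "a i = 0"
proof (induction i rule: less_induct)
  case (less i)
  have "(\<lambda>n. a (n + i) * z ^ n) sums 0" if z: "z \<noteq> 0" "cmod z < 1" for z
  proof -
    have "(\<lambda>n. a (n + i) * z ^ (n + i)) sums (0 - (\<Sum>l<i. a l * z ^ l))"
      using sums_split_initial_segment[OF assms[OF z(2)], of i] .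
    then have "(\<lambda>n. a (n + i) * z ^ (n + i)) sums 0" using less by simp
    then have "(\<lambda>n. (a (n + i) * z ^ (n + i)) * inverse (z ^ i)) sums (0 * inverse (z ^ i))"
      by (rule sums_mult2)
    then show ?thesis using z by (simp add: power_add mult.assoc)
  qed
  then have "((\<lambda>z. 0) \<longlongrightarrow> a (0 + i)) (at (0::complex))"
    by (intro powser_limit_0_strong[of 1 "\<lambda>n. a (n + i)"]) auto
  then show ?case by (simp add: tendsto_const_iff)
qed

lemma zpow_H2:
  assumes "z \<in> bidisk" shows "zpow z \<in> H2"
proof -
  have z: "cmod (fst z) < 1" "cmod (snd z) < 1" using assms by (auto simp: bidisk_def)
  have "(\<lambda>k. ((cmod (fst z))\<^sup>2) ^ fst k * ((cmod (snd z))\<^sup>2) ^ snd k) summable_on UNIV"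
    using z by (intro geometric_pair_summable) (auto simp: power_less_one_iff)
  then show ?thesis
    by (simp add: H2_def zpow_def norm_mult norm_power power_mult_distrib flip: power_mult add: mult.commute)
qed

text \<open>Evaluation is the pairing with the Szego kernel, which lies in \<open>H2\<close> for
  points of the bidisk.\<close>

lemma H2_has_eval:
  assumes "x \<in> H2" "z \<in> bidisk" shows "((\<lambda>k. x k * zpow z k) has_sum h2_eval x z) UNIV"
proof -
  have "zpow z = (\<lambda>k. cnj (zpow (cnj (fst z), cnj (snd z)) k))" by (auto simp: zpow_def)
  moreover have "(cnj (fst z), cnj (snd z)) \<in> bidisk" using assms by (auto simp: bidisk_def)
  ultimately have "(\<lambda>k. x k * zpow z k) summable_on UNIV"
    using h2_inner_summable[OF assms(1) zpow_H2] by metis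
  then show ?thesis unfolding h2_eval_zpow by simp
qed

text \<open>One variable at a time: for fixed \<open>w\<close> the values \<open>f i w\<close> are
  the coefficients of a power series in z1, and then each row is a power series in
  \<open>w\<close>.\<close>

lemma h2_eval_zero_imp_zero:
  assumes x: "x \<in> H2" and ev: "\<And>z. z \<in> bidisk \<Longrightarrow> h2_eval x z = 0"
  shows "x k = 0"
proof -
  define f where "f = (\<lambda>i w. \<Sum>\<^sub>\<infinity>j. x (i, j) * w ^ j)"
  have row: "((\<lambda>j. x (i, j) * w ^ j) has_sum f i w) UNIV" if w: "cmod w < 1" for i w
  proof -
    \<comment> \<open>Any nonzero first coordinate in the disk would do; the factor
      \<open>2 ^ i\<close> removes it again.\<close>
    have "(\<lambda>l. x l * zpow (1/2, w) l) summable_on UNIV"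
      using H2_has_eval[OF x, of "(1/2, w)"] w by (auto simp: bidisk_def summable_on_def)
    then have "(\<lambda>(i, j). x (i, j) * zpow (1/2, w) (i, j)) summable_on (SIGMA i:UNIV. UNIV)"
      by (simp add: case_prod_unfold)
    from summable_on_SigmaD1[OF this] have "(\<lambda>j. x (i, j) * zpow (1/2, w) (i, j)) summable_on UNIV" by simp
    then have "(\<lambda>j. 2 ^ i * (x (i, j) * zpow (1/2, w) (i, j))) summable_on UNIV"
      by (rule summable_on_cmult_right)
    moreover have "2 ^ i * (x (i, j) * zpow (1/2, w) (i, j)) = x (i, j) * w ^ j" for j
      by (simp add: zpow_def power_divide)
    ultimately show ?thesis by (simp add: f_def)
  qed
  have f0: "f i w = 0" if w: "cmod w < 1" for i w
  proof (rule powser_zero_imp_coeff_zero[of "\<lambda>i. f i w"])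
    fix z :: complex assume z: "cmod z < 1"
    have b: "(z, w) \<in> bidisk" using z w by (simp add: bidisk_def)
    have "((\<lambda>l. x l * zpow (z, w) l) has_sum 0) (SIGMA i:UNIV. UNIV)"
      using H2_has_eval[OF x b] ev[OF b] by simp
    moreover have "((\<lambda>j. x (i, j) * zpow (z, w) (i, j)) has_sum (f i w * z ^ i)) UNIV" for i
      using has_sum_cmult_left[OF row[OF w, of i], of "z ^ i"] by (simp add: zpow_def mult_ac)
    ultimately have "((\<lambda>i. f i w * z ^ i) has_sum 0) UNIV"
      by (rule has_sum_SigmaD)
    then show "(\<lambda>i. f i w * z ^ i) sums 0" by (rule has_sum_imp_sums)
  qed
  have "x (fst k, j) = 0" for j
  proof (rule powser_zero_imp_coeff_zero[of "\<lambda>j. x (fst k, j)"])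
    fix w :: complex assume w: "cmod w < 1"
    show "(\<lambda>j. x (fst k, j) * w ^ j) sums 0"
      using row[OF w, of "fst k"] f0[OF w] by (auto intro: has_sum_imp_sums)
  qed
  then show ?thesis by (metis prod.collapse)
qed

section \<open>The reflected polynomial\<close>

lemma reflect_deg_le: "bipoly_deg_le (reflect m n p) m n"
  by (auto simp: bipoly_deg_le_def reflect_def split: if_splits)

lemma sum_atMost_reverse: "(\<Sum>i\<le>m. f (m - i)) = (\<Sum>i\<le>(m::nat). f i)"
  by (rule sum.reindex_bij_witness[of _ "\<lambda>i. m - i" "\<lambda>i. m - i"]) auto

text \<open>On the torus conjugation is inversion in each variable, so p~ equals z1^m z2^n times the
  conjugate of \<open>p\<close> there.\<close>

lemma reflect_eval_norm:
  assumes deg: "bipoly_deg_le p m n" and z: "z \<in> torus2"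
  shows "cmod (bipoly_eval (reflect m n p) z) = cmod (bipoly_eval p z)"
proof -
  have unit: "cmod (fst z) = 1" "cmod (snd z) = 1" using z by (auto simp: torus2_def)
  have pw: "u ^ (k - i) = u ^ k * cnj u ^ i" if "cmod u = 1" "i \<le> k" for u :: complex and i k
  proof -
    have "u ^ k * cnj u ^ i = u ^ (k - i) * (u ^ i * cnj u ^ i)"
      using that by (metis le_add_diff_inverse2 mult.assoc power_add)
    also have "u ^ i * cnj u ^ i = 1"
      using that complex_norm_square[of u] by (simp flip: power_mult_distrib)
    finally show ?thesis by simp
  qed
  have "bipoly_eval (reflect m n p) z = (\<Sum>i\<le>m. \<Sum>j\<le>n. reflect m n p (m - i, n - j) * fst z ^ (m - i) * snd z ^ (n - j))"
    unfolding bipoly_deg_le_eval[OF reflect_deg_le]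
    using sum_atMost_reverse[of "\<lambda>i. \<Sum>j\<le>n. reflect m n p (i, j) * fst z ^ i * snd z ^ j" m]
      sum_atMost_reverse[of "\<lambda>j. reflect m n p (m - i, j) * fst z ^ (m - i) * snd z ^ j" n for i]
    by simp
  also have "\<dots> = (\<Sum>i\<le>m. \<Sum>j\<le>n. fst z ^ m * snd z ^ n * cnj (p (i, j) * fst z ^ i * snd z ^ j))"
    by (intro sum.cong refl) (auto simp: reflect_def pw[OF unit(1)] pw[OF unit(2)])
  also have "\<dots> = fst z ^ m * snd z ^ n * cnj (bipoly_eval p z)"
    unfolding bipoly_deg_le_eval[OF deg] by (simp add: sum_distrib_left)
  finally show ?thesis using unit by (simp add: norm_mult norm_power)
qed

text \<open>Both sides are the same finite sum, reindexed by reversing the exponents of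
  \<open>p\<close>. Orthogonality to the monomial multiples of p~ thereby becomes the vanishing of
  coefficients of p h.\<close>

lemma h2_inner_reflect:
  assumes deg: "bipoly_deg_le p m n"
  shows "h2_inner h (shift (a, b) (reflect m n p)) = conv p h (m + a, n + b)"
proof -
  let ?A = "(\<lambda>l. (m - fst l + a, n - snd l + b)) ` ({..m} \<times> {..n})"
  have "h2_inner h (shift (a, b) (reflect m n p)) = (\<Sum>\<^sub>\<infinity>l\<in>?A. h l * cnj (shift (a, b) (reflect m n p) l))"
    unfolding h2_inner_def
  proof (rule infsum_cong_neutral)
    fix l assume l: "l \<in> UNIV - ?A"
    have "l \<in> ?A" if "a \<le> fst l" "b \<le> snd l" "fst l - a \<le> m" "snd l - b \<le> n"
      using that by (intro image_eqI[of _ _ "(m - (fst l - a), n - (snd l - b))"]) (auto simp: prod_eq_iff)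
    then show "h l * cnj (shift (a, b) (reflect m n p) l) = 0"
      using l by (auto simp: shift_def reflect_def)
  qed auto
  also have "\<dots> = (\<Sum>l\<in>?A. h l * cnj (shift (a, b) (reflect m n p) l))" by simp
  also have "\<dots> = (\<Sum>l\<in>{..m} \<times> {..n}. p l * shift l h (m + a, n + b))"
    by (subst sum.reindex) (auto simp: inj_on_def shift_def reflect_def intro!: sum.cong)
  also have "\<dots> = conv p h (m + a, n + b)"
    using deg by (intro conv_eq_sum_shift[symmetric]) (auto simp: bipoly_deg_le_def)
  finally show ?thesis .
qed

lemma H2_bipoly: "is_bipoly x \<Longrightarrow> x \<in> H2"
  unfolding is_bipoly_def by (rule H2_finite_support)

lemma H2_eval_conv:
  assumes "is_bipoly q" "x \<in> H2" "z \<in> bidisk"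
  shows "h2_eval (conv q x) z = bipoly_eval q z * h2_eval x z"
  unfolding h2_eval_zpow[of "conv q x"]
  by (rule infsumI[OF conv_has_sum[OF assms(1) H2_has_eval[OF assms(2,3)]]])

section \<open>The model space described by the coefficients of p h\<close>

locale stable_bipoly =
  fixes p :: "nat \<times> nat \<Rightarrow> complex" and m n :: nat
  assumes deg: "bipoly_deg_le p m n" and nz: "\<forall>z\<in>bidisk. bipoly_eval p z \<noteq> 0"
begin

abbreviation pt where "pt \<equiv> reflect m n p"

lemma p_bipoly: "is_bipoly p" using bipoly_deg_le_bipoly[OF deg] .

lemma pt_bipoly: "is_bipoly pt" using bipoly_deg_le_bipoly[OF reflect_deg_le] .

lemma p00: "p (0, 0) \<noteq> 0"
proof -
  have "bipoly_eval p (0, 0) = p (0, 0)"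
  proof -
    have fin: "finite (insert (0, 0) {l. p l \<noteq> 0})" using p_bipoly by (simp add: is_bipoly_def)
    have "bipoly_eval p (0, 0) = (\<Sum>l\<in>insert (0, 0) {l. p l \<noteq> 0}. p l * zpow (0, 0) l)"
      using fin by (rule bipoly_eval_zpow) auto
    also have "\<dots> = (\<Sum>l\<in>{(0, 0)}. p l * zpow (0, 0) l)"
      using fin by (intro sum.mono_neutral_right) (auto simp: zpow_def power_0_left)
    finally show ?thesis by (simp add: zpow_def)
  qed
  then show ?thesis using nz by (auto simp: bidisk_def)
qed

text \<open>Taylor coefficients of 1/p, in general not square summable; hence the dilates
  \<open>dil r pinv\<close> below.\<close>

definition pinv where "pinv = (SOME c. conv p c = conv_unit)"

lemma conv_pinv: "conv p pinv = conv_unit"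
proof -
  obtain c where "conv p c = conv_unit" using conv_inverse_exists[of p, OF p00] by blast
  then show ?thesis unfolding pinv_def by (rule someI[where P = "\<lambda>c. conv p c = conv_unit"])
qed

lemma conv_p_cancel: "conv p x = (\<lambda>k. 0) \<Longrightarrow> x = (\<lambda>k. 0)"
  by (metis conv_assoc conv_commute conv_pinv conv_unit_left conv_zero_right)

lemma pinv_dil_summable:
  assumes "0 < r" "r < 1" shows "(\<lambda>k. cmod (dil r pinv k)) summable_on UNIV"
  using conv_inverse_bound[OF deg nz conv_pinv] assms
  by (intro dil_poly_growth_summable[of _ "m + n" "1 / cmod (p (0,0))"]) auto

lemma pinv_dil_conv_H2:
  assumes "0 < r" "r < 1" "x \<in> H2" shows "conv (dil r pinv) x \<in> H2"
  by (rule conv_H2(1)[OF pinv_dil_summable[OF assms(1,2)] assms(3)])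

lemma conv_dil_pinv: "conv (dil r p) (conv (dil r pinv) x) = x"
  unfolding conv_assoc[symmetric] dil_conv conv_pinv dil_conv_unit by simp

text \<open>On the torus |p~| = |p|, and \<open>bipoly_dilation_bound\<close> dominates |p| by the
  dilate of \<open>p\<close> with a constant independent of \<open>r\<close>; the dilate then
  cancels against its inverse.\<close>

lemma conv_pinv_dil_bound:
  assumes r: "0 < r" "r < 1" and x: "x \<in> H2" and q: "q = p \<or> q = pt"
  shows "conv q (conv (dil r pinv) x) \<in> H2" "h2_norm (conv q (conv (dil r pinv) x)) \<le> 2 ^ (m + n) * h2_norm x"
proof -
  note y = pinv_dil_conv_H2[OF r x]
  have qb: "is_bipoly q" using q p_bipoly pt_bipoly by auto
  show "conv q (conv (dil r pinv) x) \<in> H2" by (rule conv_bipoly_H2(1)[OF qb y])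
  have "cmod (bipoly_eval q z) \<le> 2 ^ (m + n) * cmod (bipoly_eval (dil r p) z)" if z: "z \<in> torus2" for z
    using bipoly_dilation_bound[OF deg nz _ r(2) z] r q reflect_eval_norm[OF deg z] by (auto simp: dil_eval[OF p_bipoly])
  then have "h2_norm (conv q (conv (dil r pinv) x)) \<le> 2 ^ (m + n) * h2_norm (conv (dil r p) (conv (dil r pinv) x))"
    by (intro conv_norm_mono qb dil_bipoly p_bipoly y) auto
  then show "h2_norm (conv q (conv (dil r pinv) x)) \<le> 2 ^ (m + n) * h2_norm x"
    unfolding conv_dil_pinv .
qed

lemma conv_pinv_dil_tendsto: "((\<lambda>r. conv q (conv (dil r pinv) x) k) \<longlongrightarrow> conv q (conv pinv x) k) (at_left 1)"
  by (intro conv_tendsto tendsto_const dil_tendsto)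

lemma eventually_unit_interval: "\<forall>\<^sub>F r in at_left (1::real). 0 < r \<and> r < 1"
  using eventually_at_left_real[of 0 "1::real"] by (auto elim!: eventually_mono)

text \<open>A monomial multiple of p~ is \<Theta> times the same multiple of
  \<open>p\<close>.\<close>

lemma shift_reflect_in_range: "shift l pt \<in> mult_range (rif m n p)"
proof -
  have ev: "h2_eval (shift l q) z = zpow z l * bipoly_eval q z" if "is_bipoly q" for q z
    unfolding h2_eval_zpow by (rule infsumI[OF shift_has_sum[OF bipoly_has_sum[OF that]]])
  show ?thesis
    unfolding mult_range_def mem_Collect_eq
    using nz H2_shift(1)[OF H2_bipoly[OF pt_bipoly]] H2_shift(1)[OF H2_bipoly[OF p_bipoly], of l]
    by (auto intro!: bexI[of _ "shift l p"] simp: ev[OF p_bipoly] ev[OF pt_bipoly] rif_def)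
qed

lemma model_space_imp:
  assumes "h \<in> model_space (rif m n p)" "m \<le> i" "n \<le> j"
  shows "conv p h (i, j) = 0"
proof -
  have "h2_inner h (shift (i - m, j - n) pt) = 0"
    using assms(1) shift_reflect_in_range by (auto simp: model_space_def h2_orth_compl_def)
  then show ?thesis using assms by (simp add: h2_inner_reflect[OF deg])
qed

text \<open>Linearity and \<open>h2_inner_reflect\<close> settle polynomial multipliers; truncation
  of \<open>x\<close> and weak convergence do the rest.\<close>

lemma orthogonal_reflect_range:
  assumes h: "h \<in> H2" and ph: "\<And>i j. m \<le> i \<Longrightarrow> n \<le> j \<Longrightarrow> conv p h (i, j) = 0" and x: "x \<in> H2"
  shows "h2_inner (conv pt x) h = 0"
proof -
  have fin: "h2_inner (conv pt (trunc K x)) h = 0" for K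
  proof -
    let ?A = "{l. trunc K x l \<noteq> 0}"
    have "conv pt (trunc K x) = (\<lambda>k. \<Sum>l\<in>?A. trunc K x l * shift l pt k)"
      unfolding conv_commute[of pt] by (rule conv_bipoly[OF bipoly_trunc])
    then have "h2_inner h (conv pt (trunc K x)) = (\<Sum>l\<in>?A. cnj (trunc K x l) * h2_inner h (shift l pt))"
      using bipoly_trunc[of K x] h2_inner_sum_right[of ?A "\<lambda>l. shift l pt" h] H2_shift(1)[OF H2_bipoly[OF pt_bipoly]] h
      by (simp add: is_bipoly_def)
    also have "\<dots> = 0"
    proof (rule sum.neutral, rule ballI)
      fix l :: "nat \<times> nat"
      have "h2_inner h (shift l pt) = 0"
        using ph h2_inner_reflect[OF deg, of h "fst l" "snd l"] by simp
      then show "cnj (trunc K x l) * h2_inner h (shift l pt) = 0" by simp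
    qed
    finally show ?thesis by (metis complex_cnj_zero h2_inner_commute)
  qed
  define C where "C = (\<Sum>\<^sub>\<infinity>k. cmod (pt k)) * h2_norm x"
  have "conv pt (trunc K x) \<in> H2 \<and> h2_norm (conv pt (trunc K x)) \<le> C" for K
  proof -
    have t: "trunc K x \<in> H2" "h2_norm (trunc K x) \<le> h2_norm x"
      using H2_mono[OF x, of "trunc K x"] by (auto simp: trunc_def)
    have "(\<Sum>\<^sub>\<infinity>k. cmod (pt k)) * h2_norm (trunc K x) \<le> C"
      unfolding C_def using t by (intro mult_left_mono infsum_nonneg) auto
    then show ?thesis using conv_bipoly_H2[OF pt_bipoly t(1)] by linarith
  qed
  then have "(\<lambda>K. h2_inner (conv pt (trunc K x)) h) \<longlonglongrightarrow> h2_inner (conv pt x) h"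
    by (intro h2_weak_convergence[where C = C] h always_eventually conv_tendsto tendsto_const trunc_tendsto) auto
  then show ?thesis unfolding fin using LIMSEQ_unique tendsto_const by metis
qed

text \<open>The dilates of \<open>1/p\<close> show that \<open>p~\<close> times polynomials is weakly dense in \<open>\<Theta> H\<^sup>2\<close>.\<close>

lemma model_spaceI:
  assumes h: "h \<in> H2" and ph: "\<And>i j. m \<le> i \<Longrightarrow> n \<le> j \<Longrightarrow> conv p h (i, j) = 0"
  shows "h \<in> model_space (rif m n p)"
proof -
  have "h2_inner h G = 0" if G: "G \<in> mult_range (rif m n p)" for G
  proof -
    obtain g where g: "G \<in> H2" "g \<in> H2" "\<And>z. z \<in> bidisk \<Longrightarrow> h2_eval G z = rif m n p z * h2_eval g z"
      using G by (auto simp: mult_range_def)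
    have "conv p G k - conv pt g k = 0" for k
    proof (rule h2_eval_zero_imp_zero)
      note H = conv_bipoly_H2(1)[OF p_bipoly g(1)] conv_bipoly_H2(1)[OF pt_bipoly g(2)]
      show "(\<lambda>k. conv p G k - conv pt g k) \<in> H2" by (rule H2_diff(1)[OF H])
      fix z assume z: "z \<in> bidisk"
      have "h2_eval (\<lambda>k. conv p G k - conv pt g k) z = h2_eval (conv p G) z - h2_eval (conv pt g) z"
        unfolding h2_eval_zpow[of "\<lambda>k. conv p G k - conv pt g k"]
        using has_sum_add[OF H2_has_eval[OF H(1) z] has_sum_uminusI[OF H2_has_eval[OF H(2) z]]]
        by (intro infsumI) (simp add: algebra_simps)
      also have "\<dots> = 0"
        using nz z by (simp add: H2_eval_conv p_bipoly pt_bipoly g z rif_def)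
      finally show "h2_eval (\<lambda>k. conv p G k - conv pt g k) z = 0" .
    qed
    \<comment> \<open>Multiplied by \<open>p\<close>, the relation G = \<Theta> g becomes an
      identity of coefficients, to which the dilated inverses can be applied.\<close>
    then have eq: "conv p G = conv pt g" by (auto simp: fun_eq_iff)
    \<comment> \<open>The products of p / p(r z) with \<open>G\<close> converge weakly to
      \<open>G\<close>; they equal those of p~ / p(r z) with \<open>g\<close> and so are orthogonal
      to \<open>h\<close>.\<close>
    have "((\<lambda>r. h2_inner (conv p (conv (dil r pinv) G)) h) \<longlongrightarrow> h2_inner (conv p (conv pinv G)) h) (at_left 1)"
      by (rule h2_weak_convergence[where C = "2 ^ (m + n) * h2_norm G"])
        (use eventually_unit_interval conv_pinv_dil_bound[OF _ _ g(1)] h conv_pinv_dil_tendsto in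
         \<open>auto elim!: eventually_mono\<close>)
    moreover have "conv p (conv pinv G) = G" unfolding conv_assoc[symmetric] conv_pinv by simp
    moreover have "\<forall>\<^sub>F r in at_left 1. h2_inner (conv p (conv (dil r pinv) G)) h = 0"
      using eventually_unit_interval
    proof eventually_elim
      case (elim r)
      have "conv p (conv (dil r pinv) G) = conv pt (conv (dil r pinv) g)"
        by (metis conv_left_commute eq)
      then show ?case
        using orthogonal_reflect_range[OF h ph pinv_dil_conv_H2[OF _ _ g(2)]] elim by simp
    qed
    ultimately have "h2_inner G h = 0"
      using tendsto_unique[OF trivial_limit_at_left_real _ tendsto_eventually] by metis
    then show ?thesis by (metis complex_cnj_zero h2_inner_commute)
  qed
  then show ?thesis using h by (simp add: model_space_def h2_orth_compl_def)
qed

text \<open>The functions p~ / p(r z) are bounded in norm uniformly in \<open>r\<close>, so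
  \<open>h2_Fatou\<close> applies as \<open>r\<close> tends to 1.\<close>

lemma theta_H2: "conv pt pinv \<in> H2"
proof -
  have "((\<lambda>r. conv pt (conv (dil r pinv) conv_unit) k) \<longlongrightarrow> conv pt (conv pinv conv_unit) k) (at_left 1)" for k
    by (rule conv_pinv_dil_tendsto)
  then have "conv pt (conv pinv conv_unit) \<in> H2"
    by (rule h2_Fatou(1)[where C = "2 ^ (m + n) * h2_norm conv_unit", rotated 2])
      (use eventually_unit_interval conv_pinv_dil_bound[OF _ _ h2_norm_conv_unit(1)] in \<open>auto elim!: eventually_mono\<close>)
  then show ?thesis by (simp add: conv_commute[of pinv])
qed

end

section \<open>The numerical radius on the maximal invariant subspace\<close>

text \<open>The adjoint of multiplication by z1, see \<open>h2_inner_bshift\<close>.\<close>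

definition bshift :: "(nat \<times> nat \<Rightarrow> complex) \<Rightarrow> nat \<times> nat \<Rightarrow> complex" where
  "bshift x = (\<lambda>k. x (Suc (fst k), snd k))"

definition row0 :: "(nat \<times> nat \<Rightarrow> complex) \<Rightarrow> nat \<times> nat \<Rightarrow> complex" where
  "row0 x = (\<lambda>k. if fst k = 0 then x k else 0)"

lemma H2_bshift:
  assumes x: "x \<in> H2" shows "bshift x \<in> H2" "h2_norm (bshift x) \<le> h2_norm x"
proof -
  have "(\<Sum>k\<in>F. (cmod (bshift x k))\<^sup>2) \<le> (h2_norm x)\<^sup>2" if "finite F" for F
  proof -
    have "(\<Sum>k\<in>F. (cmod (bshift x k))\<^sup>2) = (\<Sum>k\<in>(\<lambda>k. (Suc (fst k), snd k)) ` F. (cmod (x k))\<^sup>2)"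
      by (subst sum.reindex) (auto simp: inj_on_def bshift_def prod_eq_iff)
    also have "\<dots> \<le> (h2_norm x)\<^sup>2" by (rule sum_le_h2_norm_sq[OF x]) (use that in simp)
    finally show ?thesis .
  qed
  from H2_sumI[OF this h2_norm_nonneg] show "bshift x \<in> H2" "h2_norm (bshift x) \<le> h2_norm x" by auto
qed

lemma H2_row0: "x \<in> H2 \<Longrightarrow> row0 x \<in> H2"
  using H2_mono(1)[of x "row0 x"] by (auto simp: row0_def)

lemma shift_bshift: "shift (1, 0) (bshift x) = (\<lambda>k. x k - row0 x k)"
  by (auto simp: shift_def bshift_def row0_def fun_eq_iff)

lemma h2_inner_bshift: "h2_inner (bshift x) y = h2_inner x (shift (1, 0) y)"
proof -
  have "h2_inner (bshift x) y = h2_inner (shift (1, 0) (bshift x)) (shift (1, 0) y)"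
    by (rule h2_inner_shift[symmetric])
  also have "\<dots> = h2_inner x (shift (1, 0) y)"
    unfolding h2_inner_def shift_bshift by (intro infsum_cong) (auto simp: row0_def shift_def)
  finally show ?thesis .
qed

text \<open>For series with finitely many rows, evaluation at (\<alpha>, \<beta>) is bounded however
  large \<alpha> is: \<open>\<psi>\<close> combines the Szego kernel in z2 with finitely many powers
  in z1.\<close>

lemma h2_inner_finite_rows:
  assumes \<beta>: "cmod \<beta> < 1"
  obtains \<psi> where "\<psi> \<in> H2"
    "\<And>x. x \<in> H2 \<Longrightarrow> (\<And>i j. i > M \<Longrightarrow> x (i, j) = 0) \<Longrightarrow> ((\<lambda>k. x k * zpow (\<alpha>, \<beta>) k) has_sum h2_inner x \<psi>) UNIV"
proof -
  define e where "e = (\<lambda>k :: nat \<times> nat. if fst k = 0 then cnj \<beta> ^ snd k else 0)"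
  have "zpow (1/2, cnj \<beta>) \<in> H2" using \<beta> by (intro zpow_H2) (simp add: bidisk_def)
  then have e: "e \<in> H2" by (rule H2_mono(1)) (auto simp: e_def zpow_def)
  define \<psi> where "\<psi> = (\<lambda>k. \<Sum>i\<le>M. cnj \<alpha> ^ i * shift (i, 0) e k)"
  have \<psi>: "\<psi> \<in> H2" unfolding \<psi>_def by (intro H2_sum H2_cmult(1) H2_shift(1) e) auto
  have val: "\<psi> k = cnj (zpow (\<alpha>, \<beta>) k)" if "fst k \<le> M" for k
  proof -
    have "\<psi> k = (\<Sum>i\<in>{fst k}. cnj \<alpha> ^ i * shift (i, 0) e k)"
      unfolding \<psi>_def using that by (intro sum.mono_neutral_right) (auto simp: shift_def e_def)
    then show ?thesis by (simp add: shift_def e_def zpow_def)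
  qed
  have "((\<lambda>k. x k * zpow (\<alpha>, \<beta>) k) has_sum h2_inner x \<psi>) UNIV"
    if x: "x \<in> H2" "\<And>i j. i > M \<Longrightarrow> x (i, j) = 0" for x
  proof -
    have "(\<lambda>k. x k * cnj (\<psi> k)) = (\<lambda>k. x k * zpow (\<alpha>, \<beta>) k)"
    proof
      fix k show "x k * cnj (\<psi> k) = x k * zpow (\<alpha>, \<beta>) k"
        using val[of k] x(2)[of "fst k" "snd k"] by (cases "fst k \<le> M") auto
    qed
    then show ?thesis using has_sum_infsum[OF h2_inner_summable[OF x(1) \<psi>]] by (simp add: h2_inner_def)
  qed
  then show thesis using that \<psi> by blast
qed

text \<open>Elimination of one coordinate at a time. The generators are normalised so that the
  coefficients in the expansion of \<open>f\<close> are values of \<open>f\<close> itself, which the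
  norm controls later.\<close>

lemma finite_determined_basis:
  fixes R :: "('k \<Rightarrow> complex) set"
  assumes "finite I" "(\<lambda>k. 0) \<in> R" "\<And>f g c. f \<in> R \<Longrightarrow> g \<in> R \<Longrightarrow> (\<lambda>k. f k + c * g k) \<in> R"
    and "\<And>f. f \<in> R \<Longrightarrow> (\<And>i. i \<in> I \<Longrightarrow> f i = 0) \<Longrightarrow> f = (\<lambda>k. 0)"
  shows "\<exists>b. (\<forall>i. b i \<in> R) \<and> (\<forall>f\<in>R. \<forall>k. f k = (\<Sum>i\<in>I. f i * b i k))"
  using assms
proof (induction I arbitrary: R rule: finite_induct)
  case empty
  have "f k = 0" if "f \<in> R" for f k using empty.prems(3)[OF that] by simp
  then show ?case using empty.prems(1) by (intro exI[of _ "\<lambda>_ _. 0"]) simp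
next
  case (insert a I)
  define R' where "R' = {f \<in> R. f a = 0}"
  have "\<exists>b. (\<forall>i. b i \<in> R') \<and> (\<forall>f\<in>R'. \<forall>k. f k = (\<Sum>i\<in>I. f i * b i k))"
  proof (rule insert.IH)
    show "f = (\<lambda>k. 0)" if "f \<in> R'" "\<And>i. i \<in> I \<Longrightarrow> f i = 0" for f
      using insert.prems(3)[of f] that by (auto simp: R'_def)
    show "(\<lambda>k. 0) \<in> R'" using insert.prems(1) by (simp add: R'_def)
    show "(\<lambda>k. f k + c * g k) \<in> R'" if "f \<in> R'" "g \<in> R'" for f g c
      using insert.prems(2)[of f g c] that by (simp add: R'_def)
  qed
  then obtain b where b: "\<And>i. b i \<in> R'" "\<And>f k. f \<in> R' \<Longrightarrow> f k = (\<Sum>i\<in>I. f i * b i k)" by blast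
  note R_lin = insert.prems(2)
  have lin: "(\<lambda>k. f k + (\<Sum>i\<in>J. c i * b i k)) \<in> R" if "finite J" "f \<in> R" for J f c
    using that(1)
  proof (induction J rule: finite_induct)
    case (insert i J)
    have "b i \<in> R" using b(1)[of i] by (simp add: R'_def)
    from R_lin[OF insert.IH this] have "(\<lambda>k. (f k + (\<Sum>i\<in>J. c i * b i k)) + c i * b i k) \<in> R" .
    then show ?case using insert.hyps by (simp add: add_ac)
  qed (use that in simp)
  show ?case
  proof (cases "\<exists>e\<in>R. e a \<noteq> 0")
    case False
    then have "R' = R" by (auto simp: R'_def)
    define b' where "b' = b(a := (\<lambda>k. 0))"
    have "f k = (\<Sum>i\<in>insert a I. f i * b' i k)" if "f \<in> R" for f k
    proof -
      have "(\<Sum>i\<in>insert a I. f i * b' i k) = (\<Sum>i\<in>I. f i * b i k)"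
        using insert.hyps by (auto simp: b'_def intro!: sum.cong)
      then show ?thesis using b(2)[of f k] that \<open>R' = R\<close> by simp
    qed
    moreover have "b' i \<in> R" for i using b(1) insert.prems(1) by (auto simp: b'_def R'_def)
    ultimately show ?thesis by blast
  next
    case True
    then obtain e0 where e0: "e0 \<in> R" "e0 a \<noteq> 0" by blast
    define e where "e = (\<lambda>k. 0 + (1 / e0 a) * e0 k)"
    have e: "e \<in> R" unfolding e_def by (rule R_lin[OF insert.prems(1) e0(1)])
    have ea: "e a = 1" using e0 by (simp add: e_def)
    \<comment> \<open>Expanding f - f(a) e in the \<open>b i\<close> and collecting the terms with
      f(a) gives the generator that belongs to \<open>a\<close>.\<close>
    define b' where "b' = b(a := (\<lambda>k. e k + (\<Sum>i\<in>I. (- e i) * b i k)))"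
    have "f k = (\<Sum>i\<in>insert a I. f i * b' i k)" if f: "f \<in> R" for f k
    proof -
      have "(\<lambda>k. f k + (- f a) * e k) \<in> R'"
        using R_lin[OF f e, of "- f a"] ea by (simp add: R'_def)
      from b(2)[OF this, of k]
      have "f k = f a * e k + (\<Sum>i\<in>I. (f i + (- f a) * e i) * b i k)" by (simp add: algebra_simps)
      also have "\<dots> = f a * b' a k + (\<Sum>i\<in>I. f i * b i k)"
        by (simp add: b'_def algebra_simps sum.distrib sum_subtractf sum_distrib_left sum_negf)
      also have "(\<Sum>i\<in>I. f i * b i k) = (\<Sum>i\<in>I. f i * b' i k)"
        using insert.hyps by (intro sum.cong) (auto simp: b'_def)
      finally show ?thesis using insert.hyps by simp
    qed
    moreover have "b' i \<in> R" for i
      using b(1) lin[OF insert.hyps(1) e, of "\<lambda>i. - e i"] by (auto simp: b'_def R'_def)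
    ultimately show ?thesis by blast
  qed
qed

section \<open>The space \<open>W\<close> and numerical range bounds on it\<close>

context stable_bipoly
begin

text \<open>\<open>W\<close> is the largest subspace of the model space that is invariant under \<open>z\<^sub>2\<close>.\<close>

definition W where "W = {h \<in> H2. \<forall>i j. m \<le> i \<longrightarrow> conv p h (i, j) = 0}"

lemma W_H2: "h \<in> W \<Longrightarrow> h \<in> H2" by (simp add: W_def)

lemma h2_norm_tendsto_coeff:
  assumes "\<And>N. X N \<in> H2" "f \<in> H2" "(\<lambda>N. h2_norm (\<lambda>i. X N i - f i)) \<longlonglongrightarrow> 0"
  shows "(\<lambda>N. X N k) \<longlonglongrightarrow> f k"
proof (rule LIM_zero_cancel, rule tendsto_norm_zero_cancel, rule tendsto_sandwich[OF _ _ tendsto_const assms(3)])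
  show "\<forall>\<^sub>F N in sequentially. norm (X N k - f k) \<le> h2_norm (\<lambda>i. X N i - f i)"
    using cmod_le_h2_norm[OF H2_diff(1)[OF assms(1,2)]] by simp
qed simp

lemma W_closed: "h2_closed_subspace W"
  unfolding h2_closed_subspace_def
proof (intro conjI ballI allI impI)
  show "W \<subseteq> H2" "(\<lambda>k. 0) \<in> W" by (auto simp: W_def)
  show "(\<lambda>k. f k + g k) \<in> W" if "f \<in> W" "g \<in> W" for f g
    using that by (auto simp: W_def H2_add conv_add_right)
  show "(\<lambda>k. a * f k) \<in> W" if "f \<in> W" for f a
    using that by (auto simp: W_def H2_cmult conv_cmult_right)
  fix X f assume X: "(\<forall>k. X k \<in> W) \<and> f \<in> H2 \<and> (\<lambda>k. h2_norm (\<lambda>i. X k i - f i)) \<longlonglongrightarrow> 0"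
  then have lim: "(\<lambda>N. conv p (X N) k) \<longlonglongrightarrow> conv p f k" for k
    by (intro conv_tendsto tendsto_const h2_norm_tendsto_coeff) (use X W_H2 in auto)
  have "conv p f (i, j) = 0" if "m \<le> i" for i j
    using lim[of "(i, j)"] X that by (simp add: W_def LIMSEQ_const_iff)
  then show "f \<in> W" using X by (simp add: W_def)
qed

lemma W_shift: "h \<in> W \<Longrightarrow> shift (0, N) h \<in> W"
  unfolding W_def by (auto simp: H2_shift conv_shift_right) (auto simp: shift_def)

lemma W_model_space: "h \<in> W \<Longrightarrow> h \<in> model_space (rif m n p)"
  by (rule model_spaceI) (auto simp: W_def)

lemma conv_p_row0:
  assumes "i > m" shows "conv p (row0 x) (i, j) = 0"
  unfolding conv_bipoly[OF p_bipoly]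
proof (intro sum.neutral ballI)
  fix l assume "l \<in> {l. p l \<noteq> 0}"
  then have "p (fst l, snd l) \<noteq> 0" by simp
  then have "fst l < i" using deg assms unfolding bipoly_deg_le_def by (meson le_less_trans)
  then show "p l * shift l (row0 x) (i, j) = 0" by (simp add: shift_def row0_def)
qed

lemma shift_conv_bshift: "shift (1, 0) (conv p (bshift x)) = (\<lambda>k. conv p x k - conv p (row0 x) k)"
  unfolding conv_shift_right[symmetric] shift_bshift conv_diff_right ..

text \<open>Removing row 0 keeps the z1-degree of p x at most \<open>m\<close>, and division by z1
  lowers it by one. Row \<open>m\<close> is allowed here, unlike in \<open>W\<close>, so that the
  lemma applies to \<Theta>, where p \<Theta> = p~.\<close>

lemma bshift_W:
  assumes "x \<in> H2" "\<And>i j. i > m \<Longrightarrow> conv p x (i, j) = 0"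
  shows "bshift x \<in> W"
proof -
  have "conv p (bshift x) (i, j) = 0" if "m \<le> i" for i j
  proof -
    have "conv p (bshift x) (i, j) = shift (1, 0) (conv p (bshift x)) (Suc i, j)" by (simp add: shift_def)
    also have "\<dots> = 0" unfolding shift_conv_bshift using assms(2)[of "Suc i" j] conv_p_row0[of "Suc i" x j] that by simp
    finally show ?thesis .
  qed
  then show ?thesis using H2_bshift(1)[OF assms(1)] by (simp add: W_def)
qed

lemma W_bshift: "h \<in> W \<Longrightarrow> bshift h \<in> W"
  by (rule bshift_W) (auto simp: W_def)

text \<open>Evaluation of \<open>p h\<close> at a zero of \<open>p\<close> is an eigenfunctional of the backward shift.\<close>

lemma zero_imp_reflect_zero:
  assumes w: "\<And>h. h \<in> W \<Longrightarrow> cmod (h2_inner (shift (1, 0) h) h) \<le> w * (h2_norm h)\<^sup>2"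
    and \<beta>: "cmod \<beta> < 1" and \<alpha>: "w * cmod \<alpha> < 1" and zero: "bipoly_eval p (\<alpha>, \<beta>) = 0"
  shows "bipoly_eval pt (\<alpha>, \<beta>) = 0"
proof -
  obtain \<psi> where \<psi>: "\<psi> \<in> H2" "\<And>x. x \<in> H2 \<Longrightarrow> (\<And>i j. i > m \<Longrightarrow> x (i, j) = 0) \<Longrightarrow>
      ((\<lambda>k. x k * zpow (\<alpha>, \<beta>) k) has_sum h2_inner x \<psi>) UNIV"
    using h2_inner_finite_rows[OF \<beta>, of m \<alpha>] by blast
  \<comment> \<open>The value of p h at (\<alpha>, \<beta>) when p h has z1-degree at most
    \<open>m\<close>; through \<open>\<psi>\<close> it is a bounded functional although the point
    lies outside the bidisk.\<close>
  define L where "L = (\<lambda>h. h2_inner (conv p h) \<psi>)"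
  have \<alpha>0: "\<alpha> \<noteq> 0" using zero nz \<beta> by (auto simp: bidisk_def)
  note cH = conv_bipoly_H2(1)[OF p_bipoly]
  have L_bshift: "\<alpha> * L (bshift x) = L x" if x: "x \<in> H2" "\<And>i j. i > m \<Longrightarrow> conv p x (i, j) = 0" for x
  proof -
    have 1: "((\<lambda>k. conv p (bshift x) k * zpow (\<alpha>, \<beta>) k) has_sum L (bshift x)) UNIV"
      unfolding L_def using bshift_W[OF x] by (intro \<psi>(2) cH) (auto simp: W_def)
    have 2: "((\<lambda>k. conv p x k * zpow (\<alpha>, \<beta>) k) has_sum L x) UNIV"
      unfolding L_def by (intro \<psi>(2) cH x)
    have "((\<lambda>k. row0 x k * zpow (\<alpha>, \<beta>) k) has_sum h2_inner (row0 x) \<psi>) UNIV"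
      by (rule \<psi>(2)[OF H2_row0[OF x(1)]]) (auto simp: row0_def)
    \<comment> \<open>The row-0 term contributes nothing because p(\<alpha>, \<beta>) = 0; this
      makes \<open>L\<close> an eigenfunctional.\<close>
    from conv_has_sum[OF p_bipoly this]
    have 3: "((\<lambda>k. conv p (row0 x) k * zpow (\<alpha>, \<beta>) k) has_sum 0) UNIV" by (simp add: zero)
    have "((\<lambda>k. conv p x k * zpow (\<alpha>, \<beta>) k + - (conv p (row0 x) k * zpow (\<alpha>, \<beta>) k)) has_sum (L x + - 0)) UNIV"
      by (rule has_sum_add[OF 2 has_sum_uminusI[OF 3]])
    moreover have "((\<lambda>k. shift (1, 0) (conv p (bshift x)) k * zpow (\<alpha>, \<beta>) k) has_sum (zpow (\<alpha>, \<beta>) (1, 0) * L (bshift x))) UNIV"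
      by (rule shift_has_sum[OF 1])
    ultimately show ?thesis
      unfolding shift_conv_bshift by (intro has_sum_unique) (auto simp: zpow_def left_diff_distrib)
  qed
  have L_diff: "L (\<lambda>k. f k - a * g k) = L f - a * L g" if "f \<in> H2" "g \<in> H2" for f g a
    unfolding L_def conv_diff_right conv_cmult_right
    using that by (simp add: h2_inner_diff_left h2_inner_cmult_left cH \<psi> H2_cmult)
  define K where "K = {h \<in> W. L h = 0}"
  note WD = h2_closed_subspaceD[OF W_closed]
  have L_zero: "L (\<lambda>k. 0) = 0" by (simp add: L_def)
  have K_closed: "h2_closed_subspace K"
    unfolding h2_closed_subspace_def
  proof (intro conjI ballI allI impI)
    show "K \<subseteq> H2" "(\<lambda>k. 0) \<in> K" using L_zero WD(2) by (auto simp: K_def W_def)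
    show "(\<lambda>k. f k + g k) \<in> K" if "f \<in> K" "g \<in> K" for f g
      using that L_diff[of f g "-1"] WD(3)[of f g] by (simp add: K_def W_H2)
    show "(\<lambda>k. a * f k) \<in> K" if "f \<in> K" for f a
      using that L_diff[of "\<lambda>k. 0" f "-a"] WD(4)[of f a] by (simp add: K_def W_H2 L_zero)
    fix X f assume X: "(\<forall>k. X k \<in> K) \<and> f \<in> H2 \<and> (\<lambda>k. h2_norm (\<lambda>i. X k i - f i)) \<longlonglongrightarrow> 0"
    then have fW: "f \<in> W" using WD(6)[of X f] by (auto simp: K_def)
    define C where "C = (\<Sum>\<^sub>\<infinity>k. cmod (p k)) * h2_norm \<psi>"
    have "cmod (L f) \<le> C * h2_norm (\<lambda>i. X N i - f i)" for N
    proof -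
      have XN: "X N \<in> H2" "L (X N) = 0" using X by (auto simp: K_def W_H2)
      have d: "(\<lambda>i. X N i - f i) \<in> H2" using XN X by (intro H2_diff(1)) auto
      have "cmod (L f) = cmod (L (\<lambda>i. X N i - f i))"
        using L_diff[of "X N" f 1] XN X by simp
      also have "\<dots> \<le> h2_norm (conv p (\<lambda>i. X N i - f i)) * h2_norm \<psi>"
        unfolding L_def by (rule h2_Cauchy_Schwarz[OF cH[OF d] \<psi>(1)])
      also have "\<dots> \<le> ((\<Sum>\<^sub>\<infinity>k. cmod (p k)) * h2_norm (\<lambda>i. X N i - f i)) * h2_norm \<psi>"
        by (intro mult_right_mono conv_bipoly_H2(2)[OF p_bipoly d]) simp
      finally show ?thesis by (simp add: C_def mult_ac)
    qed
    moreover have "(\<lambda>N. C * h2_norm (\<lambda>i. X N i - f i)) \<longlonglongrightarrow> C * 0"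
      using X by (intro tendsto_intros) auto
    ultimately have "cmod (L f) \<le> 0" using LIMSEQ_le_const[of _ "C * 0" "cmod (L f)"] by simp
    then show "f \<in> K" using fW by (simp add: K_def)
  qed
  note KD = h2_closed_subspaceD[OF K_closed]
  have L0: "L h = 0" if h: "h \<in> W" for h
  proof (rule ccontr)
    assume Lh: "L h \<noteq> 0"
    obtain g where g: "g \<in> K" "\<forall>u\<in>K. h2_inner (\<lambda>k. h k - g k) u = 0"
      using h2_projection_exists[OF K_closed W_H2[OF h]] by blast
    \<comment> \<open>\<open>v\<close> is orthogonal to the kernel \<open>K\<close> of
      \<open>L\<close> in \<open>W\<close>. Modulo \<open>K\<close> the backward shift acts on
      \<open>v\<close> as 1/\<alpha>, which fixes the inner product of \<open>v\<close> with
      \<open>bshift v\<close>.\<close>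
    define v where "v = (\<lambda>k. h k - g k)"
    have gW: "g \<in> W" "L g = 0" using g by (auto simp: K_def)
    have v: "v \<in> W" unfolding v_def by (rule WD(5)[OF h gW(1)])
    have vH: "v \<in> H2" using v by (rule W_H2)
    have Lv: "L v = L h" using L_diff[of h g 1] gW h W_H2 by (simp add: v_def)
    have vne: "h2_norm v \<noteq> 0"
    proof
      assume "h2_norm v = 0"
      then have "v = (\<lambda>k. 0)" using h2_norm_eq_0[OF vH] by auto
      then show False using Lv Lh L_zero by simp
    qed
    have Bv: "bshift v \<in> W" "\<alpha> * L (bshift v) = L v"
      using W_bshift[OF v] L_bshift[OF vH] v by (auto simp: W_def)
    have "(\<lambda>k. bshift v k - (1 / \<alpha>) * v k) \<in> K"
      using WD(5)[OF Bv(1) WD(4)[OF v, of "1 / \<alpha>"]] L_diff[OF W_H2[OF Bv(1)] vH, of "1 / \<alpha>"] Bv(2) \<alpha>0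
      by (simp add: K_def field_simps)
    then have "h2_inner v (\<lambda>k. bshift v k - (1 / \<alpha>) * v k) = 0" using g(2) by (simp add: v_def)
    then have "h2_inner v (bshift v) - h2_inner v (\<lambda>k. (1 / \<alpha>) * v k) = 0"
      using h2_inner_diff_right[OF W_H2[OF Bv(1)] H2_cmult(1)[OF vH, of "1 / \<alpha>"] vH] by (simp only:)
    then have "h2_inner v (bshift v) = cnj (1 / \<alpha>) * h2_inner v v"
      unfolding h2_inner_cmult_right by simp
    then have "cmod (h2_inner v (bshift v)) = (h2_norm v)\<^sup>2 / cmod \<alpha>"
      using h2_inner_self[OF vH] by (simp add: norm_mult norm_divide norm_power)
    moreover have "h2_inner v (bshift v) = h2_inner (shift (1, 0) v) v"
      using h2_inner_bshift[of v v] h2_inner_commute[of v "bshift v"] h2_inner_commute[of v "shift (1,0) v"] by simp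
    ultimately have "(h2_norm v)\<^sup>2 / cmod \<alpha> \<le> w * (h2_norm v)\<^sup>2" using w[OF v] by simp
    then have "(h2_norm v)\<^sup>2 \<le> (w * cmod \<alpha>) * (h2_norm v)\<^sup>2"
      using \<alpha>0 by (simp add: field_simps)
    moreover have "(w * cmod \<alpha>) * (h2_norm v)\<^sup>2 < 1 * (h2_norm v)\<^sup>2"
      using \<alpha> vne by (intro mult_strict_right_mono) auto
    ultimately show False by simp
  qed
  \<comment> \<open>Taylor coefficients of \<Theta>, which need not lie in \<open>W\<close>; but the
    backward shift does, so \<open>L_bshift\<close> gives \<open>L \<theta> = 0\<close>, and
    \<open>L \<theta>\<close> is p~(\<alpha>, \<beta>).\<close>
  define \<theta> where "\<theta> = conv pt pinv"
  have p\<theta>: "conv p \<theta> = pt"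
    unfolding \<theta>_def by (metis conv_commute conv_left_commute conv_pinv conv_unit_left)
  have rows: "conv p \<theta> (i, j) = 0" if "i > m" for i j using that unfolding p\<theta> by (simp add: reflect_def)
  have th: "\<theta> \<in> H2" using theta_H2 by (simp add: \<theta>_def)
  have "L \<theta> = 0" using L_bshift[OF th rows] L0[OF bshift_W[OF th rows]] by simp
  moreover have "((\<lambda>k. pt k * zpow (\<alpha>, \<beta>) k) has_sum L \<theta>) UNIV"
    unfolding L_def p\<theta> by (rule \<psi>(2)[OF H2_bipoly[OF pt_bipoly]]) (simp add: reflect_def)
  ultimately show ?thesis using has_sum_unique[OF bipoly_has_sum[OF pt_bipoly]] by metis
qed

text \<open>If z1 h is close to l h with |l| = 1, then (1 - l B) p h is small, B being the backward
  shift. Inverting 1 - l B on \<open>m\<close> rows costs a factor \<open>m\<close>, and dividing by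
  \<open>p\<close> a factor 1/\<delta>.\<close>

lemma numerical_radius_gap:
  assumes \<delta>: "\<delta> > 0" "\<And>z. z \<in> torus2 \<Longrightarrow> \<delta> \<le> cmod (bipoly_eval p z)"
  obtains \<eta> where "\<eta> < 1" "\<eta> \<ge> 0" "\<And>h. h \<in> W \<Longrightarrow> h2_norm h = 1 \<Longrightarrow> cmod (h2_inner (shift (1, 0) h) h) \<le> \<eta>"
proof -
  define A where "A = (\<Sum>\<^sub>\<infinity>k. cmod (p k))"
  have A: "A \<ge> 0" unfolding A_def by (rule infsum_nonneg) simp
  \<comment> \<open>On \<open>M\<close> rows the backward shift is nilpotent, so 1 - l B is inverted
    by a Neumann sum of \<open>M\<close> terms of norm at most 1.\<close>
  have lower: "h2_norm q \<le> real M * h2_norm (\<lambda>k. q k - l * bshift q k)"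
    if "q \<in> H2" "cmod l = 1" "\<And>i j. i \<ge> M \<Longrightarrow> q (i, j) = 0" for q l M
    using that
  proof (induction M arbitrary: q)
    case 0
    then have "q = (\<lambda>k. 0)" by auto
    then show ?case by simp
  next
    case (Suc M)
    define d where "d = (\<lambda>k. q k - l * bshift q k)"
    have Bq: "bshift q \<in> H2" by (rule H2_bshift(1)[OF Suc.prems(1)])
    have d: "d \<in> H2" unfolding d_def by (intro H2_diff(1) H2_cmult(1) Bq Suc.prems(1))
    have "h2_norm (bshift q) \<le> real M * h2_norm (\<lambda>k. bshift q k - l * bshift (bshift q) k)"
      using Suc.prems by (intro Suc.IH Bq) (auto simp: bshift_def)
    also have "(\<lambda>k. bshift q k - l * bshift (bshift q) k) = bshift d" by (auto simp: d_def bshift_def)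
    also have "real M * h2_norm (bshift d) \<le> real M * h2_norm d"
      by (intro mult_left_mono H2_bshift(2) d) auto
    finally have 1: "h2_norm (bshift q) \<le> real M * h2_norm d" .
    have "h2_norm q = h2_norm (\<lambda>k. d k + l * bshift q k)" by (simp add: d_def)
    also have "\<dots> \<le> h2_norm d + h2_norm (\<lambda>k. l * bshift q k)"
      by (intro H2_add(2) d H2_cmult(1) Bq)
    also have "h2_norm (\<lambda>k. l * bshift q k) = h2_norm (bshift q)"
      using H2_cmult(2)[OF Bq] Suc.prems(2) by simp
    finally show ?case using 1 by (simp add: d_def[symmetric] distrib_right)
  qed
  \<comment> \<open>If \<rho> is the lower bound for the norm of \<open>e\<close>, then
    \<open>e_norm\<close> gives |t| <= 1 - \<rho>^2 / 2. The summand \<delta> keeps the denominator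
    positive and makes \<rho> at most 1.\<close>
  define c where "c = (\<delta> / (real m * A + \<delta>))\<^sup>2 / 2"
  have pos: "real m * A + \<delta> > 0" using A \<delta> by (simp add: add_nonneg_pos)
  define r where "r = \<delta> / (real m * A + \<delta>)"
  have r: "0 < r" "r \<le> 1" using \<delta> pos A by (auto simp: r_def divide_le_eq)
  have c: "c > 0" "c \<le> 1"
    using r power_le_one[of r 2] by (auto simp: c_def simp flip: r_def)
  have "cmod (h2_inner (shift (1, 0) h) h) \<le> 1 - c" if h: "h \<in> W" "h2_norm h = 1" for h
  proof -
    define t where "t = h2_inner (shift (1, 0) h) h"
    \<comment> \<open>The phase of \<open>t\<close>, which makes the inner product of z1 h with l h
      equal to |t|; for \<open>t = 0\<close> any unimodular value serves.\<close>
    define l where "l = (if t = 0 then 1 else t / of_real (cmod t))"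
    have l: "cmod l = 1" "cnj l * t = of_real (cmod t)"
    proof -
      show "cmod l = 1" by (simp add: l_def norm_divide)
      have "cnj t * t = of_real (cmod t) * of_real (cmod t)"
        using complex_norm_square[of t] by (simp add: power2_eq_square mult.commute)
      then show "cnj l * t = of_real (cmod t)" by (auto simp: l_def)
    qed
    have hH: "h \<in> H2" using h(1) by (rule W_H2)
    note zH = H2_shift[OF hH, of "(1, 0)"]
    define e where "e = (\<lambda>k. shift (1, 0) h k - l * h k)"
    have e: "e \<in> H2" unfolding e_def by (intro H2_diff(1) zH H2_cmult(1) hH)
    have "h2_inner (shift (1, 0) h) (\<lambda>k. l * h k) = of_real (cmod t)"
      unfolding h2_inner_cmult_right t_def[symmetric] by (rule l(2))
    then have e_norm: "(h2_norm e)\<^sup>2 = 2 - 2 * cmod t"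
      unfolding e_def h2_norm_sq_diff[OF zH(1) H2_cmult(1)[OF hH, of l]]
      using H2_cmult(2)[OF hH, of l] zH(2) h(2) l(1) by (simp only: Re_complex_of_real) simp
    define q where "q = conv p h"
    have q: "q \<in> H2" unfolding q_def by (rule conv_bipoly_H2(1)[OF p_bipoly hH])
    \<comment> \<open>The backward shift undoes the multiplication by z1 in p e = z1 q - l
      q.\<close>
    have "(\<lambda>k. q k - l * bshift q k) = bshift (conv p e)"
      unfolding e_def conv_diff_right conv_cmult_right conv_shift_right q_def[symmetric]
      by (simp add: bshift_def shift_def fun_eq_iff)
    then have "h2_norm q \<le> real m * h2_norm (bshift (conv p e))"
      using lower[OF q l(1), of m] h(1) by (simp add: W_def q_def)
    also have "\<dots> \<le> real m * (A * h2_norm e)"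
      using H2_bshift(2)[OF conv_bipoly_H2(1)[OF p_bipoly e]] conv_bipoly_H2(2)[OF p_bipoly e]
      by (intro mult_left_mono) (auto simp: A_def)
    finally have q_le: "h2_norm q \<le> (real m * A) * h2_norm e" by simp
    \<comment> \<open>On the torus the constant multiplier 1 is dominated by |p| / \<delta>.\<close>
    have "h2_norm (conv conv_unit h) \<le> (1 / \<delta>) * h2_norm (conv p h)"
      using \<delta> by (intro conv_norm_mono conv_unit_bipoly p_bipoly hH) (auto simp: conv_unit_eval field_simps)
    then have "\<delta> \<le> h2_norm q" using \<delta> h(2) by (simp add: q_def field_simps)
    also have "\<dots> \<le> (real m * A + \<delta>) * h2_norm e"
      using q_le \<delta> h2_norm_nonneg[of e] by (simp add: distrib_right add_increasing2)
    finally have "\<delta> / (real m * A + \<delta>) \<le> h2_norm e" using pos by (simp add: divide_le_eq mult.commute)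
    then have "(\<delta> / (real m * A + \<delta>))\<^sup>2 \<le> (h2_norm e)\<^sup>2"
      using \<delta> pos by (intro power_mono) auto
    then show ?thesis using e_norm by (simp add: c_def t_def)
  qed
  then show thesis using that[of "1 - c"] c by auto
qed

end

section \<open>Transfer of the numerical bound from \<open>S2\<close> to \<open>W\<close>\<close>

locale agler_decomposition = stable_bipoly +
  fixes S1 S2 :: "(nat \<times> nat \<Rightarrow> complex) set"
  assumes S1_closed: "h2_closed_subspace S1"
    and S2_closed: "h2_closed_subspace S2"
    and orth: "\<forall>f\<in>S1. \<forall>g\<in>S2. h2_inner f g = 0"
    and decomp: "model_space (rif m n p) = {(\<lambda>k. f k + g k) | f g. f \<in> S1 \<and> g \<in> S2}"
    and S1_inv: "Mz1 ` S1 \<subseteq> S1"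
    and S2_inv: "Mz2 ` S2 \<subseteq> S2"
begin

lemmas S1D = h2_closed_subspaceD[OF S1_closed]
lemmas S2D = h2_closed_subspaceD[OF S2_closed]

lemma S1_model: "f \<in> S1 \<Longrightarrow> f \<in> model_space (rif m n p)"
  unfolding decomp using S2D(2) by force

lemma S2_model: "g \<in> S2 \<Longrightarrow> g \<in> model_space (rif m n p)"
  unfolding decomp using S1D(2) by force

lemma S1_shift: "f \<in> S1 \<Longrightarrow> shift (N, 0) f \<in> S1"
proof (induction N)
  case (Suc N)
  then have "Mz1 (shift (N, 0) f) \<in> S1" using S1_inv by blast
  then show ?case by (simp add: Mz1_shift shift_shift)
qed (simp add: shift_zero)

lemma S2_shift: "g \<in> S2 \<Longrightarrow> shift (0, N) g \<in> S2"
proof (induction N)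
  case (Suc N)
  then have "Mz2 (shift (0, N) g) \<in> S2" using S2_inv by blast
  then show ?case by (simp add: Mz2_shift shift_shift)
qed (simp add: shift_zero)

text \<open>Multiplication by z1^m stays in \<open>S1\<close> and moves every row to an index of at
  least \<open>m\<close>, where the model space condition applies; \<open>S2_W\<close> is the mirror
  image.\<close>

lemma S1_conv:
  assumes "f \<in> S1" "n \<le> j" shows "conv p f (i, j) = 0"
proof -
  have "conv p f (i, j) = conv p (shift (m, 0) f) (m + i, j)"
    unfolding conv_shift_right by (simp add: shift_def)
  also have "\<dots> = 0" by (rule model_space_imp[OF S1_model[OF S1_shift[OF assms(1)]]]) (use assms in auto)
  finally show ?thesis .
qed

lemma S2_W: "g \<in> S2 \<Longrightarrow> g \<in> W"
  unfolding W_def using S2D(1)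
proof (intro CollectI conjI allI impI)
  fix i j assume g: "g \<in> S2" and i: "m \<le> i"
  have "conv p g (i, j) = conv p (shift (0, n) g) (i, n + j)"
    unfolding conv_shift_right by (simp add: shift_def)
  also have "\<dots> = 0" by (rule model_space_imp[OF S2_model[OF S2_shift[OF g]]]) (use i in auto)
  finally show "conv p g (i, j) = 0" .
qed auto

text \<open>The form <z1 h, h> does not change when \<open>h\<close> is multiplied by z2^N, and z2^N
  h tends weakly to 0. Its \<open>S1\<close>-component lies in a space of finite dimension, hence
  tends to 0 in norm, and the bound on \<open>S2\<close> survives.\<close>

lemma W_numerical_bound:
  assumes w: "w \<ge> 0" "\<And>g. g \<in> S2 \<Longrightarrow> cmod (h2_inner (shift (1, 0) g) g) \<le> w * (h2_norm g)\<^sup>2"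
    and h: "h \<in> W"
  shows "cmod (h2_inner (shift (1, 0) h) h) \<le> w * (h2_norm h)\<^sup>2"
proof -
  define R where "R = {f \<in> S1. f \<in> W}"
  note WD = h2_closed_subspaceD[OF W_closed]
  have hH: "h \<in> H2" using W_H2[OF h] .
  \<comment> \<open>For \<open>f\<close> in \<open>R\<close> the product p f is supported in the box
    of size m x n, and its coefficients there involve only those of \<open>f\<close> in the same
    box.\<close>
  have "\<exists>b. (\<forall>i. b i \<in> R) \<and> (\<forall>f\<in>R. \<forall>k. f k = (\<Sum>i\<in>{..<m} \<times> {..<n}. f i * b i k))"
  proof (rule finite_determined_basis)
    show "(\<lambda>k. 0) \<in> R" using S1D(2) WD(2) by (simp add: R_def)
    show "(\<lambda>k. f k + c * g k) \<in> R" if "f \<in> R" "g \<in> R" for f g c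
      using that S1D(3)[OF _ S1D(4)] WD(3)[OF _ WD(4)] by (simp add: R_def)
    fix f assume f: "f \<in> R" "\<And>i. i \<in> {..<m} \<times> {..<n} \<Longrightarrow> f i = 0"
    have "conv p f k = 0" for k
    proof -
      obtain i j where k: "k = (i, j)" by (cases k)
      consider "m \<le> i" | "n \<le> j" | "i < m" "j < n" by linarith
      then show ?thesis
      proof cases
        case 3
        then have "f (i - a, j - b) = 0" for a b using f(2)[of "(i - a, j - b)"] by (simp add: less_imp_diff_less)
        then show ?thesis unfolding k conv_def by simp
      qed (use f k S1_conv in \<open>auto simp: R_def W_def\<close>)
    qed
    then have "conv p f = (\<lambda>k. 0)" by (rule ext)
    then show "f = (\<lambda>k. 0)" by (rule conv_p_cancel)
  qed simp
  then obtain b where b: "\<And>i. b i \<in> R" "\<And>f k. f \<in> R \<Longrightarrow> f k = (\<Sum>i\<in>{..<m} \<times> {..<n}. f i * b i k)" by blast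
  have bH: "b i \<in> H2" for i using b(1) W_H2 by (auto simp: R_def)
  define x where "x = (\<lambda>N. shift (0, N) h)"
  have x: "x N \<in> W" "x N \<in> H2" "h2_norm (x N) = h2_norm h" for N
    unfolding x_def using W_shift[OF h] H2_shift[OF hH] by auto
  have "\<exists>f g. x N = (\<lambda>k. f k + g k) \<and> f \<in> S1 \<and> g \<in> S2" for N
    using W_model_space[OF x(1)[of N]] unfolding decomp by blast
  then obtain f g where fg: "\<And>N. x N = (\<lambda>k. f N k + g N k)" "\<And>N. f N \<in> S1" "\<And>N. g N \<in> S2" by metis
  have fH: "f N \<in> H2" and gH: "g N \<in> H2" for N using fg S1D(1) S2D(1) by auto
  have fR: "f N \<in> R" for N
  proof -
    have "(\<lambda>k. x N k - g N k) = f N" by (simp add: fg(1))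
    then have "f N \<in> W" using WD(5)[OF x(1) S2_W[OF fg(3)], of N N] by simp
    then show ?thesis using fg(2) by (simp add: R_def)
  qed
  \<comment> \<open>The inner product of \<open>x N\<close> with \<open>f N\<close> is the squared
    norm of \<open>f N\<close>. Expanding \<open>f N\<close> in the generators, with coordinates at
    most its norm, lets one factor cancel.\<close>
  define d where "d = (\<lambda>N. \<Sum>i\<in>{..<m} \<times> {..<n}. cmod (h2_inner (x N) (b i)))"
  have og: "h2_inner (f N) (g N) = 0" "h2_inner (g N) (f N) = 0" for N
    using orth fg(2,3) h2_inner_commute[of "g N" "f N"] by auto
  have fd: "h2_norm (f N) \<le> d N" for N
  proof -
    have "h2_inner (x N) (f N) = h2_inner (f N) (f N)"
      unfolding fg(1) using h2_inner_add_left[OF fH gH fH] og by simp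
    moreover have "h2_inner (x N) (f N) = (\<Sum>i\<in>{..<m} \<times> {..<n}. cnj (f N i) * h2_inner (x N) (b i))"
    proof -
      have "f N = (\<lambda>k. \<Sum>i\<in>{..<m} \<times> {..<n}. f N i * b i k)" by (rule ext) (rule b(2)[OF fR])
      then have "h2_inner (x N) (f N) = h2_inner (x N) (\<lambda>k. \<Sum>i\<in>{..<m} \<times> {..<n}. f N i * b i k)"
        by (rule arg_cong)
      also have "\<dots> = (\<Sum>i\<in>{..<m} \<times> {..<n}. cnj (f N i) * h2_inner (x N) (b i))"
        by (rule h2_inner_sum_right[OF _ bH x(2)]) simp
      finally show ?thesis .
    qed
    ultimately have "(h2_norm (f N))\<^sup>2 = cmod (\<Sum>i\<in>{..<m} \<times> {..<n}. cnj (f N i) * h2_inner (x N) (b i))"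
      using h2_inner_self[OF fH[of N]] by (metis norm_of_real abs_of_nonneg zero_le_power2)
    also have "\<dots> \<le> (\<Sum>i\<in>{..<m} \<times> {..<n}. h2_norm (f N) * cmod (h2_inner (x N) (b i)))"
      by (rule sum_norm_le) (simp add: norm_mult mult_right_mono cmod_le_h2_norm[OF fH])
    finally have "h2_norm (f N) * h2_norm (f N) \<le> h2_norm (f N) * d N"
      by (simp add: d_def sum_distrib_left power2_eq_square)
    moreover have "d N \<ge> 0" unfolding d_def by (simp add: sum_nonneg)
    ultimately show ?thesis using h2_norm_nonneg[of "f N"]
      by (metis dual_order.order_iff_strict mult_le_cancel_left_pos)
  qed
  have "(\<lambda>N. x N k) \<longlonglongrightarrow> 0" for k
  proof (rule tendsto_eventually)
    show "\<forall>\<^sub>F N in sequentially. x N k = 0"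
      using eventually_gt_at_top[of "snd k"] by eventually_elim (simp add: x_def shift_def)
  qed
  then have "(\<lambda>N. h2_inner (x N) (b i)) \<longlonglongrightarrow> h2_inner (\<lambda>k. 0) (b i)" for i
    by (intro h2_weak_convergence[where C = "h2_norm h"] bH) (auto simp: x)
  then have "(\<lambda>N. cmod (h2_inner (x N) (b i))) \<longlonglongrightarrow> 0" for i
    using tendsto_norm_zero by fastforce
  then have d0: "d \<longlonglongrightarrow> 0"
    unfolding d_def using tendsto_sum[of "{..<m} \<times> {..<n}" "\<lambda>i N. cmod (h2_inner (x N) (b i))" "\<lambda>_. 0"] by simp
  have "cmod (h2_inner (shift (1, 0) h) h) \<le> w * (h2_norm h)\<^sup>2 + 2 * (d N * h2_norm h)" for N
  proof -
    note sf = H2_shift[OF fH[of N], of "(1, 0)"] and sg = H2_shift[OF gH[of N], of "(1, 0)"]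
    have sx: "shift (1, 0) (x N) = (\<lambda>k. shift (1, 0) (f N) k + shift (1, 0) (g N) k)"
      unfolding fg(1) by (auto simp: shift_def)
    have "h2_inner (shift (1, 0) h) h = h2_inner (shift (1, 0) (x N)) (x N)"
    proof -
      have "shift (1, 0) (x N) = shift (0, N) (shift (1, 0) h)" by (simp add: x_def shift_shift)
      then show ?thesis by (simp add: x_def h2_inner_shift)
    qed
    also have "\<dots> = h2_inner (shift (1, 0) (f N)) (x N) + (h2_inner (shift (1, 0) (g N)) (f N) + h2_inner (shift (1, 0) (g N)) (g N))"
      unfolding sx using h2_inner_add_left[OF sf(1) sg(1) x(2)[of N]] h2_inner_add_right[OF fH[of N] gH[of N] sg(1)] fg(1)[of N] by simp
    finally have eq: "h2_inner (shift (1, 0) h) h = h2_inner (shift (1, 0) (f N)) (x N)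
       + (h2_inner (shift (1, 0) (g N)) (f N) + h2_inner (shift (1, 0) (g N)) (g N))" .
    have "cmod (h2_inner (shift (1, 0) h) h) \<le> cmod (h2_inner (shift (1, 0) (f N)) (x N))
       + (cmod (h2_inner (shift (1, 0) (g N)) (f N)) + cmod (h2_inner (shift (1, 0) (g N)) (g N)))"
      unfolding eq using norm_triangle_ineq[of "h2_inner (shift (1, 0) (f N)) (x N)"
          "h2_inner (shift (1, 0) (g N)) (f N) + h2_inner (shift (1, 0) (g N)) (g N)"]
        norm_triangle_ineq[of "h2_inner (shift (1, 0) (g N)) (f N)" "h2_inner (shift (1, 0) (g N)) (g N)"] by linarith
    moreover have gx: "h2_norm (g N) \<le> h2_norm h"
    proof (rule power2_le_imp_le)
      have "(h2_norm (g N))\<^sup>2 + (h2_norm (f N))\<^sup>2 = (h2_norm (x N))\<^sup>2"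
        using h2_norm_sq_diff[OF fH[of N] H2_cmult(1)[OF gH[of N], of "-1"]] H2_cmult(2)[OF gH[of N], of "-1"]
          h2_inner_cmult_right[of "f N" "-1" "g N"] og(1)[of N] fg(1)[of N] by simp
      then show "(h2_norm (g N))\<^sup>2 \<le> (h2_norm h)\<^sup>2" unfolding x(3)[of N] using zero_le_power2[of "h2_norm (f N)"] by linarith
    qed simp
    moreover have "cmod (h2_inner (shift (1, 0) (f N)) (x N)) \<le> d N * h2_norm h"
    proof -
      have "cmod (h2_inner (shift (1, 0) (f N)) (x N)) \<le> h2_norm (f N) * h2_norm h"
        using h2_Cauchy_Schwarz[OF sf(1) x(2)[of N]] sf(2) x(3) by simp
      also have "\<dots> \<le> d N * h2_norm h" by (intro mult_right_mono fd) simp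
      finally show ?thesis .
    qed
    moreover have "cmod (h2_inner (shift (1, 0) (g N)) (f N)) \<le> d N * h2_norm h"
    proof -
      have "cmod (h2_inner (shift (1, 0) (g N)) (f N)) \<le> h2_norm (g N) * h2_norm (f N)"
        using h2_Cauchy_Schwarz[OF sg(1) fH[of N]] sg(2) by simp
      also have "\<dots> \<le> h2_norm h * d N" by (intro mult_mono gx fd) auto
      finally show ?thesis by (simp add: mult.commute)
    qed
    moreover have "cmod (h2_inner (shift (1, 0) (g N)) (g N)) \<le> w * (h2_norm h)\<^sup>2"
      using w(2)[OF fg(3)[of N]] mult_left_mono[OF power_mono[OF gx h2_norm_nonneg, of 2] w(1)] by linarith
    ultimately show ?thesis by linarith
  qed
  moreover have "(\<lambda>N. w * (h2_norm h)\<^sup>2 + 2 * (d N * h2_norm h)) \<longlonglongrightarrow> w * (h2_norm h)\<^sup>2 + 2 * (0 * h2_norm h)"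
    by (intro tendsto_intros d0)
  ultimately show ?thesis
    using LIMSEQ_le_const[of _ "w * (h2_norm h)\<^sup>2 + 2 * (0 * h2_norm h)"] by simp
qed

end

section \<open>Coprimality and the theorem\<close>

text \<open>The outer variable is z1; the coefficients are polynomials in z2.\<close>

definition ev2 :: "complex poly poly \<Rightarrow> complex \<times> complex \<Rightarrow> complex" where
  "ev2 r z = poly (poly r [:fst z:]) (snd z)"

lemma ev2_mult: "ev2 (r * s) z = ev2 r z * ev2 s z"
  by (simp add: ev2_def)

lemma ev2_add: "ev2 (r + s) z = ev2 r z + ev2 s z"
  by (simp add: ev2_def)

lemma bipoly_of_poly2:
  obtains c where "is_bipoly c" "\<And>z. bipoly_eval c z = ev2 r z"
proof -
  define n where "n = (\<Sum>i\<le>degree r. degree (coeff r i))"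
  define c where "c = (\<lambda>k :: nat \<times> nat. coeff (coeff r (fst k)) (snd k))"
  have dn: "degree (coeff r i) \<le> n" for i
  proof (cases "i \<le> degree r")
    case True
    then show ?thesis unfolding n_def by (intro member_le_sum[where f = "\<lambda>i. degree (coeff r i)"]) auto
  next
    case False
    then show ?thesis by (simp add: coeff_eq_0)
  qed
  have d: "bipoly_deg_le c (degree r) n"
    unfolding bipoly_deg_le_def
  proof (intro allI impI conjI)
    fix i j assume nz: "c (i, j) \<noteq> 0"
    then show "i \<le> degree r" by (auto simp: c_def intro!: le_degree)
    have "j \<le> degree (coeff r i)" using nz by (auto simp: c_def intro!: le_degree)
    then show "j \<le> n" using dn[of i] by linarith
  qed
  have row: "poly (coeff r i) y = (\<Sum>j\<le>n. coeff (coeff r i) j * y ^ j)" for i y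
  proof -
    have "poly (coeff r i) y = (\<Sum>j\<le>degree (coeff r i). coeff (coeff r i) j * y ^ j)" by (rule poly_altdef)
    also have "\<dots> = (\<Sum>j\<le>n. coeff (coeff r i) j * y ^ j)"
      using dn[of i] by (intro sum.mono_neutral_left) (auto simp: coeff_eq_0)
    finally show ?thesis .
  qed
  have "bipoly_eval c z = ev2 r z" for z
    unfolding bipoly_deg_le_eval[OF d] ev2_def
    by (simp add: poly_altdef[of r] poly_sum row c_def sum_distrib_left sum_distrib_right mult_ac poly_const_pow)
  then show thesis using that bipoly_deg_le_bipoly[OF d] by blast
qed

lemma poly2_of_bipoly:
  assumes "bipoly_deg_le p m n" obtains P where "\<And>z. ev2 P z = bipoly_eval p z"
proof
  show "ev2 (\<Sum>i\<le>m. monom (\<Sum>j\<le>n. monom (p (i, j)) j) i) z = bipoly_eval p z" for z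
    unfolding bipoly_deg_le_eval[OF assms] ev2_def
    by (simp add: poly_sum poly_monom poly_const_pow sum_distrib_left sum_distrib_right mult_ac)
qed

text \<open>Over the domain of polynomials in z2 a nonzero polynomial has finitely many roots, while
  here every constant is a root of the difference.\<close>

lemma ev2_const_imp:
  assumes "\<And>z. ev2 r z = c" shows "r = [:[:c:]:]"
proof -
  have "poly (poly r [:x:]) = poly [:c:]" for x
    using assms[of "(x, _)"] by (auto simp: ev2_def)
  then have 1: "poly (r - [:[:c:]:]) [:x:] = 0" for x
    unfolding poly_eq_poly_eq_iff by simp
  have "infinite ((\<lambda>x. [:x:]) ` (UNIV :: complex set))"
    by (subst finite_image_iff) (auto simp: inj_on_def infinite_UNIV_char_0)
  then have "infinite {y. poly (r - [:[:c:]:]) y = 0}"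
    using 1 by (elim contrapos_nn) (auto elim: finite_subset[rotated])
  then have "r - [:[:c:]:] = 0" using poly_roots_finite by blast
  then show ?thesis by simp
qed

text \<open>Carries coprimality over to divisibility in the ring of iterated polynomials, where
  pseudo-division is available.\<close>

lemma bipoly_coprime_poly2:
  assumes "bipoly_coprime p q" "\<And>z. ev2 P z = bipoly_eval p z" "\<And>z. ev2 Q z = bipoly_eval q z"
    and "r dvd P" "r dvd Q"
  obtains c where "r = [:[:c:]:]"
proof -
  obtain s t where st: "P = r * s" "Q = r * t" using assms(4,5) by (auto elim!: dvdE)
  obtain r' where r': "is_bipoly r'" "\<And>z. bipoly_eval r' z = ev2 r z" using bipoly_of_poly2[of r] by blast
  obtain s' where s': "is_bipoly s'" "\<And>z. bipoly_eval s' z = ev2 s z" using bipoly_of_poly2[of s] by blast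
  obtain t' where t': "is_bipoly t'" "\<And>z. bipoly_eval t' z = ev2 t z" using bipoly_of_poly2[of t] by blast
  have "\<exists>c. \<forall>z. bipoly_eval r' z = c"
    using assms(1)[unfolded bipoly_coprime_def, rule_format, of r' s' t'] r' s' t' st
    by (simp add: assms(2,3)[symmetric] ev2_mult)
  then show thesis using that ev2_const_imp[of r] r'(2) by metis
qed

text \<open>An element \<open>D\<close> of least z1-degree in the ideal of \<open>P\<close> and
  \<open>Q\<close> has a primitive part that divides both, so this degree is 0. \<open>R\<close>
  depends on z2 only and acts as a resultant.\<close>

lemma poly2_Bezout:
  fixes P Q :: "complex poly poly"
  assumes "P \<noteq> 0" and cop: "\<And>r. r dvd P \<Longrightarrow> r dvd Q \<Longrightarrow> degree r = 0"
  obtains A B R where "R \<noteq> 0" "A * P + B * Q = [:R:]"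
proof -
  define J where "J = (\<lambda>D. D \<noteq> 0 \<and> (\<exists>A B. D = A * P + B * Q))"
  have "P = 1 * P + 0 * Q" by simp
  then have "J P" unfolding J_def using assms(1) by blast
  then obtain D where D: "J D" "\<And>E. J E \<Longrightarrow> degree D \<le> degree E"
    using ex_has_least_nat[of J P degree] by blast
  obtain A B where AB: "D = A * P + B * Q" and D0: "D \<noteq> 0" using D(1) by (auto simp: J_def)
  have dv: "primitive_part D dvd F" if F: "F = U * P + V * Q" for F U V
  proof -
    define r where "r = pseudo_mod F D"
    obtain a q where aq: "a \<noteq> 0" "smult a F = D * q + r" and r: "r = 0 \<or> degree r < degree D"
      using pseudo_mod[OF D0, of F] by (auto simp: r_def)
    have "r = smult a F - D * q" using aq by simp
    also have "\<dots> = (smult a U - A * q) * P + (smult a V - B * q) * Q"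
      unfolding F AB by (simp add: algebra_simps smult_add_right)
    finally have "r = 0 \<or> J r" unfolding J_def by blast
    then have "r = 0" using D(2)[of r] r by auto
    then have "D dvd smult a F" using aq by simp
    moreover have "primitive_part D dvd D" by (metis content_times_primitive_part dvd_smult dvd_refl)
    ultimately have "primitive_part D dvd smult a F" by (rule dvd_trans[rotated])
    \<comment> \<open>Over the fraction field of the polynomials in z2 the factor \<open>a\<close>
      is a unit; Gauss's lemma brings the divisibility back, the divisor being primitive.\<close>
    then have "fract_poly (primitive_part D) dvd fract_poly (smult a F)" by (rule fract_poly_dvd)
    then have "fract_poly (primitive_part D) dvd fract_poly F" using aq(1) by (simp add: dvd_smult_iff)
    then show ?thesis by (rule fract_poly_dvdD) (use D0 in simp)
  qed
  have "degree (primitive_part D) = 0"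
    using dv[of P 1 0] dv[of Q 0 1] by (intro cop) auto
  then obtain R where R: "D = [:R:]" by (metis degree_primitive_part degree_eq_zeroE)
  then show thesis using that[of R A B] AB D0 by auto
qed

lemma infinite_unit_circle: "infinite {z. cmod z = 1}"
proof
  assume fin: "finite {z. cmod z = 1}"
  define N where "N = Suc (card {z. cmod z = 1})"
  have "{z :: complex. z ^ N = 1} \<subseteq> {z. cmod z = 1}"
  proof
    fix z :: complex assume "z \<in> {z. z ^ N = 1}"
    then have "cmod z ^ N = 1 ^ N" by (simp flip: norm_power)
    then show "z \<in> {z. cmod z = 1}" using power_eq_imp_eq_base[of "cmod z" N 1] by (simp add: N_def)
  qed
  from card_mono[OF fin this] show False using card_roots_unity_eq[of N] by (simp add: N_def)
qed

text \<open>The section at z2 = \<tau> has infinitely many zeros, so each coefficient vanishes at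
  \<tau> and is divisible by z2 - \<tau>.\<close>

lemma linear_factor_dvd:
  assumes "\<And>z. cmod z = 1 \<Longrightarrow> ev2 C (z, \<tau>) = 0"
  shows "[:[:-\<tau>, 1:]:] dvd C"
proof -
  define f where "f = map_poly (\<lambda>q. poly q \<tau>) C"
  have "poly f z = ev2 C (z, \<tau>)" for z
  proof -
    have "degree f \<le> degree C" unfolding f_def by (rule map_poly_degree_leq)
    then have "poly f z = (\<Sum>i\<le>degree C. coeff f i * z ^ i)"
      unfolding poly_altdef by (intro sum.mono_neutral_left) (auto simp: coeff_eq_0)
    then show ?thesis
      by (simp add: f_def coeff_map_poly ev2_def poly_altdef[of C] poly_sum poly_const_pow mult.commute)
  qed
  then have "{z. cmod z = 1} \<subseteq> {z. poly f z = 0}" using assms by auto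
  then have "infinite {z. poly f z = 0}" using infinite_unit_circle finite_subset by blast
  then have "f = 0" using poly_roots_finite by blast
  then have "poly (coeff C i) \<tau> = 0" for i
    using coeff_map_poly[of "\<lambda>q. poly q \<tau>" C i] by (simp add: f_def)
  then show ?thesis by (simp add: const_poly_dvd_iff poly_eq_0_iff_dvd)
qed

lemma compact_torus2: "compact torus2"
proof -
  have "torus2 = sphere 0 1 \<times> sphere 0 1" by (auto simp: torus2_def)
  then show ?thesis using compact_Times[OF compact_sphere compact_sphere] by metis
qed

lemma eventually_dilation_not_root:
  assumes "R \<noteq> 0" "\<tau> \<noteq> 0"
  shows "\<forall>\<^sub>F s in at_left (1::real). poly R (of_real s * \<tau>) \<noteq> (0::complex)"
proof -
  define F where "F = (\<lambda>s. of_real s * \<tau>) -` {x. poly R x = 0}"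
  have F: "finite F" unfolding F_def
    using assms by (intro finite_vimageI poly_roots_finite) (auto simp: inj_on_def)
  have "\<forall>\<^sub>F s in at_left (1::real). \<forall>x\<in>F. s \<noteq> x"
  proof (rule eventually_ball_finite[OF F], rule ballI)
    fix x :: real
    show "\<forall>\<^sub>F s in at_left 1. s \<noteq> x" by (rule eventually_neq_at_within)
  qed
  then show ?thesis by eventually_elim (auto simp: F_def)
qed

section \<open>The numerical radius without and with a singularity\<close>

context agler_decomposition
begin

lemma num_radius_eq:
  "num_radius S2 (\<lambda>h. h2_proj S2 (Mz1 h)) = Sup (insert 0 {cmod (h2_inner (shift (1, 0) h) h) | h. h \<in> S2 \<and> h2_norm h = 1})"
proof -
  have "h2_inner (h2_proj S2 (Mz1 h)) h = h2_inner (shift (1, 0) h) h" if h: "h \<in> S2" for h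
  proof -
    have H: "Mz1 h \<in> H2" "h2_proj S2 (Mz1 h) \<in> H2"
      unfolding Mz1_shift using h2_proj(1)[OF S2_closed, of "shift (1, 0) h"] H2_shift(1)[OF S2D(1)[OF h]] S2D(1) by auto
    have "h2_inner (\<lambda>k. Mz1 h k - h2_proj S2 (Mz1 h) k) h = 0" by (rule h2_proj(2)[OF S2_closed H(1) h])
    then show ?thesis using h2_inner_diff_left[OF H S2D(1)[OF h]] by (simp add: Mz1_shift)
  qed
  then have "{cmod (h2_inner (h2_proj S2 (Mz1 h)) h) | h. h \<in> S2 \<and> h2_norm h = 1}
    = {cmod (h2_inner (shift (1, 0) h) h) | h. h \<in> S2 \<and> h2_norm h = 1}" by (intro Collect_cong) metis
  then show ?thesis unfolding num_radius_def by simp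
qed

lemma numerical_le_one:
  assumes "h \<in> S2" "h2_norm h = 1" shows "cmod (h2_inner (shift (1, 0) h) h) \<le> 1"
  using h2_Cauchy_Schwarz[OF H2_shift(1)[OF S2D(1)[OF assms(1)]] S2D(1)[OF assms(1)], of "(1, 0)"]
    H2_shift(2)[OF S2D(1)[OF assms(1)], of "(1, 0)"] assms(2) by simp

text \<open>Compactness of the torus gives the lower bound for |p| in
  \<open>numerical_radius_gap\<close>, and \<open>S2\<close> is contained in
  \<open>W\<close>.\<close>

lemma num_radius_less_one:
  assumes "\<not> has_singularity_on_torus p"
  shows "num_radius S2 (\<lambda>h. h2_proj S2 (Mz1 h)) < 1"
proof -
  have "continuous_on torus2 (\<lambda>z. cmod (bipoly_eval p z))"
    by (intro continuous_intros continuous_bipoly_eval)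
  moreover have "torus2 \<noteq> {}" by (auto simp: torus2_def intro!: exI[of _ 1])
  ultimately obtain z0 where z0: "z0 \<in> torus2" "\<And>z. z \<in> torus2 \<Longrightarrow> cmod (bipoly_eval p z0) \<le> cmod (bipoly_eval p z)"
    using continuous_attains_inf[OF compact_torus2] by metis
  moreover have "cmod (bipoly_eval p z0) > 0" using assms z0(1) by (auto simp: has_singularity_on_torus_def)
  ultimately obtain \<eta> where \<eta>: "\<eta> < 1" "\<eta> \<ge> 0"
    "\<And>h. h \<in> W \<Longrightarrow> h2_norm h = 1 \<Longrightarrow> cmod (h2_inner (shift (1, 0) h) h) \<le> \<eta>"
    using numerical_radius_gap by blast
  have "num_radius S2 (\<lambda>h. h2_proj S2 (Mz1 h)) \<le> \<eta>"
    unfolding num_radius_eq using \<eta> S2_W by (intro cSup_least) auto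
  then show ?thesis using \<eta> by simp
qed

lemma num_radius_eq_one:
  assumes cop: "bipoly_coprime p pt" and sing: "has_singularity_on_torus p"
  shows "num_radius S2 (\<lambda>h. h2_proj S2 (Mz1 h)) = 1"
proof (rule ccontr)
  let ?T = "insert 0 {cmod (h2_inner (shift (1, 0) h) h) | h. h \<in> S2 \<and> h2_norm h = 1}"
  assume ne: "num_radius S2 (\<lambda>h. h2_proj S2 (Mz1 h)) \<noteq> 1"
  have bdd: "bdd_above ?T" by (rule bdd_aboveI[of _ 1]) (use numerical_le_one in auto)
  have "Sup ?T \<le> 1" by (rule cSup_least) (use numerical_le_one in auto)
  then have w1: "Sup ?T < 1" using ne unfolding num_radius_eq by simp
  \<comment> \<open>The supremum may be 0, whereas the radius 1/w requires a positive
    \<open>w\<close>.\<close>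
  define w where "w = max (Sup ?T) (1 / 2)"
  have w: "0 < w" "w < 1" using w1 by (auto simp: w_def)
  have S2_bound: "cmod (h2_inner (shift (1, 0) g) g) \<le> w * (h2_norm g)\<^sup>2" if g: "g \<in> S2" for g
  proof (cases "h2_norm g = 0")
    case True
    then show ?thesis
      using h2_Cauchy_Schwarz[OF H2_shift(1)[OF S2D(1)[OF g]] S2D(1)[OF g], of "(1, 0)"] by simp
  next
    case False
    define a where "a = complex_of_real (1 / h2_norm g)"
    have gH: "g \<in> H2" using S2D(1)[OF g] .
    have u: "(\<lambda>k. a * g k) \<in> S2" "h2_norm (\<lambda>k. a * g k) = 1"
    proof -
      show "(\<lambda>k. a * g k) \<in> S2" by (rule S2D(4)[OF g])
      show "h2_norm (\<lambda>k. a * g k) = 1" unfolding H2_cmult(2)[OF gH] using False by (simp add: a_def norm_divide)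
    qed
    have "shift (1, 0) (\<lambda>k. a * g k) = (\<lambda>k. a * shift (1, 0) g k)" by (auto simp: shift_def)
    then have "cmod (h2_inner (shift (1, 0) (\<lambda>k. a * g k)) (\<lambda>k. a * g k)) = (cmod a)\<^sup>2 * cmod (h2_inner (shift (1, 0) g) g)"
      by (simp add: h2_inner_cmult_left h2_inner_cmult_right norm_mult power2_eq_square)
    moreover have "cmod (h2_inner (shift (1, 0) (\<lambda>k. a * g k)) (\<lambda>k. a * g k)) \<le> Sup ?T"
      using u by (intro cSup_upper[OF _ bdd]) blast
    ultimately have "(cmod a)\<^sup>2 * cmod (h2_inner (shift (1, 0) g) g) \<le> w" by (simp add: w_def)
    then show ?thesis using False by (simp add: a_def norm_divide power_divide divide_le_eq mult.commute)
  qed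
  have zz: "bipoly_eval pt (\<alpha>, \<beta>) = 0"
    if "bipoly_eval p (\<alpha>, \<beta>) = 0" "cmod \<beta> < 1" "w * cmod \<alpha> < 1" for \<alpha> \<beta>
    by (rule zero_imp_reflect_zero[OF W_numerical_bound[OF _ S2_bound] that(2,3,1)]) (use w in auto)
  obtain P where P: "\<And>z. ev2 P z = bipoly_eval p z" using poly2_of_bipoly[OF deg] by blast
  obtain Q where Q: "\<And>z. ev2 Q z = bipoly_eval pt z" using poly2_of_bipoly[OF reflect_deg_le, of m n p] by blast
  have common: "\<exists>c. r = [:[:c:]:]" if "r dvd P" "r dvd Q" for r
    using bipoly_coprime_poly2[OF cop P Q that] by blast
  have "P \<noteq> 0"
  proof
    assume "P = 0"
    then have "bipoly_eval p (0, 0) = 0" using P[of "(0, 0)"] by (simp add: ev2_def)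
    moreover have "(0, 0) \<in> bidisk" by (simp add: bidisk_def)
    ultimately show False using nz by blast
  qed
  moreover have "degree r = 0" if "r dvd P" "r dvd Q" for r using common[OF that] by auto
  ultimately obtain A B R where R: "R \<noteq> 0" "A * P + B * Q = [:R:]" by (rule poly2_Bezout)
  \<comment> \<open>The second coordinates of common zeros are roots of the nonzero polynomial
    \<open>R\<close>, hence finite in number.\<close>
  have Rz: "poly R \<beta> = 0" if "bipoly_eval p (\<alpha>, \<beta>) = 0" "bipoly_eval pt (\<alpha>, \<beta>) = 0" for \<alpha> \<beta>
  proof -
    have "ev2 (A * P + B * Q) (\<alpha>, \<beta>) = 0" using that by (simp add: ev2_add ev2_mult P Q)
    then show ?thesis unfolding R(2) by (simp add: ev2_def)
  qed
  obtain \<tau>1 \<tau>2 where \<tau>: "cmod \<tau>1 = 1" "cmod \<tau>2 = 1" "bipoly_eval p (\<tau>1, \<tau>2) = 0"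
    using sing by (auto simp: has_singularity_on_torus_def torus2_def)
  have \<tau>0: "\<tau>2 \<noteq> 0" using \<tau>(2) by auto
  \<comment> \<open>Points of modulus at least 1/w have at least this distance from the unimodular
    \<tau>1.\<close>
  define e where "e = 1 / w - 1"
  have e: "e > 0" using w by (simp add: e_def field_simps)
  have cont: "isCont (bipoly_eval p) u" for u
    using continuous_bipoly_eval[of UNIV p] by (cases u) (simp add: continuous_on_eq_continuous_at)
  \<comment> \<open>For \<open>s\<close> near 1 the zeros of the section at z2 = s \<tau>2 stay away
    from \<tau>1 by \<open>e\<close>, so its values are controlled by the one at \<tau>1, which
    tends to p(\<tau>1, \<tau>2) = 0.\<close>
  have p0: "bipoly_eval p (z, \<tau>2) = 0" for z
  proof -
    have "\<forall>\<^sub>F s in at_left 1. cmod (bipoly_eval p (z, of_real s * \<tau>2))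
        \<le> cmod (bipoly_eval p (\<tau>1, of_real s * \<tau>2)) * (1 + cmod (z - \<tau>1) / e) ^ m"
      using eventually_dilation_not_root[OF R(1) \<tau>0] eventually_unit_interval
    proof eventually_elim
      case (elim s)
      then have s: "0 < s" "s < 1" "poly R (of_real s * \<tau>2) \<noteq> 0" by auto
      obtain f where f: "degree f \<le> m" "\<And>x. poly f x = bipoly_eval p (x, of_real s * \<tau>2)"
        using bipoly_section1[OF deg] by blast
      have "e \<le> cmod (\<tau>1 - x)" if "poly f x = 0" for x
      proof -
        have "\<not> w * cmod x < 1"
          using zz[of x "of_real s * \<tau>2"] Rz[of x "of_real s * \<tau>2"] that s \<tau>(2) by (auto simp: f norm_mult)
        then have "1 / w \<le> cmod x" using w by (simp add: field_simps)
        then show ?thesis using norm_triangle_ineq2[of x \<tau>1] \<tau>(1) by (simp add: e_def norm_minus_commute)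
      qed
      from poly_bound_away_from_roots[OF f(1) e this, of z] show ?case by (simp add: f)
    qed
    moreover have "((\<lambda>s. cmod (bipoly_eval p (z, of_real s * \<tau>2))) \<longlongrightarrow> cmod (bipoly_eval p (z, of_real 1 * \<tau>2))) (at_left 1)"
      by (intro tendsto_norm isCont_tendsto_compose[OF cont] tendsto_intros)
    moreover have "((\<lambda>s. cmod (bipoly_eval p (\<tau>1, of_real s * \<tau>2)) * (1 + cmod (z - \<tau>1) / e) ^ m)
        \<longlongrightarrow> cmod (bipoly_eval p (\<tau>1, of_real 1 * \<tau>2)) * (1 + cmod (z - \<tau>1) / e) ^ m) (at_left 1)"
      by (intro tendsto_mult tendsto_const tendsto_norm isCont_tendsto_compose[OF cont] tendsto_intros)
    ultimately have "cmod (bipoly_eval p (z, of_real 1 * \<tau>2))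
        \<le> cmod (bipoly_eval p (\<tau>1, of_real 1 * \<tau>2)) * (1 + cmod (z - \<tau>1) / e) ^ m"
      by (intro tendsto_le[OF trivial_limit_at_left_real])
    then show ?thesis using \<tau>(3) by simp
  qed
  \<comment> \<open>A nonconstant common factor contradicts coprimality. For p~ the vanishing comes
    from |p~| = |p|, hence on the unit circle.\<close>
  have "[:[:-\<tau>2, 1:]:] dvd P" using p0 by (intro linear_factor_dvd) (simp add: P)
  moreover have "bipoly_eval pt (z, \<tau>2) = 0" if "cmod z = 1" for z
    using reflect_eval_norm[OF deg, of "(z, \<tau>2)"] p0 that \<tau>(2) by (simp add: torus2_def)
  then have "[:[:-\<tau>2, 1:]:] dvd Q" by (intro linear_factor_dvd) (simp add: Q)
  ultimately obtain c where "[:[:-\<tau>2, 1:]:] = [:[:c:]:]" using common by blast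
  then show False by simp
qed

end

theorem theorem3p7:
  fixes p :: "nat \<times> nat \<Rightarrow> complex" and m n :: nat
    and S1 S2 :: "(nat \<times> nat \<Rightarrow> complex) set"
  assumes p_poly: "bipoly_deg_le p m n"
    and p_nozero: "\<forall>z\<in>bidisk. bipoly_eval p z \<noteq> 0"
    and coprime: "bipoly_coprime p (reflect m n p)"
    and degree: "rat_degree (reflect m n p) p m n"
    and S1_closed: "h2_closed_subspace S1"
    and S2_closed: "h2_closed_subspace S2"
    and orth: "\<forall>f\<in>S1. \<forall>g\<in>S2. h2_inner f g = 0"
    and decomp: "model_space (rif m n p) = {(\<lambda>k. f k + g k) | f g. f \<in> S1 \<and> g \<in> S2}"
    and S1_inv: "Mz1 ` S1 \<subseteq> S1"
    and S2_inv: "Mz2 ` S2 \<subseteq> S2"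
  shows "num_radius S2 (\<lambda>h. h2_proj S2 (Mz1 h)) = 1 \<longleftrightarrow> has_singularity_on_torus p"
proof -
  interpret agler_decomposition p m n S1 S2
    by unfold_locales (fact assms)+
  show ?thesis using num_radius_less_one num_radius_eq_one[OF coprime] by fastforce
qed

end
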